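(* Let $d\ge2$, $m\ge0$, $\phi_m(r)=(r^2+m^2)^{1/2}$, and assume $(w,\psi,\phi_m)$ satisfies the standing assumption (stated in the context) in dimension $d$. Then $$\widetilde C_d(w,\psi,m)\le C_d(w,\psi,\phi_m)=2\,C_d(w,\phi_m^{1/2}\psi,r^2).$$ Furthermore, when $d=2$ or $d=3$, also $$C_d(w,\phi_m^{1/2}\psi,r^2)=\tfrac12\,C_d(w,\psi,\phi_m)\le\widetilde C_d(w,\psi,m).$$
   Context: Fourier transform: $\hat f(\xi)=\int_{\mathbb R^d}f(x)e^{-ix\cdot\xi}\,dx$; for a function $\psi$ on $(0,\infty)$, $\psi(|D|)$ is the Fourier multiplier with symbol $\psi(|\xi|)$; $D_j$ is the Fourier multiplier with symbol $\xi_j$. $\mathbb N=\{0,1,2,\dots\}$. Standing assumption on $(w,\psi,\phi)$ in dimension $d\ge2$: (1) $w:(0,\infty)\to[0,\infty)$ is such that $\varphi\mapsto\int_{\mathbb R^d}w(|x|)\varphi(x)\,dx$ is a tempered distribution, and there is a function $F_w:(0,\infty)\to\mathbb R$ with $\int_{\mathbb R^d} w(|x|)\hat\varphi(x)\,dx=\int_{\mathbb R^d}F_w(|\xi|^2/2)\varphi(\xi)\,d\xi$ for all Schwartz $\varphi$; moreover, for each $k\in\mathbb N$, $r\mapsto\int_{-1}^1F_w(r^2(1-t))p_{d,k}(t)(1-t^2)^{(d-3)/2}\,dt$ is (well defined and) continuous on $(0,\infty)$. (2) $\psi:(0,\infty)\to[0,\infty)$ is continuous. (3) $\phi:(0,\infty)\to(0,\infty)$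 is $C^1$ with $\phi'(r)>0$ for all $r>0$. Here $p_{d,k}$ is the Legendre polynomial of degree $k$ in $d$ dimensions: $(1-t^2)^{\frac{d-3}2}p_{d,k}(t)=(-1)^k\frac{\Gamma(\frac{d-1}2)}{2^k\Gamma(k+\frac{d-1}2)}\frac{d^k}{dt^k}(1-t^2)^{k+\frac{d-3}2}$. $C_d(w,\psi,\phi)\in[0,\infty]$ is the optimal constant of the smoothing estimate for the Schrödinger-type equation, i.e. the supremum over $f\in L^2(\mathbb R^d)$, $\|f\|_2=1$, of $\int_{\mathbb R}\int_{\mathbb R^d}|\psi(|D|)e^{-it\phi(|D|)}f(x)|^2w(|x|)\,dx\,dt$; writing $r^2$ in the third slot means $\phi(r)=r^2$. Dirac equation: $N=2^{\lfloor(d+1)/2\rfloor}$, $H_m=\sum_{j=1}^d\alpha_jD_j+m\beta$, where $\alpha_1,\dots,\alpha_d,\alpha_{d+1}=\beta$ are $N\times N$ Hermitian matrices with $\alpha_j\alpha_k+\alpha_k\alpha_j=2\delta_{jk}I_N$. $\widetilde C_d(w,\psi,m)\in[0,\infty]$ is the supremum over $f\in L^2(\mathbb R^d,\mathbb C^N)$, $\|f\|_2=1$, of $\int_{\mathbb R}\int_{\mathbb R^d}|\psi(|D|)e^{-itH_m}f(x)|^2w(|x|)\,dx\,dt$. Convention: these integrals are defined directly when $\hat f$ has compact support in $\mathbb R^d\setminus\{0\}$, and, when the corresponding estimate holds with a finite constant, for all $f\in L^2$ by continuous extension; the suprema may equivalently be taken over such $f$ with compactly supported $\hat f$. *)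

theory Defs
  imports "HOL-Analysis.Analysis"
begin

section \<open>The Fourier transform\<close>

definition fourier :: "(real^'n \<Rightarrow> complex) \<Rightarrow> real^'n \<Rightarrow> complex" where
  "fourier f \<xi> = (LINT x|lebesgue. f x * exp (- \<i> * of_real (x \<bullet> \<xi>)))"

definition inv_fourier :: "(real^'n \<Rightarrow> complex) \<Rightarrow> real^'n \<Rightarrow> complex" where
  "inv_fourier h x =
     (LINT \<xi>|lebesgue. h \<xi> * exp (\<i> * of_real (x \<bullet> \<xi>))) / of_real ((2 * pi) ^ CARD('n))"

text \<open>The square of the $L^2$ norm, with value in $[0,\infty]$.\<close>

definition L2_norm_sq :: "(real^'n \<Rightarrow> 'b::real_normed_vector) \<Rightarrow> ennreal" where
  "L2_norm_sq f = (\<integral>\<^sup>+x. ennreal ((norm (f x))\<^sup>2) \<partial>lebesgue)"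

definition in_L2 :: "(real^'n \<Rightarrow> 'b::real_normed_vector) \<Rightarrow> bool" where
  "in_L2 f \<longleftrightarrow> f \<in> borel_measurable lebesgue \<and> L2_norm_sq f < \<infinity>"

text \<open>
  \<open>has_L2_fourier f g\<close>: the function \<open>g\<close> represents the Fourier transform of \<open>f\<close>, in the sense
  of the extension of \<^const>\<open>fourier\<close> by continuity from $L^1 \cap L^2$ to $L^2$.
\<close>

definition has_L2_fourier ::
  "(real^'n \<Rightarrow> complex) \<Rightarrow> (real^'n \<Rightarrow> complex) \<Rightarrow> bool" where
  "has_L2_fourier f g \<longleftrightarrow> in_L2 f \<and> in_L2 g \<and>
     (\<exists>F. (\<forall>n::nat. integrable lebesgue (F n) \<and> in_L2 (F n)) \<and>
          (\<lambda>n. L2_norm_sq (\<lambda>x. F n x - f x)) \<longlonglongrightarrow> 0 \<and>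
          (\<lambda>n. L2_norm_sq (\<lambda>\<xi>. fourier (F n) \<xi> - g \<xi>)) \<longlonglongrightarrow> 0)"

definition compact_support_off_0 :: "(real^'n \<Rightarrow> 'b::zero) \<Rightarrow> bool" where
  "compact_support_off_0 g \<longleftrightarrow>
     (\<exists>K. compact K \<and> 0 \<notin> K \<and> (AE \<xi> in lebesgue. \<xi> \<notin> K \<longrightarrow> g \<xi> = 0))"


section \<open>Schwartz functions and tempered distributions\<close>

text \<open>Iterated partial derivatives; the list of coordinates plays the role of a multi-index.\<close>

primrec partials :: "'n list \<Rightarrow> (real^'n \<Rightarrow> complex) \<Rightarrow> real^'n \<Rightarrow> complex" where
  "partials [] f = f"
| "partials (j # js) f = (\<lambda>x. frechet_derivative (partials js f) (at x) (axis j 1))"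

definition schwartz :: "(real^'n \<Rightarrow> complex) \<Rightarrow> bool" where
  "schwartz f \<longleftrightarrow>
     (\<forall>js x. partials js f differentiable (at x)) \<and>
     (\<forall>k js. bounded (range (\<lambda>x. norm x ^ k *\<^sub>R partials js f x)))"

definition schwartz_norm :: "nat \<Rightarrow> (real^'n \<Rightarrow> complex) \<Rightarrow> real" where
  "schwartz_norm N f =
     (\<Sum>k\<le>N. \<Sum>js\<in>{js. length js \<le> N}. SUP x. norm x ^ k * norm (partials js f x))"

definition tempered_distribution :: "((real^'n \<Rightarrow> complex) \<Rightarrow> complex) \<Rightarrow> bool" where
  "tempered_distribution T \<longleftrightarrow>
     (\<forall>f g c. schwartz f \<longrightarrow> schwartz g \<longrightarrow> T (\<lambda>x. c * f x + g x) = c * T f + T g) \<and>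
     (\<exists>N C. \<forall>f. schwartz f \<longrightarrow> norm (T f) \<le> C * schwartz_norm N f)"


section \<open>The standing assumption\<close>

text \<open>
  The Legendre polynomial of degree \<open>k\<close> in \<open>d\<close> dimensions, by Rodrigues' formula. Only its values
  on $(-1,1)$ are meaningful here: outside this interval the \<open>powr\<close> expression is not the
  polynomial.
\<close>

definition legendre :: "nat \<Rightarrow> nat \<Rightarrow> real \<Rightarrow> real" where
  "legendre d k t =
     (-1) ^ k * Gamma ((real d - 1) / 2) / (2 ^ k * Gamma (real k + (real d - 1) / 2)) *
     (deriv ^^ k) (\<lambda>s. (1 - s\<^sup>2) powr (real k + (real d - 3) / 2)) t /
     (1 - t\<^sup>2) powr ((real d - 3) / 2)"

text \<open>
  Functions on $(0,\infty)$ are total functions on the reals of which only the values at positive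
  arguments are used (up to null sets, in integrals over the whole space).
\<close>

definition weight_assumption :: "'n::finite itself \<Rightarrow> (real \<Rightarrow> real) \<Rightarrow> bool" where
  "weight_assumption _ w \<longleftrightarrow>
     (\<forall>r>0. w r \<ge> 0) \<and>
     (\<forall>f :: real^'n \<Rightarrow> complex. schwartz f \<longrightarrow>
        integrable lebesgue (\<lambda>x. of_real (w (norm x)) * f x)) \<and>
     tempered_distribution
       (\<lambda>f :: real^'n \<Rightarrow> complex. LINT x|lebesgue. of_real (w (norm x)) * f x) \<and>
     (\<exists>F :: real \<Rightarrow> real.
        (\<forall>f :: real^'n \<Rightarrow> complex. schwartz f \<longrightarrow>
           integrable lebesgue (\<lambda>\<xi>. of_real (F ((norm \<xi>)\<^sup>2 / 2)) * f \<xi>) \<and>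
           (LINT x|lebesgue. of_real (w (norm x)) * fourier f x) =
           (LINT \<xi>|lebesgue. of_real (F ((norm \<xi>)\<^sup>2 / 2)) * f \<xi>)) \<and>
        (\<forall>k. (\<forall>r>0. set_integrable lebesgue {-1<..<1}
                 (\<lambda>t. F (r\<^sup>2 * (1 - t)) * legendre CARD('n) k t *
                      (1 - t\<^sup>2) powr ((real CARD('n) - 3) / 2))) \<and>
             continuous_on {0<..} (\<lambda>r. LINT t:{-1<..<1}|lebesgue.
                 F (r\<^sup>2 * (1 - t)) * legendre CARD('n) k t *
                 (1 - t\<^sup>2) powr ((real CARD('n) - 3) / 2))))"

definition standing_assumption ::
  "'n::finite itself \<Rightarrow> (real \<Rightarrow> real) \<Rightarrow> (real \<Rightarrow> real) \<Rightarrow> (real \<Rightarrow> real) \<Rightarrow> bool" where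
  "standing_assumption _ w \<psi> \<phi> \<longleftrightarrow>
     weight_assumption TYPE('n) w \<and>
     continuous_on {0<..} \<psi> \<and> (\<forall>r>0. \<psi> r \<ge> 0) \<and>
     (\<forall>r>0. \<phi> r > 0) \<and>
     (\<exists>\<phi>'. continuous_on {0<..} \<phi>' \<and>
        (\<forall>r>0. (\<phi> has_real_derivative \<phi>' r) (at r) \<and> \<phi>' r > 0))"


section \<open>Optimal constants\<close>

text \<open>
  The suprema are taken over $f$ with Fourier transform \<open>g\<close> compactly supported away from the
  origin. For these, \<open>g\<close> times the (locally bounded) symbol is integrable, so the multiplier
  applied to $f$ is given pointwise by the inverse Fourier integral.
\<close>

definition schrodinger_evolution ::
  "(real \<Rightarrow> real) \<Rightarrow> (real \<Rightarrow> real) \<Rightarrow> (real^'n \<Rightarrow> complex) \<Rightarrow> real \<Rightarrow> real^'n \<Rightarrow> complex" where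
  "schrodinger_evolution \<psi> \<phi> g t =
     inv_fourier (\<lambda>\<xi>. of_real (\<psi> (norm \<xi>)) * exp (- \<i> * of_real (t * \<phi> (norm \<xi>))) * g \<xi>)"

definition smoothing_const ::
  "'n::finite itself \<Rightarrow> (real \<Rightarrow> real) \<Rightarrow> (real \<Rightarrow> real) \<Rightarrow> (real \<Rightarrow> real) \<Rightarrow> ennreal" where
  "smoothing_const _ w \<psi> \<phi> =
     (SUP (f, g) \<in> {(f :: real^'n \<Rightarrow> complex, g).
          has_L2_fourier f g \<and> L2_norm_sq f = 1 \<and> compact_support_off_0 g}.
        \<integral>\<^sup>+t. \<integral>\<^sup>+x. ennreal ((norm (schrodinger_evolution \<psi> \<phi> g t x))\<^sup>2 * w (norm x))
          \<partial>lebesgue \<partial>lebesgue)"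

definition hermitian :: "complex^'N^'N \<Rightarrow> bool" where
  "hermitian A \<longleftrightarrow> (\<forall>i j. A $ i $ j = cnj (A $ j $ i))"

definition dirac_matrices :: "('n \<Rightarrow> complex^'N^'N) \<Rightarrow> complex^'N^'N \<Rightarrow> bool" where
  "dirac_matrices \<alpha> \<beta> \<longleftrightarrow>
     (\<forall>j. hermitian (\<alpha> j)) \<and> hermitian \<beta> \<and>
     (\<forall>j k. \<alpha> j ** \<alpha> k + \<alpha> k ** \<alpha> j = (if j = k then mat 2 else 0)) \<and>
     (\<forall>j. \<alpha> j ** \<beta> + \<beta> ** \<alpha> j = 0) \<and>
     \<beta> ** \<beta> + \<beta> ** \<beta> = mat 2"

text \<open>The exponential series with respect to the matrix product.\<close>

definition matrix_exp :: "complex^'N^'N \<Rightarrow> complex^'N^'N" where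
  "matrix_exp A = (\<Sum>n. (1 / fact n) *\<^sub>R (((**) A) ^^ n) (mat 1))"

definition dirac_symbol ::
  "('n::finite \<Rightarrow> complex^'N^'N) \<Rightarrow> complex^'N^'N \<Rightarrow> real \<Rightarrow> real^'n \<Rightarrow> complex^'N^'N" where
  "dirac_symbol \<alpha> \<beta> m \<xi> = (\<Sum>j\<in>UNIV. (\<xi> $ j) *\<^sub>R \<alpha> j) + m *\<^sub>R \<beta>"

definition dirac_evolution ::
  "('n::finite \<Rightarrow> complex^'N^'N) \<Rightarrow> complex^'N^'N \<Rightarrow> real \<Rightarrow> (real \<Rightarrow> real) \<Rightarrow>
   (real^'n \<Rightarrow> complex^'N) \<Rightarrow> real \<Rightarrow> real^'n \<Rightarrow> complex^'N" where
  "dirac_evolution \<alpha> \<beta> m \<psi> g t x =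
     (\<chi> i. inv_fourier (\<lambda>\<xi>. of_real (\<psi> (norm \<xi>)) *
        (matrix_exp (mat (- \<i> * of_real t) ** dirac_symbol \<alpha> \<beta> m \<xi>) *v g \<xi>) $ i) x)"

definition dirac_smoothing_const ::
  "('n::finite \<Rightarrow> complex^'N^'N) \<Rightarrow> complex^'N^'N \<Rightarrow>
   (real \<Rightarrow> real) \<Rightarrow> (real \<Rightarrow> real) \<Rightarrow> real \<Rightarrow> ennreal" where
  "dirac_smoothing_const \<alpha> \<beta> w \<psi> m =
     (SUP (f, g) \<in> {(f :: real^'n \<Rightarrow> complex^'N, g).
          (\<forall>i. has_L2_fourier (\<lambda>x. f x $ i) (\<lambda>\<xi>. g \<xi> $ i)) \<and>
          L2_norm_sq f = 1 \<and> compact_support_off_0 g}.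
        \<integral>\<^sup>+t. \<integral>\<^sup>+x. ennreal ((norm (dirac_evolution \<alpha> \<beta> m \<psi> g t x))\<^sup>2 * w (norm x))
          \<partial>lebesgue \<partial>lebesgue)"

definition rel_dispersion :: "real \<Rightarrow> real \<Rightarrow> real" where
  "rel_dispersion m r = sqrt (r\<^sup>2 + m\<^sup>2)"

end

theory Submission
  imports Defs "HOL-Probability.Probability"
begin

text \<open>
  Fix \<open>x\<close> and let \<open>G\<close> be the density of the push-forward of
  $\hat f(\xi) e^{i x\cdot\xi}\,d\xi$ under $\xi \mapsto |\xi|$. After the substitution
  $s = \phi(r)$, Plancherel's theorem in the time variable turns the time integral of
  $|\psi(|D|) e^{-it\phi(|D|)} f(x)|^2$ into a constant times
  $\int_0^\infty \psi(r)^2 |G(r)|^2 / \phi'(r)\,dr$. Hence only $\psi^2/\phi'$ matters, which gives the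
  equality of the two Schroedinger constants, already for each single initial datum.

  For the Dirac equation put $S = H_m/\phi_m$ on the Fourier side, a Hermitian involution, so that
  $e^{-itH_m} = e^{-it\phi_m} P_+ + e^{it\phi_m} P_-$ with $P_\pm = (1 \pm S)/2$. As
  $\phi_m > 0$, the two parts have disjoint time frequencies and are orthogonal in $L^2(dt)$ at each
  \<open>x\<close>, so the Dirac functional of \<open>g\<close> is $Q(P_+ g) + Q(P_- g)$, where \<open>Q\<close> is the scalar
  functional. The upper bound follows from $\|P_+ g\|^2 + \|P_- g\|^2 = \|g\|^2$, and the lower
  bound from $Q(u + v) \le 2 (Q(u) + Q(v))$ applied to data with a single nonzero component.
\<close>

section \<open>Gaussians and changes of variables\<close>

text \<open>The overview takes three analytic facts for granted. The density \<open>G\<close> has to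
  be a square integrable function: the image of Lebesgue measure under the norm has a density, which
  gives \<open>G\<close> by Radon-Nikodym, and duality with truncations bounds its L^2 norm.
  Plancherel's theorem is used in time and in space; it comes from Gaussian means of
  \<open>|ft u|^2\<close>, whose limit is the value at 0 of the autocorrelation of \<open>u\<close>,
  attained because translations are continuous in L^2. Finally, the suprema range over pairs of a
  datum and its transform, while the projections act on the transform alone, so every transform
  built that way must be shown to belong to a datum of the right norm; this is Fourier inversion in
  L^2. Integrating in time at fixed \<open>x\<close> rests on Tonelli and so on measurability of the
  weight, which the standing assumption yields only through integrals against Schwartz functions; a
  Gaussian, having no zeros, recovers it. The factor 2 between the two scalar constants comes from
  the derivatives r / \<open>rel_dispersion m r\<close> and 2 r of the two dispersions.\<close>

definition gauss :: "'a::euclidean_space \<Rightarrow> real" where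
  "gauss z = exp (- (norm z)\<^sup>2 / 2)"

lemma gauss_prod: "gauss (z::'a::euclidean_space) = (\<Prod>b\<in>Basis. exp (- (z \<bullet> b)\<^sup>2 / 2))"
proof -
  have "(norm z)\<^sup>2 = (\<Sum>b\<in>Basis. (z \<bullet> b)\<^sup>2)"
    unfolding power2_norm_eq_inner euclidean_inner[of z z] by (simp only: power2_eq_square)
  then show ?thesis
    by (simp add: gauss_def exp_sum[symmetric] sum_negf sum_divide_distrib)
qed

lemma gauss_measurable[measurable]: "gauss \<in> borel_measurable borel"
  unfolding gauss_def[abs_def] by measurable

lemma gauss_pos: "gauss z > 0" and gauss_le_1: "gauss z \<le> 1" and gauss_0: "gauss 0 = 1"
  and gauss_uminus: "gauss (- z) = gauss z"
  by (auto simp: gauss_def)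

lemma measurable_cis[measurable]: "cis \<in> borel_measurable borel"
  by (intro borel_measurable_continuous_onI continuous_on_cis continuous_on_id)

text \<open>Up to the factor sqrt (2 pi) the integral is the characteristic function of the standard
  normal distribution.\<close>

lemma gauss_1d:
  fixes y :: real
  shows "integrable lborel (\<lambda>t::real. complex_of_real (exp (- t\<^sup>2 / 2)) * cis (t * y))"
    and "(LINT t|lborel. complex_of_real (exp (- t\<^sup>2 / 2)) * cis (t * y))
       = of_real (sqrt (2 * pi) * exp (- y\<^sup>2 / 2))"
proof -
  have eq: "complex_of_real (exp (- t\<^sup>2 / 2)) * cis (t * y)
      = of_real (sqrt (2*pi)) * (std_normal_density t *\<^sub>R iexp (y * t))" for t
    by (simp add: std_normal_density_def cis_conv_exp scaleR_conv_of_real mult.commute[of t y])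
  have int: "integrable lborel (\<lambda>t. std_normal_density t *\<^sub>R iexp (y * t))"
  proof (rule Bochner_Integration.integrable_bound)
    show "integrable lborel std_normal_density" by (rule integrable_normal_density) simp
  qed auto
  show "integrable lborel (\<lambda>t::real. complex_of_real (exp (- t\<^sup>2 / 2)) * cis (t * y))"
    unfolding eq by (intro integrable_mult_right int)
  have "char std_normal_distribution y = (LINT t|lborel. std_normal_density t *\<^sub>R iexp (y * t))"
    unfolding char_def by (subst integral_density) auto
  then have "(LINT t|lborel. std_normal_density t *\<^sub>R iexp (y * t)) = of_real (exp (- y\<^sup>2 / 2))"
    by (simp add: char_std_normal_distribution)
  then show "(LINT t|lborel. complex_of_real (exp (- t\<^sup>2 / 2)) * cis (t * y))
       = of_real (sqrt (2 * pi) * exp (- y\<^sup>2 / 2))"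
    unfolding eq integral_mult_right_zero by simp
qed

text \<open>In coordinates the integrand is a product of the integrands of \<open>gauss_1d\<close>,
  and Lebesgue measure is the image of a product measure under the coordinate map, so the integral
  factors.\<close>

lemma gauss_fourier:
  fixes y :: "'a::euclidean_space"
  shows "integrable lborel (\<lambda>t::'a. of_real (gauss t) * cis (t \<bullet> y))"
    and "(LINT t|lborel. of_real (gauss t) * cis (t \<bullet> y))
       = of_real (sqrt (2 * pi) ^ DIM('a) * gauss y)"
proof -
  interpret product_sigma_finite "\<lambda>_::'a. lborel :: real measure" by standard
  let ?f = "\<lambda>b s. complex_of_real (exp (- s\<^sup>2 / 2)) * cis (s * (y \<bullet> b))"
  have cis_sum: "cis (\<Sum>b\<in>Basis. h b) = (\<Prod>b\<in>Basis. cis (h b))" for h :: "'a \<Rightarrow> real"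
    by (induction "Basis :: 'a set" rule: infinite_finite_induct) (auto simp: cis_conv_exp exp_sum sum_distrib_left)
  have eq: "of_real (gauss t) * cis (t \<bullet> y) = (\<Prod>b\<in>Basis. ?f b (t \<bullet> b))" for t
    by (simp add: gauss_prod prod.distrib euclidean_inner[of t y] cis_sum)
  have eq2: "(\<Prod>b\<in>Basis. ?f b ((\<Sum>c\<in>Basis. f c *\<^sub>R c) \<bullet> b)) = (\<Prod>b\<in>Basis. ?f b (f b))" for f :: "'a \<Rightarrow> real"
    by (intro prod.cong refl) simp
  have m: "(\<lambda>t::'a. of_real (gauss t) * cis (t \<bullet> y)) \<in> borel_measurable borel"
    by measurable
  have [measurable]: "(\<lambda>f::'a\<Rightarrow>real. \<Sum>c\<in>Basis. f c *\<^sub>R c) \<in> borel_measurable (\<Pi>\<^sub>M b\<in>Basis. lborel)"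
    by measurable
  show "integrable lborel (\<lambda>t::'a. of_real (gauss t) * cis (t \<bullet> y))"
    apply (subst lborel_eq)
    apply (subst integrable_distr_eq)
      apply simp apply (use m in simp)
    unfolding eq eq2
    by (rule product_integrable_prod) (rule finite_Basis, rule gauss_1d(1))
  show "(LINT t|lborel. of_real (gauss t) * cis (t \<bullet> y))
       = of_real (sqrt (2 * pi) ^ DIM('a) * gauss y)"
    apply (subst lborel_eq)
    apply (subst integral_distr)
      apply simp apply (use m in simp)
    unfolding eq eq2
    apply (subst product_integral_prod)
      apply (rule finite_Basis)
     apply (rule gauss_1d(1))
    unfolding gauss_1d(2) gauss_prod of_real_prod of_real_mult prod.distrib
    by simp
qed

lemma gauss_integral:
  shows "integrable lborel (gauss :: 'a::euclidean_space \<Rightarrow> real)"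
    and "(LINT t|lborel. gauss (t::'a)) = sqrt (2 * pi) ^ DIM('a)"
proof -
  have c: "integrable lborel (\<lambda>t::'a. complex_of_real (gauss t))"
    "(LINT t|lborel. complex_of_real (gauss (t::'a))) = of_real (sqrt (2 * pi) ^ DIM('a))"
    using gauss_fourier[of "0::'a"] by (simp_all add: gauss_0)
  then show "integrable lborel (gauss :: 'a \<Rightarrow> real)"
    by (simp only: complex_of_real_integrable_eq)
  show "(LINT t|lborel. gauss (t::'a)) = sqrt (2 * pi) ^ DIM('a)"
    using c(2) unfolding integral_complex_of_real of_real_eq_iff .
qed

lemma lborel_integral_scale:
  fixes f :: "'a::euclidean_space \<Rightarrow> 'b::{banach,second_countable_topology}"
  assumes "c > 0" and [measurable]: "f \<in> borel_measurable borel"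
  shows "(LINT x|lborel. f x) = c ^ DIM('a) *\<^sub>R (LINT x|lborel. f (c *\<^sub>R x))"
    and "integrable lborel f \<longleftrightarrow> integrable lborel (\<lambda>x. f (c *\<^sub>R x))"
proof -
  have [simp]: "integrable lborel (\<lambda>x. r *\<^sub>R h x) \<longleftrightarrow> integrable lborel h" if "r > 0" for r and h :: "'a \<Rightarrow> 'b"
    using integrable_scaleR_right[of "inverse r" lborel "\<lambda>x. r *\<^sub>R h x"] that
      integrable_scaleR_right[of r lborel h] by auto
  have l: "lborel = density (distr lborel borel (\<lambda>x::'a. c *\<^sub>R x)) (\<lambda>_. c^DIM('a))"
    using lborel_affine[of c "0::'a"] assms by simp
  show "(LINT x|lborel. f x) = c ^ DIM('a) *\<^sub>R (LINT x|lborel. f (c *\<^sub>R x))"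
    apply (subst l)
    apply (subst integral_density)
    using assms by (auto simp: integral_distr)
  show "integrable lborel f \<longleftrightarrow> integrable lborel (\<lambda>x. f (c *\<^sub>R x))"
    apply (subst l)
    apply (subst integrable_density)
    using assms by (simp_all add: integrable_distr_eq)
qed

lemma lborel_integral_shift:
  fixes f :: "'a::euclidean_space \<Rightarrow> 'b::{banach,second_countable_topology}"
  assumes [measurable]: "f \<in> borel_measurable borel"
  shows "(LINT x|lborel. f (x + a)) = (LINT x|lborel. f x)"
    and "integrable lborel (\<lambda>x. f (x + a)) \<longleftrightarrow> integrable lborel f"
proof -
  have l: "lborel = distr lborel borel (\<lambda>x::'a. x + a)"
    using lborel_distr_plus[of a] unfolding add.commute[of a] by (rule sym)
  show "(LINT x|lborel. f (x + a)) = (LINT x|lborel. f x)"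
    apply (subst (2) l)
    by (subst integral_distr) auto
  show "integrable lborel (\<lambda>x. f (x + a)) \<longleftrightarrow> integrable lborel f"
    apply (subst (2) l)
    by (subst integrable_distr_eq) auto
qed

lemma lborel_nn_integral_shift:
  fixes f :: "'a::euclidean_space \<Rightarrow> ennreal"
  assumes [measurable]: "f \<in> borel_measurable borel"
  shows "(\<integral>\<^sup>+x. f (x + a) \<partial>lborel) = (\<integral>\<^sup>+x. f x \<partial>lborel)"
proof -
  have l: "lborel = distr lborel borel (\<lambda>x::'a. x + a)"
    using lborel_distr_plus[of a] unfolding add.commute[of a] by (rule sym)
  show ?thesis
    apply (subst (2) l)
    by (subst nn_integral_distr) auto
qed

section \<open>Continuity of translations in $L^2$\<close>

text \<open>The counterpart of \<open>L2_norm_sq\<close> for Borel functions. An arbitrary Euclidean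
  space is allowed because it is applied to functions on \<open>real^'n\<close> as well as to
  functions of the radius, the time and the time frequency.\<close>

definition norm_sq :: "('a::euclidean_space \<Rightarrow> 'b::real_normed_vector) \<Rightarrow> ennreal" where
  "norm_sq u = (\<integral>\<^sup>+x. ennreal ((norm (u x))\<^sup>2) \<partial>lborel)"

lemma norm_sq_shift:
  fixes u :: "'a::euclidean_space \<Rightarrow> complex"
  assumes [measurable]: "u \<in> borel_measurable borel"
  shows "norm_sq (\<lambda>s. u (s + y)) = norm_sq u"
  unfolding norm_sq_def by (rule lborel_nn_integral_shift) measurable

lemma norm_sq_minus_commute: "norm_sq (\<lambda>x. u x - v x) = norm_sq (\<lambda>x. v x - u x)"
  by (simp add: norm_sq_def norm_minus_commute)

lemma ennreal_tendsto_0I: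
  fixes f :: "'c \<Rightarrow> ennreal"
  assumes "\<And>e::real. e > 0 \<Longrightarrow> eventually (\<lambda>x. f x < ennreal e) F"
  shows "(f \<longlongrightarrow> 0) F"
proof (rule order_tendstoI)
  fix a :: ennreal assume "0 < a"
  then obtain z where z: "0 < z" "z < a" using dense by blast
  then obtain e where "z = ennreal e" "e > 0" by (cases z) auto
  with assms[of e] z show "eventually (\<lambda>x. f x < a) F"
    by (auto elim!: eventually_mono)
qed auto

text \<open>Formulated along sequences of shifts, the setting of the dominated convergence theorem
  by which it is proved.\<close>

definition translation_continuous :: "('a::euclidean_space \<Rightarrow> complex) \<Rightarrow> bool" where
  "translation_continuous u \<longleftrightarrow>
     (\<forall>Y. Y \<longlonglongrightarrow> 0 \<longrightarrow> (\<lambda>n::nat. norm_sq (\<lambda>s. u (s + Y n) - u s)) \<longlonglongrightarrow> 0)"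

text \<open>Young's inequality: the gap between the two sides is pointwise at least (d |a| - |b|)^2
  / d. The parameter \<open>d\<close> stays free so that it can tend to 0 in
  \<open>norm_sq_ft_limit_le\<close>, where the exact constant matters.\<close>

lemma norm_sq_add_le:
  fixes u v :: "'a::euclidean_space \<Rightarrow> complex"
  assumes [measurable]: "u \<in> borel_measurable borel" "v \<in> borel_measurable borel" and d: "d > 0"
  shows "norm_sq (\<lambda>x. u x + v x) \<le> ennreal (1 + d) * norm_sq u + ennreal (1 + 1 / d) * norm_sq v"
proof -
  have *: "(norm (a + b))\<^sup>2 \<le> (1 + d) * (norm a)\<^sup>2 + (1 + 1 / d) * (norm b)\<^sup>2" for a b :: complex
  proof -
    have "(norm (a + b))\<^sup>2 \<le> (norm a + norm b)\<^sup>2" by (intro power_mono norm_triangle_ineq) auto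
    moreover have "0 \<le> (d * norm a - norm b)\<^sup>2 / d" using d by simp
    moreover have "(d * norm a - norm b)\<^sup>2 / d = (1 + d) * (norm a)\<^sup>2 + (1 + 1 / d) * (norm b)\<^sup>2 - (norm a + norm b)\<^sup>2"
      using d by (simp add: power2_eq_square field_simps)
    ultimately show ?thesis by linarith
  qed
  have "norm_sq (\<lambda>x. u x + v x) \<le> (\<integral>\<^sup>+x. ennreal (1 + d) * ennreal ((norm (u x))\<^sup>2) + ennreal (1 + 1 / d) * ennreal ((norm (v x))\<^sup>2) \<partial>lborel)"
    unfolding norm_sq_def using * d
    by (intro nn_integral_mono) (simp add: ennreal_mult[symmetric] ennreal_plus[symmetric] ennreal_leI del: ennreal_plus)
  also have "\<dots> = ennreal (1 + d) * norm_sq u + ennreal (1 + 1 / d) * norm_sq v"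
    unfolding norm_sq_def by (subst nn_integral_add, measurable) (simp add: nn_integral_cmult)
  finally show ?thesis .
qed

lemma norm_sq_add_le_2:
  fixes u v :: "'a::euclidean_space \<Rightarrow> complex"
  assumes "u \<in> borel_measurable borel" "v \<in> borel_measurable borel"
  shows "norm_sq (\<lambda>x. u x + v x) \<le> 2 * (norm_sq u + norm_sq v)"
  using norm_sq_add_le[OF assms, of 1] by (simp add: distrib_left)

lemma norm_sq_diff_le:
  fixes u v :: "'a::euclidean_space \<Rightarrow> complex"
  assumes [measurable]: "u \<in> borel_measurable borel" "v \<in> borel_measurable borel"
  shows "norm_sq (\<lambda>x. u x - v x) \<le> 2 * (norm_sq u + norm_sq v)"
proof -
  have "norm_sq (\<lambda>x. u x + - v x) \<le> 2 * (norm_sq u + norm_sq (\<lambda>x. - v x))"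
    by (rule norm_sq_add_le_2) measurable
  then show ?thesis by (simp add: norm_sq_def)
qed

lemma translation_continuous_approx:
  fixes u :: "'a::euclidean_space \<Rightarrow> complex"
  assumes [measurable]: "u \<in> borel_measurable borel"
    and ex: "\<And>e::real. e > 0 \<Longrightarrow>
      \<exists>v. v \<in> borel_measurable borel \<and> translation_continuous v \<and> norm_sq (\<lambda>x. u x - v x) < ennreal e"
  shows "translation_continuous u"
  unfolding translation_continuous_def
proof (intro allI impI ennreal_tendsto_0I)
  fix Y :: "nat \<Rightarrow> 'a" and e :: real assume Y: "Y \<longlonglongrightarrow> 0" and e: "e > 0"
  \<comment> \<open>The tenth is chosen for the two nested uses of \<open>norm_sq_add_le_2\<close>
    below: 2 (2 (1/10 + 1/10) + 1/10) = 1.\<close>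
  obtain v where [measurable]: "v \<in> borel_measurable borel" and v: "translation_continuous v"
    and uv: "norm_sq (\<lambda>x. u x - v x) < ennreal (e / 10)"
    using ex[of "e / 10"] e by auto
  have "(\<lambda>n. norm_sq (\<lambda>s. v (s + Y n) - v s)) \<longlonglongrightarrow> 0"
    using v Y by (auto simp: translation_continuous_def)
  then have "\<forall>\<^sub>F n in sequentially. norm_sq (\<lambda>s. v (s + Y n) - v s) < ennreal (e / 10)"
    by (rule order_tendstoD) (use e in simp)
  then show "\<forall>\<^sub>F n in sequentially. norm_sq (\<lambda>s. u (s + Y n) - u s) < ennreal e"
  proof eventually_elim
    case (elim n)
    let ?d = "\<lambda>x. u x - v x"
    have "norm_sq (\<lambda>s. u (s + Y n) - u s) = norm_sq (\<lambda>s. (?d (s + Y n) + (v (s + Y n) - v s)) + (v s - u s))"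
      by simp
    also have "\<dots> \<le> 2 * (norm_sq (\<lambda>s. ?d (s + Y n) + (v (s + Y n) - v s)) + norm_sq (\<lambda>s. v s - u s))"
      by (rule norm_sq_add_le_2) measurable
    also have "\<dots> \<le> 2 * (2 * (norm_sq (\<lambda>s. ?d (s + Y n)) + norm_sq (\<lambda>s. v (s + Y n) - v s)) + norm_sq (\<lambda>s. v s - u s))"
      by (intro mult_left_mono add_right_mono norm_sq_add_le_2) measurable
    also have "norm_sq (\<lambda>s. ?d (s + Y n)) = norm_sq ?d" by (rule norm_sq_shift) measurable
    also have "norm_sq (\<lambda>s. v s - u s) = norm_sq ?d" by (rule norm_sq_minus_commute)
    also have "2 * (2 * (norm_sq ?d + norm_sq (\<lambda>s. v (s + Y n) - v s)) + norm_sq ?d) <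
       2 * (2 * (ennreal (e/10) + ennreal (e/10)) + ennreal (e/10))"
      by (intro ennreal_mult_strict_left_mono add_strict_mono uv elim) auto
    also have "\<dots> = ennreal e"
      using e by (simp add: ennreal_mult[symmetric] ennreal_plus[symmetric] ennreal_numeral[symmetric]
          del: ennreal_plus ennreal_numeral)
    finally show ?case .
  qed
qed

lemma norm_sq_dominated:
  fixes f :: "nat \<Rightarrow> 'a::euclidean_space \<Rightarrow> complex"
  assumes [measurable]: "\<And>n. f n \<in> borel_measurable borel" and [measurable]: "w \<in> borel_measurable borel"
    and "\<And>n x. ennreal ((norm (f n x))\<^sup>2) \<le> w x" and "(\<integral>\<^sup>+x. w x \<partial>lborel) < \<infinity>"
    and lim: "AE x in lborel. (\<lambda>n. f n x) \<longlonglongrightarrow> 0"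
  shows "(\<lambda>n. norm_sq (f n)) \<longlonglongrightarrow> 0"
proof -
  have "(\<lambda>n. \<integral>\<^sup>+x. ennreal ((norm (f n x))\<^sup>2) \<partial>lborel) \<longlonglongrightarrow> (\<integral>\<^sup>+x. 0 \<partial>(lborel :: 'a measure))"
  proof (rule nn_integral_dominated_convergence[where w = w])
    show "AE x in lborel. (\<lambda>n. ennreal ((norm (f n x))\<^sup>2)) \<longlonglongrightarrow> 0"
      using lim
    proof eventually_elim
      case (elim x)
      have "(\<lambda>n. ennreal ((norm (f n x))\<^sup>2)) \<longlonglongrightarrow> ennreal ((norm (0::complex))\<^sup>2)"
        by (intro tendsto_ennrealI tendsto_power tendsto_norm elim)
      then show ?case by simp
    qed
  qed (use assms in auto)
  then show ?thesis by (simp add: norm_sq_def)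
qed

lemma measurable_const_indicator_cball[measurable]:
  "(\<lambda>x. ennreal c * indicator (cball (0::'a::euclidean_space) R) x) \<in> borel_measurable borel"
  by (intro borel_measurable_times_ennreal borel_measurable_const borel_measurable_indicator borel_closed closed_cball)

lemma nn_integral_indicator_cball_finite:
  "(\<integral>\<^sup>+x. ennreal c * indicator (cball (0::'a::euclidean_space) R) x \<partial>lborel) < top"
  using emeasure_lborel_cball_finite[of "0::'a" R]
  by (subst nn_integral_cmult_indicator) (auto simp: ennreal_mult_less_top)

text \<open>A null sequence of shifts is bounded by some \<open>B\<close>, so all differences vanish
  outside the ball of radius \<open>R + B\<close> and are at most \<open>2 * M\<close> inside;
  dominated convergence applies.\<close>

lemma translation_continuous_continuous:
  fixes v :: "'a::euclidean_space \<Rightarrow> complex"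
  assumes v: "continuous_on UNIV v" and b: "\<And>x. norm (v x) \<le> M" and s: "\<And>x. norm x > R \<Longrightarrow> v x = 0"
  shows "translation_continuous v"
  unfolding translation_continuous_def
proof (intro allI impI)
  fix Y :: "nat \<Rightarrow> 'a" assume Y: "Y \<longlonglongrightarrow> 0"
  from v have [measurable]: "v \<in> borel_measurable borel" by (rule borel_measurable_continuous_onI)
  obtain B where B: "\<And>n. norm (Y n) \<le> B"
    using convergent_imp_Bseq[OF convergentI[OF Y]] by (auto simp: Bseq_def)
  define K where "K = (2 * M)\<^sup>2"
  have "B \<ge> 0" using B[of 0] norm_ge_zero order_trans by blast
  show "(\<lambda>n. norm_sq (\<lambda>s. v (s + Y n) - v s)) \<longlonglongrightarrow> 0"
  proof (rule norm_sq_dominated[where w = "\<lambda>x. ennreal K * indicator (cball 0 (R + B)) x"])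
    fix n x
    show "ennreal ((norm (v (x + Y n) - v x))\<^sup>2) \<le> ennreal K * indicator (cball 0 (R + B)) x"
    proof (cases "norm x \<le> R + B")
      case True
      have "norm (v (x + Y n) - v x) \<le> 2 * M"
        using norm_triangle_ineq4[of "v (x + Y n)" "v x"] b[of "x + Y n"] b[of x] by simp
      from power_mono[OF this, of 2] show ?thesis using True by (auto simp: K_def intro!: ennreal_leI)
    next
      case False
      then have "norm x > R" "norm (x + Y n) > R"
        using B[of n] \<open>B \<ge> 0\<close> norm_triangle_ineq4[of "x + Y n" "Y n"] by auto
      then show ?thesis using s by simp
    qed
  next
    show "AE x in lborel. (\<lambda>n. v (x + Y n) - v x) \<longlonglongrightarrow> 0"
    proof (rule AE_I2)
      fix x
      have "(\<lambda>n. x + Y n) \<longlonglongrightarrow> x" using tendsto_add[OF tendsto_const[of x] Y] by simp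
      moreover have "isCont v x" using v by (simp add: continuous_on_eq_continuous_at)
      ultimately have "(\<lambda>n. v (x + Y n)) \<longlonglongrightarrow> v x" by (rule isCont_tendsto_compose[rotated])
      then show "(\<lambda>n. v (x + Y n) - v x) \<longlonglongrightarrow> 0" by (simp add: LIM_zero)
    qed
  qed (use measurable_const_indicator_cball in \<open>auto simp: nn_integral_indicator_cball_finite\<close>)
qed

lemma translation_continuous_bounded:
  fixes u :: "'a::euclidean_space \<Rightarrow> complex"
  assumes [measurable]: "u \<in> borel_measurable borel" and M: "M > 0"
    and b: "\<And>x. norm (u x) \<le> M" and s: "\<And>x. norm x > R \<Longrightarrow> u x = 0"
  shows "translation_continuous u"
proof -
  have "u measurable_on UNIV"
    by (rule lebesgue_measurable_imp_measurable_on) (auto intro: measurable_completion)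
  then obtain N g where N: "negligible N" and g: "\<And>n. continuous_on UNIV (g n)"
    and lim: "\<And>x. x \<notin> N \<Longrightarrow> (\<lambda>n. g n x) \<longlonglongrightarrow> u x"
    unfolding measurable_on_def by auto
  \<comment> \<open>The first factor pulls values of norm above \<open>M\<close> back to norm
    \<open>M\<close>; the second is a continuous cutoff, 1 up to radius \<open>R\<close> and 0 from
    radius \<open>R + 1\<close> on. Both preserve continuity and leave the limit \<open>u x\<close>
    unchanged.\<close>
  define v where "v n x = ((M / max M (norm (g n x))) * max 0 (min 1 (R + 1 - norm x))) *\<^sub>R g n x" for n x
  have vc: "continuous_on UNIV (v n)" for n
    unfolding v_def using M by (intro continuous_intros g) auto
  have [measurable]: "v n \<in> borel_measurable borel" for n
    using vc by (rule borel_measurable_continuous_onI)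
  have vb: "norm (v n x) \<le> M" for n x
  proof -
    have "norm (v n x) = (M * norm (g n x) / max M (norm (g n x))) * max 0 (min 1 (R + 1 - norm x))"
      using M by (simp add: v_def abs_mult)
    also have "\<dots> \<le> M * 1"
      using M by (intro mult_mono) (auto simp: divide_simps max_def)
    finally show ?thesis by simp
  qed
  have vs: "v n x = 0" if "norm x > R + 1" for n x
    using that by (simp add: v_def)
  have vt: "translation_continuous (v n)" for n
    by (rule translation_continuous_continuous[OF vc vb vs])
  define K where "K = (2 * M)\<^sup>2"
  have "(\<lambda>n. norm_sq (\<lambda>x. u x - v n x)) \<longlonglongrightarrow> 0"
  proof (rule norm_sq_dominated[where w = "\<lambda>x. ennreal K * indicator (cball 0 (R + 1)) x"])
    fix n x
    show "ennreal ((norm (u x - v n x))\<^sup>2) \<le> ennreal K * indicator (cball 0 (R + 1)) x"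
    proof (cases "norm x \<le> R + 1")
      case True
      have "norm (u x - v n x) \<le> 2 * M"
        using norm_triangle_ineq4[of "u x" "v n x"] b[of x] vb[of n x] by simp
      from power_mono[OF this, of 2] show ?thesis using True by (auto simp: K_def intro!: ennreal_leI)
    qed (use vs s in auto)
  next
    have "AE x in lebesgue. x \<notin> N"
      using N by (simp add: AE_not_in negligible_iff_null_sets)
    then have "AE x in lborel. x \<notin> N" by (simp add: AE_completion_iff)
    then show "AE x in lborel. (\<lambda>n. u x - v n x) \<longlonglongrightarrow> 0"
    proof eventually_elim
      case (elim x)
      have "(\<lambda>n. v n x) \<longlonglongrightarrow> ((M / max M (norm (u x))) * max 0 (min 1 (R + 1 - norm x))) *\<^sub>R u x"
        unfolding v_def using M by (intro tendsto_intros lim elim) auto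
      also have "((M / max M (norm (u x))) * max 0 (min 1 (R + 1 - norm x))) *\<^sub>R u x = u x"
        using b[of x] s[of x] M by (cases "norm x > R") (auto simp: max_def min_def)
      finally show ?case using tendsto_diff[OF tendsto_const[of "u x"]] by fastforce
    qed
  qed (use measurable_const_indicator_cball in \<open>auto simp: nn_integral_indicator_cball_finite\<close>)
  then have "\<exists>n. norm_sq (\<lambda>x. u x - v n x) < ennreal e" if "e > 0" for e
    using eventually_happens'[OF sequentially_bot order_tendstoD(2), of "\<lambda>n. norm_sq (\<lambda>x. u x - v n x)" 0 "ennreal e"] that
    by simp
  then show ?thesis
    using vt by (intro translation_continuous_approx[OF assms(1)]) (meson \<open>\<And>n. v n \<in> borel_measurable borel\<close>)
qed

text \<open>Cutting \<open>u\<close> off at height \<open>n\<close> and radius \<open>n\<close>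
  gives bounded functions of bounded support, which converge to \<open>u\<close> in L^2 with the
  dominating function |u|^2.\<close>

lemma translation_continuous_L2:
  fixes u :: "'a::euclidean_space \<Rightarrow> complex"
  assumes [measurable]: "u \<in> borel_measurable borel" and fin: "norm_sq u < \<infinity>"
  shows "translation_continuous u"
proof -
  define v where "v n x = (if norm (u x) \<le> real n \<and> norm x \<le> real n then u x else 0)" for n x
  have [measurable]: "v n \<in> borel_measurable borel" for n
    unfolding v_def by measurable
  \<comment> \<open>The bound is taken as \<open>n + 1\<close> because it has to be positive for
    \<open>n = 0\<close> too.\<close>
  have vt: "translation_continuous (v n)" for n
    by (rule translation_continuous_bounded[of _ "real n + 1" "real n"]) (auto simp: v_def)
  have "(\<lambda>n. norm_sq (\<lambda>x. u x - v n x)) \<longlonglongrightarrow> 0"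
  proof (rule norm_sq_dominated[where w = "\<lambda>x. ennreal ((norm (u x))\<^sup>2)"])
    show "AE x in lborel. (\<lambda>n. u x - v n x) \<longlonglongrightarrow> 0"
    proof (rule AE_I2)
      fix x
      obtain n0 where n0: "norm (u x) + norm x \<le> real n0" using real_arch_simple by blast
      have "\<forall>\<^sub>F n in sequentially. u x - v n x = 0"
        using eventually_ge_at_top[of n0]
      proof eventually_elim
        case (elim n)
        then have "norm (u x) \<le> real n" "norm x \<le> real n"
          using n0 norm_ge_zero[of x] norm_ge_zero[of "u x"] by linarith+
        then show ?case by (simp add: v_def)
      qed
      then show "(\<lambda>n. u x - v n x) \<longlonglongrightarrow> 0" by (rule tendsto_eventually)
    qed
  qed (use fin in \<open>auto simp: v_def norm_sq_def\<close>)
  then have "\<exists>n. norm_sq (\<lambda>x. u x - v n x) < ennreal e" if "e > 0" for e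
    using eventually_happens'[OF sequentially_bot order_tendstoD(2), of "\<lambda>n. norm_sq (\<lambda>x. u x - v n x)" 0 "ennreal e"] that
    by simp
  then show ?thesis
    using vt by (intro translation_continuous_approx[OF assms(1)]) (meson \<open>\<And>n. v n \<in> borel_measurable borel\<close>)
qed

section \<open>Plancherel's theorem\<close>

text \<open>The transform \<open>fourier\<close> for Borel functions on any Euclidean space: it
  serves on \<open>real^'n\<close> and, with \<open>real\<close> as its domain, in the time
  variable.\<close>

definition ft :: "('a::euclidean_space \<Rightarrow> complex) \<Rightarrow> 'a \<Rightarrow> complex" where
  "ft u t = (LINT x|lborel. u x * cis (- (x \<bullet> t)))"

lemma measurable_cnj[measurable]: "cnj \<in> borel_measurable borel"
  by (intro borel_measurable_continuous_onI continuous_on_cnj continuous_on_id)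

lemma gauss_nonneg[simp]: "0 \<le> gauss z" and abs_gauss[simp]: "\<bar>gauss z\<bar> = gauss z"
  by (simp_all add: gauss_def)

lemma integrable_mult_cis:
  fixes u :: "'a \<Rightarrow> complex"
  assumes "integrable M u" and [measurable]: "h \<in> borel_measurable M"
  shows "integrable M (\<lambda>x. u x * cis (h x))"
  by (rule Bochner_Integration.integrable_bound[OF assms(1)])
     (use assms in \<open>auto simp: norm_mult intro!: borel_measurable_times\<close>)

lemma integrable_bounded_mult:
  fixes h :: "'a \<Rightarrow> complex"
  assumes "integrable M h" and [measurable]: "k \<in> borel_measurable M" and B: "\<And>x. norm (k x) \<le> B"
  shows "integrable M (\<lambda>x. k x * h x)"
proof (rule Bochner_Integration.integrable_bound)
  show "integrable M (\<lambda>x. B * norm (h x))" using assms(1) by simp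
  show "(\<lambda>x. k x * h x) \<in> borel_measurable M" using assms(1) by measurable
  have "0 \<le> B" if "x \<in> space M" for x using B[of x] norm_ge_zero order_trans by blast
  then show "AE x in M. norm (k x * h x) \<le> norm (B * norm (h x))"
    using B by (auto simp: norm_mult abs_mult intro!: AE_I2 mult_right_mono)
qed

lemma norm_ft_le:
  assumes "integrable lborel u"
  shows "norm (ft u t) \<le> (LINT x|lborel. norm (u x))"
  unfolding ft_def
  by (rule order_trans[OF integral_norm_bound]) (simp add: norm_mult)

lemma ft_measurable[measurable]:
  assumes [measurable]: "u \<in> borel_measurable borel"
  shows "ft u \<in> borel_measurable borel"
  unfolding ft_def[abs_def] by measurable

text \<open>The autocorrelation links the two sides of Plancherel's theorem: its transform is |ft
  u|^2, and its value at 0 is the squared L^2 norm of \<open>u\<close>.\<close>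

definition autocorr :: "('a::euclidean_space \<Rightarrow> complex) \<Rightarrow> 'a \<Rightarrow> complex" where
  "autocorr u y = (LINT s|lborel. u (s + y) * cnj (u s))"

lemma autocorr_measurable[measurable]:
  assumes [measurable]: "u \<in> borel_measurable borel"
  shows "autocorr u \<in> borel_measurable borel"
  unfolding autocorr_def[abs_def] by measurable

lemma autocorr_pair_integrable:
  fixes u :: "'a::euclidean_space \<Rightarrow> complex"
  assumes [measurable]: "u \<in> borel_measurable borel" and int: "integrable lborel u"
  shows "integrable (lborel \<Otimes>\<^sub>M lborel) (\<lambda>(s, y). u (s + y) * cnj (u s))"
proof (rule lborel_pair.Fubini_integrable)
  have i: "integrable lborel (\<lambda>y. u (s + y))" for s
    using lborel_integral_shift(2)[of u s] int by (simp add: add.commute)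
  have e: "(LINT y|lborel. norm (u (s + y))) = (LINT y|lborel. norm (u y))" for s
    using lborel_integral_shift(1)[of "\<lambda>y. norm (u y)" s] by (simp add: add.commute)
  show "integrable lborel (\<lambda>s. LINT y|lborel. norm (case (s, y) of (s, y) \<Rightarrow> u (s + y) * cnj (u s)))"
    using int by (simp add: norm_mult e)
  show "AE s in lborel. integrable lborel (\<lambda>y. case (s, y) of (s, y) \<Rightarrow> u (s + y) * cnj (u s))"
    using i by simp
qed measurable

lemma autocorr_integrable:
  assumes [measurable]: "u \<in> borel_measurable borel" and int: "integrable lborel u"
  shows "integrable lborel (autocorr u)"
  using lborel_pair.integrable_snd[OF autocorr_pair_integrable[OF assms]]
  by (simp add: autocorr_def[abs_def])

text \<open>Writing y = (y + s) - s in the phase splits the double integral into a transform and a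
  conjugate transform.\<close>

lemma ft_autocorr:
  fixes u :: "'a::euclidean_space \<Rightarrow> complex"
  assumes [measurable]: "u \<in> borel_measurable borel" and int: "integrable lborel u"
  shows "ft (autocorr u) t = ft u t * cnj (ft u t)"
proof -
  let ?f = "\<lambda>s y. u (s + y) * cnj (u s) * cis (- (y \<bullet> t))"
  have i: "integrable (lborel \<Otimes>\<^sub>M lborel) (\<lambda>(s, y). ?f s y)"
    using integrable_mult_cis[OF autocorr_pair_integrable[OF assms], of "\<lambda>(s,y). - (y \<bullet> t)"]
    by (simp add: split_def)
  have "ft (autocorr u) t = (LINT y|lborel. LINT s|lborel. ?f s y)"
    by (simp add: ft_def autocorr_def)
  also have "\<dots> = (LINT s|lborel. LINT y|lborel. ?f s y)"
    by (rule lborel_pair.Fubini_integral[OF i])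
  also have "\<dots> = (LINT s|lborel. ft u t * (cnj (u s * cis (- (s \<bullet> t)))))"
  proof (rule Bochner_Integration.integral_cong[OF refl])
    fix s
    have "?f s y = cnj (u s * cis (- (s \<bullet> t))) * (u (y + s) * cis (- ((y + s) \<bullet> t)))" for y
    proof -
      have "cis (- (y \<bullet> t)) = cis (s \<bullet> t) * cis (- ((y + s) \<bullet> t))"
        by (simp add: cis_mult inner_add_left)
      then show ?thesis by (simp add: cis_cnj add.commute mult_ac)
    qed
    then have "(LINT y|lborel. ?f s y)
      = cnj (u s * cis (- (s \<bullet> t))) * (LINT y|lborel. u (y + s) * cis (- ((y + s) \<bullet> t)))"
      by (simp only: integral_mult_right_zero)
    also have "(LINT y|lborel. u (y + s) * cis (- ((y + s) \<bullet> t))) = ft u t"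
      unfolding ft_def by (rule lborel_integral_shift(1)[of "\<lambda>y. u y * cis (- (y \<bullet> t))"]) measurable
    finally show "(LINT y|lborel. ?f s y) = ft u t * (cnj (u s * cis (- (s \<bullet> t))))" by simp
  qed
  also have "\<dots> = ft u t * cnj (ft u t)"
    unfolding integral_mult_right_zero Bochner_Integration.integral_cnj by (simp only: ft_def)
  finally show ?thesis .
qed

lemma gauss_scaled_fourier:
  fixes y :: "'a::euclidean_space"
  assumes "e > 0"
  shows "integrable lborel (\<lambda>t::'a. complex_of_real (gauss (e *\<^sub>R t)) * cis (t \<bullet> y))"
    and "(LINT t|lborel. of_real (gauss (e *\<^sub>R t)) * cis (t \<bullet> y))
       = of_real (sqrt (2 * pi) ^ DIM('a) / e ^ DIM('a) * gauss (y /\<^sub>R e))"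
proof -
  let ?f = "\<lambda>t::'a. complex_of_real (gauss (e *\<^sub>R t)) * cis (t \<bullet> y)"
  have m: "?f \<in> borel_measurable borel" by measurable
  have e: "(\<lambda>t. ?f (inverse e *\<^sub>R t)) = (\<lambda>t. complex_of_real (gauss t) * cis (t \<bullet> (y /\<^sub>R e)))"
    using assms by simp
  have "inverse e > 0" using assms by simp
  note * = lborel_integral_scale[OF this m, unfolded e]
  show "integrable lborel ?f" unfolding *(2) by (rule gauss_fourier)
  show "(LINT t|lborel. ?f t) = of_real (sqrt (2 * pi) ^ DIM('a) / e ^ DIM('a) * gauss (y /\<^sub>R e))"
    unfolding *(1) gauss_fourier by (simp add: scaleR_conv_of_real power_inverse field_simps)
qed

lemma gauss_scaled_integrable:
  "e > 0 \<Longrightarrow> integrable lborel (\<lambda>t::'a::euclidean_space. gauss (e *\<^sub>R t))"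
  using gauss_scaled_fourier(1)[of e "0::'a"] by (simp add: complex_of_real_integrable_eq)

text \<open>Fubini moves the transform from \<open>A\<close> to the Gaussian. The substitution y = e
  z then fixes the Gaussian and evaluates \<open>A\<close> at e z, so that small \<open>e\<close>
  probes \<open>A\<close> near the origin.\<close>

lemma integral_ft_gauss:
  fixes A :: "'a::euclidean_space \<Rightarrow> complex"
  assumes [measurable]: "A \<in> borel_measurable borel" and int: "integrable lborel A" and e: "e > 0"
  shows "(LINT t|lborel. ft A t * of_real (gauss (e *\<^sub>R t)))
    = of_real (sqrt (2 * pi) ^ DIM('a)) * (LINT z|lborel. A (e *\<^sub>R z) * of_real (gauss z))"
proof -
  let ?f = "\<lambda>(t::'a) y. A y * (of_real (gauss (e *\<^sub>R t)) * cis (t \<bullet> (- y)))"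
  have i0: "integrable (lborel \<Otimes>\<^sub>M lborel) (\<lambda>(t::'a, y). ?f t y)"
  proof (rule lborel_pair.Fubini_integrable)
    show "integrable lborel (\<lambda>t. LINT y|lborel. norm (case (t, y) of (t, y) \<Rightarrow> ?f t y))"
      using gauss_scaled_integrable[OF e, where 'a = 'a] gauss_pos[THEN less_imp_le] by (simp add: norm_mult)
    show "AE t in lborel. integrable lborel (\<lambda>y. case (t, y) of (t, y) \<Rightarrow> ?f t y)"
      using int by (auto intro!: integrable_mult_cis simp: mult.assoc[symmetric])
  qed measurable
  have "(LINT t|lborel. ft A t * of_real (gauss (e *\<^sub>R t))) = (LINT t|lborel. LINT y|lborel. ?f t y)"
    unfolding ft_def integral_mult_left_zero[symmetric] by (simp add: mult_ac inner_commute)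
  also have "\<dots> = (LINT y|lborel. LINT t|lborel. ?f t y)"
    by (rule lborel_pair.Fubini_integral[OF i0, symmetric])
  also have "\<dots> = (LINT y|lborel. A y * of_real (sqrt (2 * pi) ^ DIM('a) / e ^ DIM('a) * gauss (y /\<^sub>R e)))"
    unfolding integral_mult_right_zero gauss_scaled_fourier(2)[OF e]
    by (simp add: gauss_uminus)
  also have "\<dots> = e ^ DIM('a) *\<^sub>R (LINT z|lborel. A (e *\<^sub>R z) *
        of_real (sqrt (2 * pi) ^ DIM('a) / e ^ DIM('a) * gauss ((e *\<^sub>R z) /\<^sub>R e)))"
    by (rule lborel_integral_scale(1)[OF e]) measurable
  also have "\<dots> = e ^ DIM('a) *\<^sub>R (LINT z|lborel. of_real (sqrt (2 * pi) ^ DIM('a) / e ^ DIM('a)) *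
        (A (e *\<^sub>R z) * of_real (gauss z)))"
    using e by (simp add: mult_ac)
  also have "\<dots> = of_real (sqrt (2 * pi) ^ DIM('a)) * (LINT z|lborel. A (e *\<^sub>R z) * of_real (gauss z))"
    unfolding integral_mult_right_zero using e by (simp add: scaleR_conv_of_real)
  finally show ?thesis .
qed

lemma norm_sq_eq_integral:
  fixes u :: "'a::euclidean_space \<Rightarrow> complex"
  assumes [measurable]: "u \<in> borel_measurable borel" and "norm_sq u < \<infinity>"
  shows "integrable lborel (\<lambda>x. (norm (u x))\<^sup>2)"
    and "norm_sq u = ennreal (LINT x|lborel. (norm (u x))\<^sup>2)"
proof -
  show "integrable lborel (\<lambda>x. (norm (u x))\<^sup>2)"
    using assms by (intro integrableI_bounded) (auto simp: norm_sq_def)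
  then show "norm_sq u = ennreal (LINT x|lborel. (norm (u x))\<^sup>2)"
    unfolding norm_sq_def by (rule nn_integral_eq_integral) simp
qed

lemma Re_mult_cnj_eq: "Re (a * cnj b) = ((norm a)\<^sup>2 + (norm b)\<^sup>2 - (norm (a - b))\<^sup>2) / 2"
  by (simp only: cmod_power2) (simp add: power2_eq_square algebra_simps)

text \<open>Polarization by \<open>Re_mult_cnj_eq\<close>: since \<open>u\<close> and its translate
  have the same norm, the autocorrelation falls short of its value at 0 by half the squared distance
  between them. Continuity of translations thus becomes continuity of the autocorrelation at
  0.\<close>

lemma Re_autocorr:
  fixes u :: "'a::euclidean_space \<Rightarrow> complex"
  assumes [measurable]: "u \<in> borel_measurable borel" and fin: "norm_sq u < \<infinity>"
  shows "Re (autocorr u y) = enn2real (norm_sq u) - enn2real (norm_sq (\<lambda>s. u (s + y) - u s)) / 2"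
    and "\<bar>Re (autocorr u y)\<bar> \<le> enn2real (norm_sq u)"
proof -
  let ?v = "\<lambda>s. u (s + y)"
  let ?I = "\<lambda>f :: 'a \<Rightarrow> complex. LINT s|lborel. (norm (f s))\<^sup>2"
  have v: "norm_sq ?v = norm_sq u" by (rule norm_sq_shift) measurable
  have fv: "norm_sq ?v < \<infinity>" using fin v by simp
  have "norm_sq (\<lambda>s. ?v s - u s) \<le> 2 * (norm_sq ?v + norm_sq u)"
    by (rule norm_sq_diff_le) measurable
  also have "\<dots> < \<infinity>" using fin v by (simp add: ennreal_mult_less_top)
  finally have fd: "norm_sq (\<lambda>s. ?v s - u s) < \<infinity>" .
  note U = norm_sq_eq_integral[OF assms]
  note V = norm_sq_eq_integral[OF _ fv, simplified]
  note D = norm_sq_eq_integral[OF _ fd, simplified]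
  have cm: "norm (?v s * cnj (u s)) \<le> (norm (?v s))\<^sup>2 / 2 + (norm (u s))\<^sup>2 / 2" for s
    using zero_le_power2[of "norm (?v s) - norm (u s)"] by (simp add: norm_mult power2_eq_square algebra_simps)
  have bi: "integrable lborel (\<lambda>s. (norm (?v s))\<^sup>2 / 2 + (norm (u s))\<^sup>2 / 2)"
    using U V by auto
  have i: "integrable lborel (\<lambda>s. ?v s * cnj (u s))"
    by (rule Bochner_Integration.integrable_bound[OF bi]) (use cm in \<open>auto intro!: AE_I2 order_trans[OF cm]\<close>)
  have VU: "?I ?v = ?I u"
    by (rule lborel_integral_shift(1)[of "\<lambda>s. (norm (u s))\<^sup>2"]) measurable
  have "Re (autocorr u y) = (LINT s|lborel. Re (?v s * cnj (u s)))"
    unfolding autocorr_def by (rule integral_Re[OF i, symmetric])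
  also have "\<dots> = (LINT s|lborel. ((norm (?v s))\<^sup>2 + (norm (u s))\<^sup>2 - (norm (?v s - u s))\<^sup>2) / 2)"
    by (simp only: Re_mult_cnj_eq)
  also have "\<dots> = ((?I ?v + ?I u) - ?I (\<lambda>s. ?v s - u s)) / 2"
    using U V D by simp
  finally show 1: "Re (autocorr u y) = enn2real (norm_sq u) - enn2real (norm_sq (\<lambda>s. u (s + y) - u s)) / 2"
    using U D by (simp add: VU field_simps)
  have "\<bar>Re (autocorr u y)\<bar> \<le> norm (autocorr u y)" by (rule abs_Re_le_cmod)
  also have "\<dots> \<le> (LINT s|lborel. norm (?v s * cnj (u s)))" unfolding autocorr_def by (rule integral_norm_bound)
  also have "\<dots> \<le> (LINT s|lborel. (norm (?v s))\<^sup>2 / 2 + (norm (u s))\<^sup>2 / 2)"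
    by (rule integral_mono[OF integrable_norm[OF i] bi cm])
  also have "\<dots> = ?I u" using U V VU by simp
  finally show "\<bar>Re (autocorr u y)\<bar> \<le> enn2real (norm_sq u)" using U by simp
qed

text \<open>The Gaussian factor makes the integral of |ft u|^2 converge before \<open>ft u\<close>
  is known to be square integrable; so far \<open>ft u\<close> is only bounded, by the L^1 norm of
  \<open>u\<close>.\<close>

lemma integral_norm_ft_gauss:
  fixes u :: "'a::euclidean_space \<Rightarrow> complex"
  assumes [measurable]: "u \<in> borel_measurable borel" and int: "integrable lborel u" and fin: "norm_sq u < \<infinity>"
    and e: "e > 0"
  shows "integrable lborel (\<lambda>t. (norm (ft u t))\<^sup>2 * gauss (e *\<^sub>R t))"
    and "(LINT t|lborel. (norm (ft u t))\<^sup>2 * gauss (e *\<^sub>R t))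
    = sqrt (2 * pi) ^ DIM('a) * (LINT z|lborel. Re (autocorr u (e *\<^sub>R z)) * gauss z)"
proof -
  let ?L = "LINT x|lborel. norm (u x)"
  show i: "integrable lborel (\<lambda>t. (norm (ft u t))\<^sup>2 * gauss (e *\<^sub>R t))"
  proof (rule Bochner_Integration.integrable_bound)
    show "integrable lborel (\<lambda>t::'a. ?L\<^sup>2 * gauss (e *\<^sub>R t))"
      using gauss_scaled_integrable[OF e, where 'a = 'a] by simp
    show "AE t in lborel. norm ((norm (ft u t))\<^sup>2 * gauss (e *\<^sub>R t)) \<le> norm (?L\<^sup>2 * gauss (e *\<^sub>R t))"
      using norm_ft_le[OF int] gauss_pos[THEN less_imp_le]
      by (auto simp: abs_mult intro!: AE_I2 mult_right_mono power_mono)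
  qed measurable
  have c: "complex_of_real ((norm (ft u t))\<^sup>2 * gauss (e *\<^sub>R t))
      = ft (autocorr u) t * of_real (gauss (e *\<^sub>R t))" for t
    unfolding ft_autocorr[OF assms(1) int] complex_norm_square[symmetric] by simp
  have "complex_of_real (LINT t|lborel. (norm (ft u t))\<^sup>2 * gauss (e *\<^sub>R t))
      = (LINT t|lborel. ft (autocorr u) t * of_real (gauss (e *\<^sub>R t)))"
    unfolding integral_complex_of_real[symmetric] c ..
  also have "\<dots> = of_real (sqrt (2 * pi) ^ DIM('a)) * (LINT z|lborel. autocorr u (e *\<^sub>R z) * of_real (gauss z))"
    by (rule integral_ft_gauss[OF _ autocorr_integrable[OF assms(1) int] e]) measurable
  finally have "(LINT t|lborel. (norm (ft u t))\<^sup>2 * gauss (e *\<^sub>R t))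
      = sqrt (2 * pi) ^ DIM('a) * Re (LINT z|lborel. autocorr u (e *\<^sub>R z) * of_real (gauss z))"
    by (auto dest: arg_cong[where f = Re])
  also have "Re (LINT z|lborel. autocorr u (e *\<^sub>R z) * of_real (gauss z))
     = (LINT z|lborel. Re (autocorr u (e *\<^sub>R z)) * gauss z)"
  proof -
    have "integrable lborel (\<lambda>z. autocorr u (e *\<^sub>R z) * of_real (gauss z))"
    proof (rule Bochner_Integration.integrable_bound)
      show "integrable lborel (\<lambda>z. autocorr u (e *\<^sub>R z))"
        by (subst lborel_integral_scale(2)[OF e, symmetric]) (use autocorr_integrable[OF assms(1) int] in auto)
      show "AE z in lborel. norm (autocorr u (e *\<^sub>R z) * of_real (gauss z)) \<le> norm (autocorr u (e *\<^sub>R z))"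
        using gauss_le_1 gauss_pos[THEN less_imp_le] by (auto simp: norm_mult intro!: AE_I2 mult_left_le)
    qed measurable
    from integral_Re[OF this] show ?thesis by simp
  qed
  finally show "(LINT t|lborel. (norm (ft u t))\<^sup>2 * gauss (e *\<^sub>R t))
    = sqrt (2 * pi) ^ DIM('a) * (LINT z|lborel. Re (autocorr u (e *\<^sub>R z)) * gauss z)" .
qed

lemma gauss_scale_antimono:
  assumes "0 \<le> c" "c \<le> d"
  shows "gauss (d *\<^sub>R t) \<le> gauss (c *\<^sub>R t)"
proof -
  have "norm (c *\<^sub>R t) \<le> norm (d *\<^sub>R t)" using assms by (simp add: mult_right_mono)
  then have "(norm (c *\<^sub>R t))\<^sup>2 \<le> (norm (d *\<^sub>R t))\<^sup>2" by (intro power_mono) auto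
  then show ?thesis unfolding gauss_def by simp
qed

lemma gauss_scale_tendsto:
  assumes "e \<longlonglongrightarrow> 0"
  shows "(\<lambda>n. gauss (e n *\<^sub>R t)) \<longlonglongrightarrow> 1"
proof -
  have "(\<lambda>n. e n *\<^sub>R t) \<longlonglongrightarrow> 0 *\<^sub>R t" by (intro tendsto_scaleR assms tendsto_const)
  then have "(\<lambda>n. gauss (e n *\<^sub>R t)) \<longlonglongrightarrow> gauss (0 *\<^sub>R t)"
    unfolding gauss_def by (intro tendsto_exp tendsto_divide tendsto_minus tendsto_power tendsto_norm tendsto_const) auto
  then show ?thesis by (simp add: gauss_0)
qed

lemma sqrt_2pi_power: "sqrt (2 * pi) ^ n * sqrt (2 * pi) ^ n = (2 * pi) ^ n"
  unfolding power_mult_distrib[symmetric] by simp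

text \<open>With the parameter 1 / (n + 1) the Gaussians increase to 1, so the means of |ft u|^2
  increase to \<open>norm_sq (ft u)\<close>, while on the autocorrelation side dominated convergence
  gives the value at 0. Of the two factors sqrt (2 pi)^d that make up (2 pi)^d, one comes from the
  transform of the Gaussian and one from its total mass.\<close>

theorem plancherel:
  fixes u :: "'a::euclidean_space \<Rightarrow> complex"
  assumes [measurable]: "u \<in> borel_measurable borel" and int: "integrable lborel u" and fin: "norm_sq u < \<infinity>"
  shows "norm_sq (ft u) = ennreal ((2 * pi) ^ DIM('a)) * norm_sq u"
proof -
  let ?g = "\<lambda>n. inverse (real (Suc n))"
  let ?U = "enn2real (norm_sq u)"
  let ?K = "sqrt (2 * pi) ^ DIM('a)"
  have U: "norm_sq u = ennreal ?U" using fin by simp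
  have tc: "translation_continuous u" by (rule translation_continuous_L2[OF assms(1,3)])
  have lim1: "(\<lambda>n. Re (autocorr u (?g n *\<^sub>R z))) \<longlonglongrightarrow> ?U" for z
  proof -
    have "(\<lambda>n. ?g n *\<^sub>R z) \<longlonglongrightarrow> 0 *\<^sub>R z"
      by (intro tendsto_scaleR LIMSEQ_inverse_real_of_nat tendsto_const)
    then have "(\<lambda>n. norm_sq (\<lambda>s. u (s + ?g n *\<^sub>R z) - u s)) \<longlonglongrightarrow> ennreal 0"
      using tc unfolding translation_continuous_def by simp
    then have "(\<lambda>n. enn2real (norm_sq (\<lambda>s. u (s + ?g n *\<^sub>R z) - u s))) \<longlonglongrightarrow> 0"
      by (rule tendsto_enn2real) auto
    then have "(\<lambda>n. ?U - enn2real (norm_sq (\<lambda>s. u (s + ?g n *\<^sub>R z) - u s)) / 2) \<longlonglongrightarrow> ?U - 0 / 2"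
      by (intro tendsto_diff tendsto_divide tendsto_const) auto
    moreover have "?U - 0 / 2 = ?U" by simp
    ultimately show ?thesis unfolding Re_autocorr(1)[OF assms(1,3)] by metis
  qed
  have lim2: "(\<lambda>n. LINT z|lborel. Re (autocorr u (?g n *\<^sub>R z)) * gauss z) \<longlonglongrightarrow> (LINT z|lborel. ?U * gauss (z::'a))"
  proof (rule integral_dominated_convergence[where w = "\<lambda>z. ?U * gauss z"])
    show "AE z in lborel. (\<lambda>n. Re (autocorr u (?g n *\<^sub>R z)) * gauss z) \<longlonglongrightarrow> ?U * gauss z"
      by (intro AE_I2 tendsto_mult lim1 tendsto_const)
    show "AE z in lborel. norm (Re (autocorr u (?g n *\<^sub>R z)) * gauss z) \<le> ?U * gauss z" for n
      using Re_autocorr(2)[OF assms(1,3)] gauss_pos[THEN less_imp_le]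
      by (auto simp: abs_mult intro!: AE_I2 mult_right_mono)
  qed (auto simp: gauss_integral)
  have "(\<lambda>n. LINT t|lborel. (norm (ft u t))\<^sup>2 * gauss (?g n *\<^sub>R t)) \<longlonglongrightarrow> ?K * (?U * ?K)"
    unfolding integral_norm_ft_gauss(2)[OF assms inverse_positive_iff_positive[THEN iffD2, OF of_nat_0_less_iff[THEN iffD2, OF zero_less_Suc]]]
    using tendsto_mult[OF tendsto_const lim2, of ?K] by (simp add: gauss_integral)
  then have l1: "(\<lambda>n. ennreal (LINT t|lborel. (norm (ft u t))\<^sup>2 * gauss (?g n *\<^sub>R t))) \<longlonglongrightarrow> ennreal (?K * (?U * ?K))"
    by (rule tendsto_ennrealI)
  have "(\<lambda>n. \<integral>\<^sup>+t. ennreal ((norm (ft u t))\<^sup>2 * gauss (?g n *\<^sub>R t)) \<partial>lborel) \<longlonglongrightarrow> norm_sq (ft u)"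
    unfolding norm_sq_def
  proof (rule nn_integral_LIMSEQ)
    show "incseq (\<lambda>n t. ennreal ((norm (ft u t))\<^sup>2 * gauss (?g n *\<^sub>R t)))"
    proof (rule incseq_SucI, rule le_funI, rule ennreal_leI, rule mult_left_mono)
      show "gauss (?g n *\<^sub>R t) \<le> gauss (?g (Suc n) *\<^sub>R t)" for n and t :: 'a
        by (rule gauss_scale_antimono) (auto intro!: le_imp_inverse_le)
    qed simp
    show "(\<lambda>n. ennreal ((norm (ft u t))\<^sup>2 * gauss (?g n *\<^sub>R t))) \<longlonglongrightarrow> ennreal ((norm (ft u t))\<^sup>2)" for t
    proof -
      have "(\<lambda>n. (norm (ft u t))\<^sup>2 * gauss (?g n *\<^sub>R t)) \<longlonglongrightarrow> (norm (ft u t))\<^sup>2 * 1"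
        by (intro tendsto_mult tendsto_const gauss_scale_tendsto LIMSEQ_inverse_real_of_nat)
      then show ?thesis unfolding mult_1_right by (rule tendsto_ennrealI)
    qed
  qed measurable
  moreover have "(\<integral>\<^sup>+t. ennreal ((norm (ft u t))\<^sup>2 * gauss (?g n *\<^sub>R t)) \<partial>lborel)
      = ennreal (LINT t|lborel. (norm (ft u t))\<^sup>2 * gauss (?g n *\<^sub>R t))" for n
    by (rule nn_integral_eq_integral)
       (use integral_norm_ft_gauss(1)[OF assms, of "?g n"] gauss_pos[THEN less_imp_le] in auto)
  ultimately have "norm_sq (ft u) = ennreal (?K * (?U * ?K))"
    using l1 by (intro LIMSEQ_unique[of _ "norm_sq (ft u)"]) (simp only:)
  also have "?K * (?U * ?K) = (2 * pi) ^ DIM('a) * ?U"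
    unfolding sqrt_2pi_power[symmetric] by (simp add: mult_ac)
  finally show ?thesis by (subst U) (simp add: ennreal_mult)
qed

section \<open>The Fourier transform on $L^2$\<close>

lemma lborel_distr_neg: "distr lborel borel uminus = (lborel :: 'a::euclidean_space measure)"
proof -
  have "(lborel :: 'a measure) = density (distr lborel borel (\<lambda>x. 0 + (- 1) *\<^sub>R x)) (\<lambda>_. ennreal (\<bar>- 1\<bar> ^ DIM('a)))"
    by (rule lborel_affine[of "- 1" "0::'a"]) simp
  then show ?thesis by (simp add: density_1)
qed

lemma norm_sq_reflect:
  fixes u :: "'a::euclidean_space \<Rightarrow> complex"
  assumes [measurable]: "u \<in> borel_measurable borel"
  shows "norm_sq (\<lambda>x. u (- x)) = norm_sq u"
  unfolding norm_sq_def
  by (subst (2) lborel_distr_neg[symmetric], subst nn_integral_distr) auto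

lemma lborel_integral_reflect:
  fixes f :: "'a::euclidean_space \<Rightarrow> complex"
  assumes [measurable]: "f \<in> borel_measurable borel"
  shows "(LINT x|lborel. f (- x)) = (LINT x|lborel. f x)"
  by (subst (2) lborel_distr_neg[symmetric], subst integral_distr) auto

lemma norm_sq_cmult:
  fixes u :: "'a::euclidean_space \<Rightarrow> complex"
  assumes [measurable]: "u \<in> borel_measurable borel"
  shows "norm_sq (\<lambda>x. c * u x) = ennreal ((norm c)\<^sup>2) * norm_sq u"
  unfolding norm_sq_def
  by (subst nn_integral_cmult[symmetric]) (auto simp: norm_mult power_mult_distrib ennreal_mult)

text \<open>Fubini again. Conjugating the phase reverses its sign, which is the origin of the
  reflected argument \<open>- x\<close>.\<close>

lemma ft_parseval:
  fixes u v :: "'a::euclidean_space \<Rightarrow> complex"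
  assumes [measurable]: "u \<in> borel_measurable borel" "v \<in> borel_measurable borel"
    and i: "integrable lborel u" "integrable lborel v"
  shows "(LINT \<xi>|lborel. ft u \<xi> * cnj (v \<xi>)) = (LINT x|lborel. u x * cnj (ft v (- x)))"
proof -
  let ?f = "\<lambda>\<xi> x. (u x * cis (- (x \<bullet> \<xi>))) * cnj (v \<xi>)"
  have "integrable (lborel \<Otimes>\<^sub>M lborel) (\<lambda>(\<xi>, x). ?f \<xi> x)"
  proof (rule lborel_pair.Fubini_integrable)
    show "integrable lborel (\<lambda>\<xi>. LINT x|lborel. norm (case (\<xi>, x) of (\<xi>, x) \<Rightarrow> ?f \<xi> x))"
      using i(2) by (simp add: norm_mult)
    show "AE \<xi> in lborel. integrable lborel (\<lambda>x. case (\<xi>, x) of (\<xi>, x) \<Rightarrow> ?f \<xi> x)"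
      using i(1) by (auto intro!: integrable_mult_left integrable_mult_cis)
  qed measurable
  from lborel_pair.Fubini_integral[OF this]
  have "(LINT \<xi>|lborel. LINT x|lborel. ?f \<xi> x) = (LINT x|lborel. LINT \<xi>|lborel. ?f \<xi> x)" ..
  moreover have "(LINT \<xi>|lborel. ?f \<xi> x) = u x * cnj (ft v (- x))" for x
  proof -
    have "?f \<xi> x = u x * cnj (v \<xi> * cis (- (\<xi> \<bullet> - x)))" for \<xi>
      by (simp add: cis_cnj inner_commute)
    then show ?thesis
      unfolding ft_def by (simp only: integral_mult_right_zero Bochner_Integration.integral_cnj)
  qed
  ultimately show ?thesis unfolding ft_def integral_mult_left_zero by simp
qed

text \<open>The candidate \<open>f\<close> is the inverse transform of \<open>h\<close>. Plancherel
  makes it square integrable but it may fail to be integrable, so the approximants are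
  \<open>f\<close> times widening Gaussians. No pointwise inversion is involved: expanding the
  square of \<open>ft (F n) - h\<close> and evaluating the cross term by \<open>ft_parseval\<close>
  expresses the error through |f|^2 alone. The form of the conclusion is the one that
  \<open>has_L2_fourier\<close> asks for.\<close>

lemma L2_fourier_inversion:
  fixes h :: "'a::euclidean_space \<Rightarrow> complex"
  assumes [measurable]: "h \<in> borel_measurable borel" and int: "integrable lborel h" and fin: "norm_sq h < \<infinity>"
  obtains f F where "f \<in> borel_measurable borel" "norm_sq f = ennreal (1 / (2 * pi) ^ DIM('a)) * norm_sq h"
    "\<forall>n::nat. F n \<in> borel_measurable borel \<and> integrable lborel (F n) \<and> norm_sq (F n) < \<infinity>"
    "(\<lambda>n. norm_sq (\<lambda>x. F n x - f x)) \<longlonglongrightarrow> 0" "(\<lambda>n. norm_sq (\<lambda>x. ft (F n) x - h x)) \<longlonglongrightarrow> 0"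
proof -
  define c where "c = 1 / (2 * pi) ^ DIM('a)"
  have c: "c > 0" by (simp add: c_def)
  define e where "e n = inverse (real (Suc n))" for n
  have e: "e n > 0" for n by (simp add: e_def)
  have e0: "e \<longlonglongrightarrow> 0" unfolding e_def[abs_def] by (rule LIMSEQ_inverse_real_of_nat)
  define f where "f x = of_real c * ft h (- x)" for x
  define F where "F n x = f x * of_real (gauss (e n *\<^sub>R x))" for n x
  have [measurable]: "f \<in> borel_measurable borel" unfolding f_def[abs_def] by measurable
  have [measurable]: "F n \<in> borel_measurable borel" for n unfolding F_def[abs_def] by measurable
  have nf: "norm_sq f = ennreal c * norm_sq h"
  proof -
    have "norm_sq f = ennreal (c\<^sup>2) * norm_sq (ft h)"
      unfolding f_def[abs_def] by (subst norm_sq_cmult) (auto simp: norm_sq_reflect)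
    also have "\<dots> = ennreal (c\<^sup>2 * (2 * pi) ^ DIM('a)) * norm_sq h"
      unfolding plancherel[OF assms] by (subst ennreal_mult) (auto simp: mult.assoc)
    also have "c\<^sup>2 * (2 * pi) ^ DIM('a) = c" by (simp add: c_def power2_eq_square)
    finally show ?thesis .
  qed
  have ff: "norm_sq f < \<infinity>" unfolding nf using fin by (simp add: ennreal_mult_less_top)
  have Ff: "norm (F n x) \<le> norm (f x)" for n x
    unfolding F_def by (auto simp: norm_mult gauss_le_1 intro!: mult_left_le)
  have F1: "integrable lborel (F n)" for n
  proof (rule Bochner_Integration.integrable_bound)
    show "integrable lborel (\<lambda>t::'a. (c * (LINT x|lborel. norm (h x))) * gauss (e n *\<^sub>R t))"
      using gauss_scaled_integrable[OF e, where 'a = 'a] by simp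
    show "AE t in lborel. norm (F n t) \<le> norm ((c * (LINT x|lborel. norm (h x))) * gauss (e n *\<^sub>R t))"
      using norm_ft_le[OF int] c
      by (auto simp: abs_mult F_def f_def norm_mult intro!: AE_I2 mult_right_mono mult_left_mono)
  qed measurable
  have F2: "norm_sq (F n) < \<infinity>" for n
  proof -
    have "norm_sq (F n) \<le> norm_sq f"
      unfolding norm_sq_def by (intro nn_integral_mono ennreal_leI power_mono Ff) auto
    with ff show ?thesis by simp
  qed
  \<comment> \<open>The part of |f|^2 that the Gaussian removes. Its integral tends to 0 and, up to
    a constant, dominates both approximation errors.\<close>
  let ?j = "\<lambda>n x. (norm (f x))\<^sup>2 * (1 - gauss (e n *\<^sub>R x))"
  note fi = norm_sq_eq_integral[OF _ ff]
  have ji: "integrable lborel (?j n)" for n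
    using fi(1) by (rule Bochner_Integration.integrable_bound)
      (auto simp: abs_mult gauss_le_1 intro!: AE_I2 mult_left_le)
  have jl: "(\<lambda>n. LINT x|lborel. ?j n x) \<longlonglongrightarrow> (LINT x|(lborel :: 'a measure). 0)"
  proof (rule integral_dominated_convergence[where w = "\<lambda>x. (norm (f x))\<^sup>2"])
    have "(\<lambda>n. ?j n x) \<longlonglongrightarrow> (norm (f x))\<^sup>2 * (1 - 1)" for x
      by (intro tendsto_mult tendsto_diff tendsto_const gauss_scale_tendsto e0)
    then show "AE x in lborel. (\<lambda>n. ?j n x) \<longlonglongrightarrow> 0" by simp
    show "AE x in lborel. norm (?j n x) \<le> (norm (f x))\<^sup>2" for n
      by (auto simp: abs_mult gauss_le_1 intro!: AE_I2 mult_left_le)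
  qed (use fi(1) in auto)
  have lim0: "(\<lambda>n. ennreal (r * (LINT x|lborel. ?j n x))) \<longlonglongrightarrow> 0" for r
    using tendsto_ennrealI[OF tendsto_mult[OF tendsto_const jl, of r]] by simp
  have sq: "(norm (F n x))\<^sup>2 = (norm (f x))\<^sup>2 * (gauss (e n *\<^sub>R x))\<^sup>2" for n x
    by (simp add: F_def norm_mult power_mult_distrib)
  have FL: "(\<lambda>n. norm_sq (\<lambda>x. F n x - f x)) \<longlonglongrightarrow> 0"
  proof (rule tendsto_sandwich[OF _ _ tendsto_const lim0[of 1]])
    have "norm_sq (\<lambda>x. F n x - f x) \<le> (\<integral>\<^sup>+x. ennreal (?j n x) \<partial>lborel)" for n
      unfolding norm_sq_def
    proof (intro nn_integral_mono ennreal_leI)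
      fix x
      have "F n x - f x = f x * of_real (gauss (e n *\<^sub>R x) - 1)" by (simp add: F_def algebra_simps)
      then have "(norm (F n x - f x))\<^sup>2 = (norm (f x))\<^sup>2 * (1 - gauss (e n *\<^sub>R x))\<^sup>2"
        by (simp only: norm_mult norm_of_real power_mult_distrib power2_abs power2_commute)
      also have "\<dots> \<le> ?j n x"
        using gauss_le_1[of "e n *\<^sub>R x"] gauss_nonneg[of "e n *\<^sub>R x"]
        by (intro mult_left_mono) (auto simp: power2_eq_square mult_left_le)
      finally show "(norm (F n x - f x))\<^sup>2 \<le> ?j n x" .
    qed
    also have "(\<integral>\<^sup>+x. ennreal (?j n x) \<partial>lborel) = ennreal (1 * (LINT x|lborel. ?j n x))" for n
      using nn_integral_eq_integral[OF ji[of n]] by (simp add: gauss_le_1)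
    finally show "\<forall>\<^sub>F n in sequentially. norm_sq (\<lambda>x. F n x - f x) \<le> ennreal (1 * (LINT x|lborel. ?j n x))" by simp
  qed simp
  have "norm_sq (\<lambda>x. ft (F n) x - h x) \<le> ennreal ((2 * pi) ^ DIM('a) * (LINT x|lborel. ?j n x))" for n
  proof -
    let ?K = "(2 * pi) ^ DIM('a) :: real" and ?I = "\<lambda>u :: 'a \<Rightarrow> complex. LINT x|lborel. (norm (u x))\<^sup>2"
    let ?J = "LINT x|lborel. (norm (f x))\<^sup>2 * gauss (e n *\<^sub>R x)"
    have Jg: "integrable lborel (\<lambda>x. (norm (f x))\<^sup>2 * gauss (e n *\<^sub>R x))"
      using fi(1) by (rule Bochner_Integration.integrable_bound)
        (auto simp: abs_mult gauss_le_1 intro!: AE_I2 mult_left_le)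
    note pl = plancherel[OF _ F1 F2, of n] and hI = norm_sq_eq_integral[OF assms(1) fin] and FI = norm_sq_eq_integral[OF _ F2, of n]
    have tf: "norm_sq (ft (F n)) < \<infinity>" using pl F2[of n] by (simp add: ennreal_mult_less_top)
    note tI = norm_sq_eq_integral[OF _ tf]
    have T: "?I (ft (F n)) = ?K * ?I (F n)"
      using pl tI(2) FI(2) by (simp add: ennreal_mult[symmetric] del: power_mult_distrib)
    have H: "?I h = ?K * ?I f"
      using nf hI(2) fi(2) c by (simp add: ennreal_mult[symmetric] c_def field_simps)
    have df: "norm_sq (\<lambda>x. ft (F n) x - h x) < \<infinity>"
    proof (rule le_less_trans)
      show "norm_sq (\<lambda>x. ft (F n) x - h x) \<le> 2 * (norm_sq (ft (F n)) + norm_sq h)"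
        by (rule norm_sq_diff_le) measurable
    qed (use tf fin in \<open>simp add: ennreal_mult_less_top\<close>)
    note dI = norm_sq_eq_integral[OF _ df]
    have i: "integrable lborel (\<lambda>x. ft (F n) x * cnj (h x))"
      by (rule integrable_bounded_mult[OF _ _ norm_ft_le[OF F1]]) (use int in auto)
    have "(LINT x|lborel. ft (F n) x * cnj (h x)) = (LINT x|lborel. F n x * cnj (ft h (- x)))"
      by (rule ft_parseval[OF _ _ F1 int]) measurable
    also have "\<dots> = (LINT x|lborel. of_real (?K * ((norm (f x))\<^sup>2 * gauss (e n *\<^sub>R x))))"
    proof (rule Bochner_Integration.integral_cong[OF refl])
      fix x
      have "ft h (- x) = of_real ?K * f x" by (simp add: f_def c_def)
      then have "F n x * cnj (ft h (- x)) = of_real ?K * (f x * cnj (f x)) * of_real (gauss (e n *\<^sub>R x))"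
        by (simp add: F_def)
      then show "F n x * cnj (ft h (- x)) = of_real (?K * ((norm (f x))\<^sup>2 * gauss (e n *\<^sub>R x)))"
        by (simp only: complex_norm_square[symmetric] of_real_mult mult.assoc)
    qed
    also have "\<dots> = of_real (?K * ?J)" unfolding integral_complex_of_real by simp
    finally have "(LINT x|lborel. Re (ft (F n) x * cnj (h x))) = ?K * ?J"
      using integral_Re[OF i] by simp
    moreover have "(LINT x|lborel. Re (ft (F n) x * cnj (h x))) = (?I (ft (F n)) + ?I h - ?I (\<lambda>x. ft (F n) x - h x)) / 2"
      unfolding Re_mult_cnj_eq using tI(1) hI(1) dI(1) by simp
    ultimately have "?I (\<lambda>x. ft (F n) x - h x) = ?K * (?I (F n) + ?I f - 2 * ?J)"
      unfolding T H by (simp add: algebra_simps)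
    \<comment> \<open>A Gaussian value lies between 0 and 1, hence its square is at most
      itself.\<close>
    also have "?I (F n) \<le> ?J"
      unfolding sq using FI(1) Jg unfolding sq
      by (intro integral_mono) (auto simp: power2_eq_square gauss_le_1 intro!: mult_left_mono mult_left_le)
    also have "?J + ?I f - 2 * ?J = (LINT x|lborel. ?j n x)"
      using Jg fi(1) by (simp add: right_diff_distrib)
    finally show ?thesis using dI(2) by (simp add: ennreal_leI)
  qed
  then have "\<forall>\<^sub>F n in sequentially. norm_sq (\<lambda>x. ft (F n) x - h x) \<le> ennreal ((2 * pi) ^ DIM('a) * (LINT x|lborel. ?j n x))"
    by (intro always_eventually allI)
  then have "(\<lambda>n. norm_sq (\<lambda>x. ft (F n) x - h x)) \<longlonglongrightarrow> 0"
    by (intro tendsto_sandwich[OF _ _ tendsto_const lim0]) auto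
  from that[OF _ nf[unfolded c_def] _ FL this] F1 F2 show thesis by simp
qed

section \<open>From Lebesgue measurable functions to Borel representatives\<close>

lemma exp_eq_cis: "exp (\<i> * complex_of_real a) = cis a" "exp (- \<i> * complex_of_real a) = cis (- a)"
  by (simp_all add: cis_conv_exp)

lemma lebesgue_complex_borel_rep:
  fixes f :: "'a::euclidean_space \<Rightarrow> complex"
  assumes [measurable]: "f \<in> borel_measurable lebesgue"
  shows "\<exists>f'. f' \<in> borel_measurable borel \<and> (AE x in lborel. f x = f' x)"
proof -
  obtain a where [measurable]: "a \<in> borel_measurable lborel" and a: "AE x in lborel. Re (f x) = a x"
    using completion_ex_borel_measurable_real[of "\<lambda>x. Re (f x)" lborel] by auto
  obtain b where [measurable]: "b \<in> borel_measurable lborel" and b: "AE x in lborel. Im (f x) = b x"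
    using completion_ex_borel_measurable_real[of "\<lambda>x. Im (f x)" lborel] by auto
  show ?thesis
  proof (intro exI conjI)
    show "(\<lambda>x. of_real (a x) + \<i> * of_real (b x)) \<in> borel_measurable borel"
      by measurable
    show "AE x in lborel. f x = of_real (a x) + \<i> * of_real (b x)"
      using a b by eventually_elim (simp add: complex_eq_iff)
  qed
qed

lemma L2_norm_sq_eq_norm_sq:
  assumes "AE x in lborel. f x = f' x"
  shows "L2_norm_sq f = norm_sq f'"
  unfolding L2_norm_sq_def norm_sq_def nn_integral_completion
  by (rule nn_integral_cong_AE) (use assms in eventually_elim, simp)

lemma fourier_eq_ft:
  fixes f :: "real^'n \<Rightarrow> complex"
  assumes [measurable]: "f \<in> borel_measurable lebesgue" "f' \<in> borel_measurable borel"
    and ae: "AE x in lborel. f x = f' x"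
  shows "fourier f \<xi> = ft f' \<xi>"
proof -
  have [measurable]: "(\<lambda>x. f' x * cis (- (x \<bullet> \<xi>))) \<in> borel_measurable borel" by measurable
  have [measurable]: "(\<lambda>x. cis (- (x \<bullet> \<xi>))) \<in> borel_measurable lebesgue"
    by (intro measurable_completion) measurable
  have "fourier f \<xi> = (LINT x|lebesgue. f' x * cis (- (x \<bullet> \<xi>)))"
    unfolding fourier_def exp_eq_cis
  proof (rule integral_cong_AE)
    show "AE x in lebesgue. f x * cis (- (x \<bullet> \<xi>)) = f' x * cis (- (x \<bullet> \<xi>))"
      using AE_completion[OF ae] by eventually_elim simp
  qed (auto intro: measurable_completion)
  also have "\<dots> = ft f' \<xi>"
    unfolding ft_def by (rule integral_completion) measurable
  finally show ?thesis .
qed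

lemma integrable_lebesgue_eq:
  fixes f :: "'a::euclidean_space \<Rightarrow> complex"
  assumes [measurable]: "f \<in> borel_measurable lebesgue" "f' \<in> borel_measurable borel"
    and ae: "AE x in lborel. f x = f' x"
  shows "integrable lebesgue f \<longleftrightarrow> integrable lborel f'"
proof -
  have "integrable lebesgue f \<longleftrightarrow> integrable lebesgue f'"
    by (rule integrable_cong_AE) (use AE_completion[OF ae] in \<open>auto intro: measurable_completion\<close>)
  also have "\<dots> \<longleftrightarrow> integrable lborel f'" by (rule integrable_completion) simp
  finally show ?thesis .
qed

text \<open>Plancherel's constant survives the passage to L^2 limits because \<open>n\<close> tends
  to infinity at a fixed splitting parameter \<open>d\<close>, and only afterwards \<open>d\<close>
  tends to 0.\<close>

lemma norm_sq_ft_limit_le: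
  fixes f g :: "'a::euclidean_space \<Rightarrow> complex"
  assumes [measurable]: "f \<in> borel_measurable borel" "g \<in> borel_measurable borel"
    and [measurable]: "\<And>n::nat. F n \<in> borel_measurable borel"
    and F: "\<And>n. integrable lborel (F n)" "\<And>n. norm_sq (F n) < \<infinity>"
    and ff: "norm_sq f < \<infinity>"
    and l1: "(\<lambda>n. norm_sq (\<lambda>x. F n x - f x)) \<longlonglongrightarrow> 0"
    and l2: "(\<lambda>n. norm_sq (\<lambda>x. ft (F n) x - g x)) \<longlonglongrightarrow> 0"
  shows "norm_sq g \<le> ennreal ((2 * pi) ^ DIM('a)) * norm_sq f"
proof -
  let ?K = "(2 * pi) ^ DIM('a)" and ?r = "enn2real (norm_sq f)"
  have r: "norm_sq f = ennreal ?r" using ff by simp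
  have bd: "norm_sq g \<le> ennreal ((1 + d) * (?K * ((1 + d) * ?r)))" if d: "d > 0" for d
  proof -
    let ?R = "\<lambda>x y. ennreal (1 + d) * (ennreal ?K * (ennreal (1 + d) * norm_sq f + ennreal (1 + 1 / d) * x))
         + ennreal (1 + 1 / d) * y"
    have "norm_sq g \<le> ?R (norm_sq (\<lambda>x. F n x - f x)) (norm_sq (\<lambda>x. ft (F n) x - g x))" for n
    proof -
      have "norm_sq g \<le> ennreal (1 + d) * norm_sq (ft (F n)) + ennreal (1 + 1 / d) * norm_sq (\<lambda>x. ft (F n) x - g x)"
        using norm_sq_add_le[OF _ _ d, of "ft (F n)" "\<lambda>x. g x - ft (F n) x"] by (simp add: norm_sq_minus_commute[of g])
      also have "norm_sq (ft (F n)) = ennreal ?K * norm_sq (F n)"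
        using F by (intro plancherel) auto
      also have "ennreal (1 + d) * (ennreal ?K * norm_sq (F n)) + ennreal (1 + 1 / d) * norm_sq (\<lambda>x. ft (F n) x - g x)
        \<le> ?R (norm_sq (\<lambda>x. F n x - f x)) (norm_sq (\<lambda>x. ft (F n) x - g x))"
        using norm_sq_add_le[OF _ _ d, of f "\<lambda>x. F n x - f x"] by (intro add_mono mult_left_mono order_refl) auto
      finally show ?thesis .
    qed
    moreover have "(\<lambda>n. ?R (norm_sq (\<lambda>x. F n x - f x)) (norm_sq (\<lambda>x. ft (F n) x - g x))) \<longlonglongrightarrow> ?R 0 0"
      by (intro tendsto_add ennreal_tendsto_cmult l1 l2 tendsto_const) auto
    ultimately have "norm_sq g \<le> ?R 0 0" by (intro LIMSEQ_le_const) auto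
    also have "\<dots> = ennreal ((1 + d) * (?K * ((1 + d) * ?r)))"
      using d by (subst r) (simp add: ennreal_mult del: ennreal_plus)
    finally show ?thesis .
  qed
  have "(\<lambda>n. ennreal ((1 + inverse (real (Suc n))) * (?K * ((1 + inverse (real (Suc n))) * ?r))))
     \<longlonglongrightarrow> ennreal ((1 + 0) * (?K * ((1 + 0) * ?r)))"
    by (intro tendsto_ennrealI tendsto_mult tendsto_add tendsto_const LIMSEQ_inverse_real_of_nat)
  then have "norm_sq g \<le> ennreal ((1 + 0) * (?K * ((1 + 0) * ?r)))"
    by (rule LIMSEQ_le_const) (use bd in auto)
  then show ?thesis by (subst r) (simp add: ennreal_mult)
qed

lemma in_L2_borel_rep:
  fixes f :: "real^'n \<Rightarrow> complex"
  assumes "in_L2 f"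
  obtains f' where "f' \<in> borel_measurable borel" "AE x in lborel. f x = f' x" "norm_sq f' < \<infinity>"
    "L2_norm_sq f = norm_sq f'"
  using lebesgue_complex_borel_rep[of f] assms L2_norm_sq_eq_norm_sq[of f] unfolding in_L2_def by metis

text \<open>Carries the normalisation \<open>L2_norm_sq f = 1\<close> of the suprema to the Fourier
  side, where the Dirac projections act.\<close>

lemma has_L2_fourier_norm_le:
  fixes f g :: "real^'n \<Rightarrow> complex"
  assumes "has_L2_fourier f g"
  shows "L2_norm_sq g \<le> ennreal ((2 * pi) ^ CARD('n)) * L2_norm_sq f"
proof -
  from assms obtain F where fg: "in_L2 f" "in_L2 g"
    and F: "\<And>n::nat. integrable lebesgue (F n)" "\<And>n. in_L2 (F n)"
    and l: "(\<lambda>n. L2_norm_sq (\<lambda>x. F n x - f x)) \<longlonglongrightarrow> 0" "(\<lambda>n. L2_norm_sq (\<lambda>\<xi>. fourier (F n) \<xi> - g \<xi>)) \<longlonglongrightarrow> 0"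
    unfolding has_L2_fourier_def by blast
  obtain f' where f': "f' \<in> borel_measurable borel" "AE x in lborel. f x = f' x" "norm_sq f' < \<infinity>" "L2_norm_sq f = norm_sq f'"
    using in_L2_borel_rep[OF fg(1)] .
  obtain g' where g': "g' \<in> borel_measurable borel" "AE x in lborel. g x = g' x" "norm_sq g' < \<infinity>" "L2_norm_sq g = norm_sq g'"
    using in_L2_borel_rep[OF fg(2)] .
  have "\<exists>h. h \<in> borel_measurable borel \<and> (AE x in lborel. F n x = h x) \<and> norm_sq h < \<infinity>" for n
    using in_L2_borel_rep[OF F(2)[of n]] by metis
  then obtain F' where F': "\<And>n. F' n \<in> borel_measurable borel" "\<And>n. AE x in lborel. F n x = F' n x" "\<And>n. norm_sq (F' n) < \<infinity>"
    by metis
  have Fm: "F n \<in> borel_measurable lebesgue" for n using F(1) by (rule borel_measurable_integrable)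
  have "norm_sq g' \<le> ennreal ((2 * pi) ^ DIM(real^'n)) * norm_sq f'"
  proof (rule norm_sq_ft_limit_le[of _ _ F'])
    show "integrable lborel (F' n)" for n
      using integrable_lebesgue_eq[OF Fm F'(1,2)] F(1) by simp
    have "L2_norm_sq (\<lambda>x. F n x - f x) = norm_sq (\<lambda>x. F' n x - f' x)" for n
      by (rule L2_norm_sq_eq_norm_sq) (use F'(2)[of n] f'(2) in eventually_elim, simp)
    then show "(\<lambda>n. norm_sq (\<lambda>x. F' n x - f' x)) \<longlonglongrightarrow> 0" using l by simp
    have "L2_norm_sq (\<lambda>x. fourier (F n) x - g x) = norm_sq (\<lambda>x. ft (F' n) x - g' x)" for n
      unfolding fourier_eq_ft[OF Fm F'(1,2)]
      by (rule L2_norm_sq_eq_norm_sq) (use g'(2) in eventually_elim, simp)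
    then show "(\<lambda>n. norm_sq (\<lambda>x. ft (F' n) x - g' x)) \<longlonglongrightarrow> 0" using l by simp
  qed (use f' g' F' in auto)
  then show ?thesis using f' g' by simp
qed

text \<open>On the ball, which has finite measure, |h| is at most 1 + |h|^2.\<close>

lemma L2_bounded_support_integrable:
  fixes h :: "'a::euclidean_space \<Rightarrow> complex"
  assumes [measurable]: "h \<in> borel_measurable borel" and "norm_sq h < \<infinity>" and s: "\<And>x. norm x > b \<Longrightarrow> h x = 0"
  shows "integrable lborel h"
proof (rule Bochner_Integration.integrable_bound)
  have "integrable lborel (indicator (cball (0::'a) b) :: 'a \<Rightarrow> real)"
    using emeasure_lborel_cball_finite[of "0::'a" b] by simp
  then show "integrable lborel (\<lambda>x. indicator (cball 0 b) x + (norm (h x))\<^sup>2)"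
    using norm_sq_eq_integral[OF assms(1,2)] by auto
  show "AE x in lborel. norm (h x) \<le> norm (indicator (cball 0 b) x + (norm (h x))\<^sup>2)"
  proof (rule AE_I2)
    fix x
    show "norm (h x) \<le> norm (indicator (cball 0 b) x + (norm (h x))\<^sup>2)"
    proof (cases "norm x \<le> b")
      case True
      have "norm (h x) \<le> 1 + (norm (h x))\<^sup>2"
        using zero_le_power2[of "norm (h x) - 1"] norm_ge_zero[of "h x"]
        by (simp add: power2_eq_square algebra_simps del: norm_ge_zero)
      then show ?thesis using True by simp
    qed (use s in auto)
  qed
qed measurable

definition annular :: "('a::euclidean_space \<Rightarrow> complex) \<Rightarrow> real \<Rightarrow> real \<Rightarrow> bool" where
  "annular h a b \<longleftrightarrow> h \<in> borel_measurable borel \<and> norm_sq h < \<infinity> \<and> 0 < a \<and> a \<le> b \<and>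
     (\<forall>x. norm x < a \<or> norm x > b \<longrightarrow> h x = 0)"

lemma compact_support_off_0_rep:
  fixes g :: "real^'n \<Rightarrow> complex"
  assumes "in_L2 g" "compact_support_off_0 g"
  obtains h a b where "annular h a b" "AE x in lborel. g x = h x" "L2_norm_sq g = norm_sq h"
proof -
  obtain g' where g': "g' \<in> borel_measurable borel" "AE x in lborel. g x = g' x" "norm_sq g' < \<infinity>" "L2_norm_sq g = norm_sq g'"
    using in_L2_borel_rep[OF assms(1)] .
  from assms(2) obtain K where K: "compact K" "0 \<notin> K" "AE x in lborel. x \<notin> K \<longrightarrow> g x = 0"
    unfolding compact_support_off_0_def AE_completion_iff by blast
  obtain c where c: "c > 0" "\<And>x. x \<in> K \<Longrightarrow> c \<le> norm x"
    using separate_point_closed[OF compact_imp_closed[OF K(1)] K(2)] by auto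
  obtain b where b: "\<And>x. x \<in> K \<Longrightarrow> norm x \<le> b"
    using compact_imp_bounded[OF K(1)] by (auto simp: bounded_iff)
  note [measurable] = g'(1)
  \<comment> \<open>The outer radius \<open>max b c\<close> is at least the inner radius
    \<open>c\<close> even if \<open>K\<close> is empty.\<close>
  define h where "h x = (if c \<le> norm x \<and> norm x \<le> max b c then g' x else 0)" for x
  have m: "h \<in> borel_measurable borel" unfolding h_def[abs_def] by measurable
  have ae: "AE x in lborel. g x = h x"
    using g'(2) K(3)
  proof eventually_elim
    case (elim x)
    then show ?case using c(2)[of x] b[of x] unfolding h_def by (cases "x \<in> K") auto
  qed
  have "norm_sq h \<le> norm_sq g'"
    unfolding norm_sq_def h_def by (intro nn_integral_mono) auto
  with g' have "norm_sq h < \<infinity>" by simp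
  then have "annular h c (max b c)"
    using m c(1) unfolding annular_def by (auto simp: h_def)
  then show ?thesis using ae L2_norm_sq_eq_norm_sq[OF ae] by (rule that)
qed

text \<open>Makes functions constructed on the Fourier side, such as the spectral parts of a datum,
  eligible in the suprema, which require a datum \<open>f\<close> with that transform.\<close>

lemma has_L2_fourier_exists:
  fixes g :: "real^'n \<Rightarrow> complex"
  assumes "in_L2 g" "compact_support_off_0 g"
  obtains f where "has_L2_fourier f g" "L2_norm_sq f = ennreal (1 / (2 * pi) ^ CARD('n)) * L2_norm_sq g"
proof -
  obtain h a b where hab: "annular h a b" and hg: "AE x in lborel. g x = h x" "L2_norm_sq g = norm_sq h"
    using compact_support_off_0_rep[OF assms] .
  have h: "h \<in> borel_measurable borel" "AE x in lborel. g x = h x" "norm_sq h < \<infinity>" "L2_norm_sq g = norm_sq h"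
    using hab hg by (auto simp: annular_def)
  have hi: "integrable lborel h"
    by (rule L2_bounded_support_integrable[OF h(1,3), of b]) (use hab in \<open>auto simp: annular_def\<close>)
  obtain f F where f: "f \<in> borel_measurable borel" "norm_sq f = ennreal (1 / (2 * pi) ^ DIM(real^'n)) * norm_sq h"
    and F: "\<forall>n::nat. F n \<in> borel_measurable borel \<and> integrable lborel (F n) \<and> norm_sq (F n) < \<infinity>"
    and l: "(\<lambda>n. norm_sq (\<lambda>x. F n x - f x)) \<longlonglongrightarrow> 0" "(\<lambda>n. norm_sq (\<lambda>x. ft (F n) x - h x)) \<longlonglongrightarrow> 0"
    using L2_fourier_inversion[OF h(1) hi h(3)] .
  have L2: "L2_norm_sq u = norm_sq u" for u :: "real^'n \<Rightarrow> complex"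
    by (rule L2_norm_sq_eq_norm_sq) simp
  have ff: "fourier (F n) \<xi> = ft (F n) \<xi>" for n \<xi>
    by (rule fourier_eq_ft) (use F in \<open>auto intro: measurable_completion\<close>)
  have lg: "L2_norm_sq (\<lambda>\<xi>. ft (F n) \<xi> - g \<xi>) = norm_sq (\<lambda>\<xi>. ft (F n) \<xi> - h \<xi>)" for n
    by (rule L2_norm_sq_eq_norm_sq) (use h(2) in eventually_elim, simp)
  have "norm_sq f < \<infinity>" using f h by (simp add: ennreal_mult_less_top)
  then have "in_L2 f" and "in_L2 (F n)" and "integrable lebesgue (F n)" for n
    using f(1) F by (auto simp: in_L2_def L2 integrable_completion intro: measurable_completion)
  then have "has_L2_fourier f g"
    unfolding has_L2_fourier_def ff using assms(1) l unfolding lg[symmetric] L2[symmetric]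
    by (intro conjI exI[of _ F] allI) (simp_all only: ff)
  then show ?thesis using f h by (intro that[of f]) (auto simp: L2)
qed

section \<open>Radial densities\<close>

text \<open>Polar coordinates for radial functions. The half-lines \<open>{..r}\<close> generate the
  Borel sets and are stable under intersection; on them the left side is the volume of a ball, and
  the density is the derivative of that volume in \<open>r\<close>.\<close>

lemma distr_norm_lborel:
  "distr (lborel :: 'a::euclidean_space measure) borel norm =
   density lborel (\<lambda>r. ennreal (real DIM('a) * unit_ball_vol (real DIM('a)) * r ^ (DIM('a) - 1)) * indicator {0..} r)"
    (is "?L = density lborel ?d")
proof (rule measure_eqI_generator_eq[where E = "range (\<lambda>r::real. {..r})" and \<Omega> = UNIV and A = "\<lambda>i::nat. {..real i}"])
  let ?V = "unit_ball_vol (real DIM('a))"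
  have V: "?V \<ge> 0" by simp
  have em: "emeasure ?L {..r} = (if 0 \<le> r then ennreal (?V * r ^ DIM('a)) else 0)" for r
  proof -
    have "emeasure ?L {..r} = emeasure lborel (norm -` {..r} :: 'a set)"
      by (subst emeasure_distr) auto
    also have "norm -` {..r} = cball (0::'a) r" by (auto simp: dist_norm)
    finally show ?thesis by (simp add: emeasure_cball)
  qed
  show "Int_stable (range (\<lambda>r::real. {..r}))"
    by (auto simp: Int_stable_def)
  show "sets ?L = sigma_sets UNIV (range (\<lambda>r::real. {..r}))"
    and "sets (density lborel ?d) = sigma_sets UNIV (range (\<lambda>r::real. {..r}))"
    by (simp_all add: borel_eq_atMost)
  show "emeasure ?L X = emeasure (density lborel ?d) X" if "X \<in> range (\<lambda>r::real. {..r})" for X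
  proof -
    from that obtain r where X: "X = {..r}" by (rule rangeE)
    have D: "emeasure (density lborel ?d) X = (\<integral>\<^sup>+s. ennreal (real DIM('a) * ?V * s ^ (DIM('a) - 1)) * indicator {0..r} s \<partial>lborel)"
      unfolding X by (subst emeasure_density) (auto intro!: nn_integral_cong split: split_indicator)
    show ?thesis
    proof (cases "0 \<le> r")
      case True
      have "(\<integral>\<^sup>+s. ennreal (real DIM('a) * ?V * s ^ (DIM('a) - 1)) * indicator {0..r} s \<partial>lborel)
        = ennreal (?V * r ^ DIM('a) - ?V * 0 ^ DIM('a))"
        by (rule nn_integral_FTC_Icc) (use True in \<open>auto intro!: derivative_eq_intros\<close>)
      then show ?thesis unfolding D unfolding X em using True by simp
    next
      case False
      then show ?thesis unfolding D unfolding X em by simp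
    qed
  qed
  show "(\<Union>i::nat. {..real i}) = UNIV" using real_arch_simple by auto
  show "emeasure ?L {..real i} \<noteq> \<infinity>" for i by (simp add: em)
qed auto

lemma nn_integral_norm_le:
  fixes f :: "real \<Rightarrow> ennreal"
  assumes [measurable]: "f \<in> borel_measurable borel"
  shows "(\<integral>\<^sup>+x. f (norm (x::'a::euclidean_space)) * indicator {..b} (norm x) \<partial>lborel)
    \<le> ennreal (real DIM('a) * unit_ball_vol (real DIM('a)) * b ^ (DIM('a) - 1)) * (\<integral>\<^sup>+r. f r \<partial>lborel)"
proof -
  have "(\<integral>\<^sup>+x. f (norm (x::'a)) * indicator {..b} (norm x) \<partial>lborel) =
     (\<integral>\<^sup>+r. f r * indicator {..b} r \<partial>(distr (lborel :: 'a measure) borel norm))"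
    by (subst nn_integral_distr) auto
  also have "\<dots> = (\<integral>\<^sup>+r. (ennreal (real DIM('a) * unit_ball_vol (real DIM('a)) * r ^ (DIM('a) - 1)) * indicator {0..} r)
      * (f r * indicator {..b} r) \<partial>lborel)"
    unfolding distr_norm_lborel by (subst nn_integral_density) auto
  also have "\<dots> \<le> (\<integral>\<^sup>+r. ennreal (real DIM('a) * unit_ball_vol (real DIM('a)) * b ^ (DIM('a) - 1)) * f r \<partial>lborel)"
    by (intro nn_integral_mono) (auto split: split_indicator intro!: mult_right_mono ennreal_leI mult_left_mono power_mono)
  also have "\<dots> = ennreal (real DIM('a) * unit_ball_vol (real DIM('a)) * b ^ (DIM('a) - 1)) * (\<integral>\<^sup>+r. f r \<partial>lborel)"
    by (rule nn_integral_cmult) measurable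
  finally show ?thesis .
qed

text \<open>\<open>G\<close> is the density of the image under the norm of the complex measure with
  density \<open>h\<close>, described by duality with bounded Borel functions of the norm. Square
  integrability is part of the notion because Plancherel in time is applied to a reparametrization
  of \<open>G\<close>.\<close>

definition radial_density :: "('a::euclidean_space \<Rightarrow> complex) \<Rightarrow> (real \<Rightarrow> complex) \<Rightarrow> real \<Rightarrow> real \<Rightarrow> bool" where
  "radial_density h G a b \<longleftrightarrow>
     G \<in> borel_measurable borel \<and> integrable lborel G \<and> norm_sq G < \<infinity> \<and> (\<forall>r. r < a \<or> b < r \<longrightarrow> G r = 0) \<and>
     (\<forall>k. k \<in> borel_measurable borel \<longrightarrow> (\<exists>B. \<forall>r. norm (k r :: complex) \<le> B) \<longrightarrow>
        (LINT x|lborel. k (norm x) * h x) = (LINT r|lborel. k r * G r))"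

text \<open>Radon-Nikodym provides an integrable \<open>G\<close>. For its L^2 norm, the integral of
  \<open>G\<close> times a truncation of \<open>G\<close> equals the integral of \<open>h\<close>
  times that truncation at |x|; Young's inequality and polar coordinates bound it by a multiple of
  the squared norm of \<open>h\<close> plus one half of the squared norm of the truncation, and the
  latter is absorbed.\<close>

lemma radial_density_nonneg:
  fixes h :: "'a::euclidean_space \<Rightarrow> real"
  assumes [measurable]: "h \<in> borel_measurable borel" and h0: "\<And>x. 0 \<le> h x"
    and fin: "norm_sq (\<lambda>x. complex_of_real (h x)) < \<infinity>"
    and ab: "0 < a" and s: "\<And>x. norm x < a \<or> norm x > b \<Longrightarrow> h x = 0"
  shows "\<exists>G. radial_density (\<lambda>x. complex_of_real (h x)) G a b"
proof -
  have hi': "integrable lborel (\<lambda>x. complex_of_real (h x))"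
    by (rule L2_bounded_support_integrable[where b = b]) (use fin s in auto)
  then have hi: "integrable lborel h" by (simp only: complex_of_real_integrable_eq)
  let ?M = "density lborel (\<lambda>x. ennreal (h x))"
  let ?N = "distr ?M borel norm"
  have [measurable]: "norm \<in> borel_measurable ?M" by simp
  \<comment> \<open>A null set of radii has a null preimage under the norm by
    \<open>distr_norm_lborel\<close>, and \<open>?M\<close> has a density.\<close>
  have "absolutely_continuous lborel ?N"
    unfolding absolutely_continuous_def
  proof
    fix X assume X: "X \<in> null_sets (lborel :: real measure)"
    then have [measurable]: "X \<in> sets borel" by (auto simp: null_sets_def)
    have "emeasure (distr (lborel :: 'a measure) borel norm) X = 0"
    proof -
      have "AE r in lborel. r \<notin> X" by (rule AE_not_in[OF X])
      then show ?thesis unfolding distr_norm_lborel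
        by (subst emeasure_density) (auto simp: nn_integral_0_iff_AE elim!: eventually_mono)
    qed
    then have "norm -` X \<in> null_sets (lborel :: 'a measure)"
      by (subst (asm) emeasure_distr) (auto simp: null_sets_def intro!: measurable_sets_borel[OF _ \<open>X \<in> sets borel\<close>])
    then have "AE x::'a in lborel. norm x \<notin> X" using AE_not_in by fastforce
    then have "emeasure ?M (norm -` X) = 0"
      by (subst emeasure_density)
        (auto simp: nn_integral_0_iff_AE intro!: measurable_sets_borel[OF _ \<open>X \<in> sets borel\<close>] elim!: eventually_mono)
    then show "X \<in> null_sets ?N" by (auto simp: null_sets_def emeasure_distr)
  qed
  then obtain f where [measurable]: "f \<in> borel_measurable lborel" and f: "density lborel f = ?N"
    using sigma_finite_measure.Radon_Nikodym[OF sigma_finite_lborel, of ?N] by auto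
  have nnN: "(\<integral>\<^sup>+r. f r * k r \<partial>lborel) = (\<integral>\<^sup>+x. ennreal (h x) * k (norm x) \<partial>lborel)"
    if [measurable]: "k \<in> borel_measurable borel" for k
  proof -
    have "(\<integral>\<^sup>+r. f r * k r \<partial>lborel) = (\<integral>\<^sup>+r. k r \<partial>density lborel f)"
      by (subst nn_integral_density) auto
    also have "\<dots> = (\<integral>\<^sup>+x. k (norm x) \<partial>?M)" unfolding f by (subst nn_integral_distr) auto
    also have "\<dots> = (\<integral>\<^sup>+x. ennreal (h x) * k (norm x) \<partial>lborel)" by (subst nn_integral_density) auto
    finally show ?thesis .
  qed
  have ff: "(\<integral>\<^sup>+r. f r \<partial>lborel) < \<infinity>"
    using nnN[of "\<lambda>_. 1"] nn_integral_eq_integral[OF hi] h0 by simp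
  then have fae: "AE r in lborel. f r \<noteq> \<infinity>" by (intro nn_integral_PInf_AE) auto
  have "(\<integral>\<^sup>+r. f r * indicator (- {a..b}) r \<partial>lborel) = (\<integral>\<^sup>+x. ennreal (h x) * indicator (- {a..b}) (norm x) \<partial>lborel)"
    by (rule nnN) simp
  also have "(\<lambda>x. ennreal (h x) * indicator (- {a..b}) (norm x)) = (\<lambda>x. 0)"
    using s by (force split: split_indicator)
  also have "(\<integral>\<^sup>+x. 0 \<partial>(lborel :: 'a measure)) = 0" by simp
  finally have "AE r in lborel. f r * indicator (- {a..b}) r = 0"
    by (subst (asm) nn_integral_0_iff_AE) auto
  then have foff: "AE r in lborel. r \<notin> {a..b} \<longrightarrow> f r = 0" by eventually_elim (auto split: split_indicator_asm)
  \<comment> \<open>\<open>enn2real\<close> turns the value infinity, which \<open>f\<close> takes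
    only on a null set, into 0. The indicator makes \<open>G\<close> vanish outside the interval
    everywhere instead of almost everywhere.\<close>
  define G where "G r = enn2real (f r) * indicator {a..b} r" for r
  have [measurable]: "G \<in> borel_measurable borel" unfolding G_def[abs_def] by measurable
  have G0: "0 \<le> G r" for r by (simp add: G_def)
  have G_off: "r < a \<or> b < r \<longrightarrow> G r = 0" for r by (simp add: G_def)
  have Gf: "AE r in lborel. ennreal (G r) = f r"
    using fae foff by eventually_elim (auto simp: G_def less_top split: split_indicator)
  have Gi: "integrable lborel G"
  proof (rule integrableI_bounded)
    have "(\<integral>\<^sup>+r. ennreal (norm (G r)) \<partial>lborel) = (\<integral>\<^sup>+r. f r \<partial>lborel)"
      by (rule nn_integral_cong_AE) (use Gf G0 in auto)
    then show "(\<integral>\<^sup>+r. ennreal (norm (G r)) \<partial>lborel) < \<infinity>" using ff by simp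
  qed simp
  have dG: "density lborel (\<lambda>r. ennreal (G r)) = ?N"
    unfolding f[symmetric] by (rule density_cong) (use Gf in auto)
  have dual: "(LINT x|lborel. k (norm x) * complex_of_real (h x)) = (LINT r|lborel. k r * complex_of_real (G r))"
    if [measurable]: "k \<in> borel_measurable borel" for k :: "real \<Rightarrow> complex"
  proof -
    have "(LINT x|lborel. k (norm x) * complex_of_real (h x)) = (LINT x|?M. k (norm x))"
      by (subst integral_density) (auto simp: h0 scaleR_conv_of_real mult.commute)
    also have "\<dots> = (LINT r|?N. k r)" by (subst integral_distr) auto
    also have "\<dots> = (LINT r|lborel. k r * complex_of_real (G r))"
      unfolding dG[symmetric] by (subst integral_density) (auto simp: G0 scaleR_conv_of_real mult.commute)
    finally show ?thesis .
  qed
  \<comment> \<open>The constant of \<open>nn_integral_norm_le\<close>, enlarged by 1 so that it is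
    positive and can be divided by.\<close>
  define C where "C = real DIM('a) * unit_ball_vol (real DIM('a)) * \<bar>b\<bar> ^ (DIM('a) - 1) + 1"
  have C: "C > 0" unfolding C_def by (simp add: add_nonneg_pos)
  let ?H = "norm_sq (\<lambda>x. complex_of_real (h x))"
  \<comment> \<open>Absorbing a term on the left demands that it be finite, which is clear for the
    truncations: their squares are at most \<open>n\<close> times the integrable
    \<open>G\<close>.\<close>
  define Gn where "Gn n r = min (G r) (real n)" for n r
  have [measurable]: "Gn n \<in> borel_measurable borel" for n unfolding Gn_def[abs_def] by measurable
  have Gn0: "0 \<le> Gn n r" for n r using G0 by (simp add: Gn_def)
  have bd: "(\<integral>\<^sup>+r. ennreal ((Gn n r)\<^sup>2) \<partial>lborel) \<le> ennreal C * ?H" for n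
  proof -
    define q :: real where "q = 1 / 2"
    have q0: "0 \<le> q" by (simp add: q_def)
    let ?I = "\<integral>\<^sup>+r. ennreal ((Gn n r)\<^sup>2) \<partial>lborel"
    have le: "(Gn n r)\<^sup>2 \<le> G r * Gn n r" for r
      unfolding power2_eq_square using Gn0 by (intro mult_right_mono) (auto simp: Gn_def)
    have "?I \<le> (\<integral>\<^sup>+r. ennreal (G r) * ennreal (Gn n r) \<partial>lborel)"
      using le G0 Gn0 by (intro nn_integral_mono) (simp add: ennreal_mult[symmetric] ennreal_leI)
    also have eq: "\<dots> = (\<integral>\<^sup>+r. f r * ennreal (Gn n r) \<partial>lborel)"
      by (rule nn_integral_cong_AE) (use Gf in auto)
    also have "\<dots> = (\<integral>\<^sup>+x. ennreal (h x) * ennreal (Gn n (norm x)) \<partial>lborel)"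
      by (rule nnN) simp
    also have "\<dots> \<le> (\<integral>\<^sup>+x. ennreal (C / 2) * ennreal ((h x)\<^sup>2)
        + ennreal (1 / (2 * C)) * (ennreal ((Gn n (norm x))\<^sup>2) * indicator {..\<bar>b\<bar>} (norm x)) \<partial>lborel)"
    proof (rule nn_integral_mono)
      fix x
      show "ennreal (h x) * ennreal (Gn n (norm x)) \<le> ennreal (C / 2) * ennreal ((h x)\<^sup>2)
        + ennreal (1 / (2 * C)) * (ennreal ((Gn n (norm x))\<^sup>2) * indicator {..\<bar>b\<bar>} (norm x))"
      proof (cases "norm x \<le> \<bar>b\<bar>")
        case True
        have "0 \<le> (C * h x - Gn n (norm x))\<^sup>2 / (2 * C)" using C by simp
        also have "\<dots> = C / 2 * (h x)\<^sup>2 + 1 / (2 * C) * (Gn n (norm x))\<^sup>2 - h x * Gn n (norm x)"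
          using C by (simp add: power2_eq_square field_simps)
        finally have "h x * Gn n (norm x) \<le> C / 2 * (h x)\<^sup>2 + 1 / (2 * C) * (Gn n (norm x))\<^sup>2" by simp
        then show ?thesis using True C h0 Gn0
          by (simp add: ennreal_mult[symmetric] ennreal_plus[symmetric] ennreal_leI del: ennreal_plus)
      next
        case False
        then have "h x = 0" by (intro s) auto
        then show ?thesis by simp
      qed
    qed
    also have "\<dots> = ennreal (C / 2) * ?H + ennreal (1 / (2 * C)) *
       (\<integral>\<^sup>+x. ennreal ((Gn n (norm (x::'a)))\<^sup>2) * indicator {..\<bar>b\<bar>} (norm x) \<partial>lborel)"
      unfolding norm_sq_def by (subst nn_integral_add, measurable) (simp add: nn_integral_cmult)
    also have "(\<integral>\<^sup>+x. ennreal ((Gn n (norm (x::'a)))\<^sup>2) * indicator {..\<bar>b\<bar>} (norm x) \<partial>lborel) \<le>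
        ennreal (real DIM('a) * unit_ball_vol (real DIM('a)) * \<bar>b\<bar> ^ (DIM('a) - 1)) * ?I"
      by (rule nn_integral_norm_le) measurable
    also have "\<dots> \<le> ennreal C * ?I" by (intro mult_right_mono ennreal_leI) (auto simp: C_def)
    also have "ennreal (1 / (2 * C)) * (ennreal C * ?I) = ennreal q * ?I"
      unfolding mult.assoc[symmetric] using C by (subst ennreal_mult[symmetric]) (auto simp: q_def)
    finally have 1: "?I \<le> ennreal (C / 2) * ?H + ennreal q * ?I"
      by (auto simp: mult_left_mono add_left_mono)
    have "?I \<le> (\<integral>\<^sup>+r. ennreal (real n) * ennreal (G r) \<partial>lborel)"
      using G0 Gn0 unfolding power2_eq_square
      by (intro nn_integral_mono) (auto simp: ennreal_mult[symmetric] Gn_def intro!: ennreal_leI mult_mono)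
    also have "\<dots> < \<infinity>"
      using Gi G0 by (subst nn_integral_cmult) (auto simp: ennreal_mult_less_top nn_integral_eq_integral)
    finally obtain I where I: "?I = ennreal I" "0 \<le> I" by (cases ?I) auto
    obtain H where H: "?H = ennreal H" "0 \<le> H" using fin by (cases ?H) auto
    from 1 have "I \<le> C / 2 * H + q * I"
      unfolding I(1) H(1) using C I(2) H(2) q0
      by (simp add: ennreal_mult[symmetric] ennreal_plus[symmetric] del: ennreal_plus)
    then have "I \<le> C * H" by (simp add: q_def)
    then show ?thesis unfolding I(1) H(1) using C H(2) by (simp add: ennreal_mult[symmetric] ennreal_leI)
  qed
  have "(\<lambda>n. \<integral>\<^sup>+r. ennreal ((Gn n r)\<^sup>2) \<partial>lborel) \<longlonglongrightarrow> (\<integral>\<^sup>+r. ennreal ((G r)\<^sup>2) \<partial>lborel)"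
  proof (rule nn_integral_LIMSEQ)
    show "incseq (\<lambda>n r. ennreal ((Gn n r)\<^sup>2))"
    proof (rule incseq_SucI, rule le_funI, rule ennreal_leI)
      show "(Gn n r)\<^sup>2 \<le> (Gn (Suc n) r)\<^sup>2" for n r
        using Gn0 by (intro power_mono) (auto simp: Gn_def)
    qed
    show "(\<lambda>n. ennreal ((Gn n r)\<^sup>2)) \<longlonglongrightarrow> ennreal ((G r)\<^sup>2)" for r
    proof (rule tendsto_eventually)
      obtain n0 where "G r \<le> real n0" using real_arch_simple by blast
      then show "\<forall>\<^sub>F n in sequentially. ennreal ((Gn n r)\<^sup>2) = ennreal ((G r)\<^sup>2)"
        by (intro eventually_sequentiallyI[of n0]) (auto simp: Gn_def min_def)
    qed
  qed measurable
  then have "(\<integral>\<^sup>+r. ennreal ((G r)\<^sup>2) \<partial>lborel) \<le> ennreal C * ?H"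
    by (rule LIMSEQ_le_const2) (use bd in auto)
  also have "\<dots> < \<infinity>" using fin by (simp add: ennreal_mult_less_top)
  finally have "norm_sq (\<lambda>r. complex_of_real (G r)) < \<infinity>" by (simp add: norm_sq_def)
  then have "radial_density (\<lambda>x. complex_of_real (h x)) (\<lambda>r. complex_of_real (G r)) a b"
    using Gi dual G_off unfolding radial_density_def by (simp add: complex_of_real_integrable_eq)
  then show ?thesis by blast
qed

lemma radial_density_diff:
  assumes 1: "radial_density h1 G1 a b" and 2: "radial_density h2 G2 a b"
    and i: "integrable lborel h1" "integrable lborel h2"
  shows "radial_density (\<lambda>x. h1 x - c * h2 x) (\<lambda>r. G1 r - c * G2 r) a b"
proof -
  note d1 = 1[unfolded radial_density_def] and d2 = 2[unfolded radial_density_def]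
  have [measurable]: "G1 \<in> borel_measurable borel" "G2 \<in> borel_measurable borel" using d1 d2 by auto
  have "norm_sq (\<lambda>r. G1 r - c * G2 r) \<le> 2 * (norm_sq G1 + norm_sq (\<lambda>r. c * G2 r))"
    by (rule norm_sq_diff_le) measurable
  also have "\<dots> < \<infinity>" using d1 d2 by (simp add: norm_sq_cmult ennreal_mult_less_top)
  finally have n: "norm_sq (\<lambda>r. G1 r - c * G2 r) < \<infinity>" .
  have "(LINT x|lborel. k (norm x) * (h1 x - c * h2 x)) = (LINT r|lborel. k r * (G1 r - c * G2 r))"
    if [measurable]: "k \<in> borel_measurable borel" and B: "\<And>r. norm (k r) \<le> B" for k :: "real \<Rightarrow> complex" and B
  proof -
    have ih: "integrable lborel (\<lambda>x. k (norm x) * h1 x)" "integrable lborel (\<lambda>x. k (norm x) * h2 x)"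
      and iG: "integrable lborel (\<lambda>r. k r * G1 r)" "integrable lborel (\<lambda>r. k r * G2 r)"
      using i d1 d2 B by (auto intro!: integrable_bounded_mult[where B = B])
    have e1: "(LINT x|lborel. k (norm x) * h1 x) = (LINT r|lborel. k r * G1 r)"
      and e2: "(LINT x|lborel. k (norm x) * h2 x) = (LINT r|lborel. k r * G2 r)"
      using d1 d2 B that by blast+
    have "(LINT x|lborel. k (norm x) * (h1 x - c * h2 x))
        = (LINT x|lborel. k (norm x) * h1 x - c * (k (norm x) * h2 x))"
      by (simp add: algebra_simps)
    also have "\<dots> = (LINT x|lborel. k (norm x) * h1 x) - c * (LINT x|lborel. k (norm x) * h2 x)"
      using ih by simp
    also have "\<dots> = (LINT r|lborel. k r * G1 r - c * (k r * G2 r))"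
      unfolding e1 e2 using iG by simp
    also have "\<dots> = (LINT r|lborel. k r * (G1 r - c * G2 r))" by (simp add: algebra_simps)
    finally show ?thesis .
  qed
  then show ?thesis using d1 d2 n unfolding radial_density_def by auto
qed

text \<open>The positive and negative parts of the real and imaginary parts of \<open>h\<close> are
  nonnegative and bounded by |h|; the coefficients 1, -i and i in \<open>radial_density_diff\<close>
  put them together again.\<close>

lemma radial_density_exists:
  fixes h :: "'a::euclidean_space \<Rightarrow> complex"
  assumes [measurable]: "h \<in> borel_measurable borel" and fin: "norm_sq h < \<infinity>"
    and a: "0 < a" and s: "\<And>x. norm x < a \<or> norm x > b \<Longrightarrow> h x = 0"
  shows "\<exists>G. radial_density h G a b"
proof -
  have *: "\<exists>G. radial_density (\<lambda>x. complex_of_real (p (h x))) G a b"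
    "integrable lborel (\<lambda>x. complex_of_real (p (h x)))"
    if [measurable]: "p \<in> borel_measurable borel" and p: "\<And>z. 0 \<le> p z" "\<And>z. p z \<le> norm z" for p :: "complex \<Rightarrow> real"
  proof -
    have "norm_sq (\<lambda>x. complex_of_real (p (h x))) \<le> norm_sq h"
      unfolding norm_sq_def using p by (intro nn_integral_mono ennreal_leI power_mono) auto
    with fin have f: "norm_sq (\<lambda>x. complex_of_real (p (h x))) < \<infinity>" by simp
    have z: "p (h x) = 0" if "norm x < a \<or> norm x > b" for x
      using s[OF that] p[of 0] by simp
    show "\<exists>G. radial_density (\<lambda>x. complex_of_real (p (h x))) G a b"
      by (rule radial_density_nonneg[OF _ _ f a z]) (use p in auto)
    show "integrable lborel (\<lambda>x. complex_of_real (p (h x)))"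
      by (rule L2_bounded_support_integrable[OF _ f, of b]) (use z in auto)
  qed
  have le: "max 0 (Re z) \<le> norm z" "max 0 (- Re z) \<le> norm z" "max 0 (Im z) \<le> norm z" "max 0 (- Im z) \<le> norm z" for z
    using abs_Re_le_cmod[of z] abs_Im_le_cmod[of z] by auto
  note h1 = *[of "\<lambda>z. max 0 (Re z)"] and h2 = *[of "\<lambda>z. max 0 (- Re z)"]
   and h3 = *[of "\<lambda>z. max 0 (Im z)"] and h4 = *[of "\<lambda>z. max 0 (- Im z)"]
  obtain G1 G2 G3 G4 where G: "radial_density (\<lambda>x. complex_of_real (max 0 (Re (h x)))) G1 a b"
     "radial_density (\<lambda>x. complex_of_real (max 0 (- Re (h x)))) G2 a b"
     "radial_density (\<lambda>x. complex_of_real (max 0 (Im (h x)))) G3 a b"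
     "radial_density (\<lambda>x. complex_of_real (max 0 (- Im (h x)))) G4 a b"
    using h1(1) h2(1) h3(1) h4(1) le by (auto)
  have i: "integrable lborel (\<lambda>x. complex_of_real (max 0 (Re (h x))))"
     "integrable lborel (\<lambda>x. complex_of_real (max 0 (- Re (h x))))"
     "integrable lborel (\<lambda>x. complex_of_real (max 0 (Im (h x))))"
     "integrable lborel (\<lambda>x. complex_of_real (max 0 (- Im (h x))))"
    using h1(2) h2(2) h3(2) h4(2) le by (simp_all)
  note r1 = radial_density_diff[OF G(1,2) i(1,2), of 1]
  note r2 = radial_density_diff[OF r1 G(3) _ i(3), of "- \<i>"]
  note r3 = radial_density_diff[OF r2 G(4) _ i(4), of "\<i>"]
  have "(\<lambda>x. complex_of_real (max 0 (Re (h x))) - 1 * complex_of_real (max 0 (- Re (h x)))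
     - - \<i> * complex_of_real (max 0 (Im (h x))) - \<i> * complex_of_real (max 0 (- Im (h x)))) = h"
    by (rule ext) (simp add: complex_eq_iff max_def)
  moreover note r3
  ultimately show ?thesis using i by (auto)
qed

section \<open>Substitution of the time frequency for the radius\<close>

definition dispersion :: "(real \<Rightarrow> real) \<Rightarrow> (real \<Rightarrow> real) \<Rightarrow> bool" where
  "dispersion \<phi> \<phi>' \<longleftrightarrow> continuous_on {0<..} \<phi>' \<and>
        (\<forall>r>0. (\<phi> has_real_derivative \<phi>' r) (at r) \<and> \<phi>' r > 0)"

lemma dispersion_strict_mono:
  assumes "dispersion \<phi> \<phi>'" "0 < r" "r < s"
  shows "\<phi> r < \<phi> s"
proof (rule DERIV_pos_imp_increasing[OF assms(3)])
  fix x assume "r \<le> x"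
  then have "0 < x" using assms(2) by simp
  then show "\<exists>y. (\<phi> has_real_derivative y) (at x) \<and> 0 < y"
    using assms(1) unfolding dispersion_def by blast
qed

text \<open>\<open>u\<close> is G / \<phi>' composed with the inverse of \<open>\<phi>\<close>.
  Against the measure ds = \<phi>' dr one factor \<phi>' cancels: integrals of \<open>u\<close> lose
  the Jacobian altogether, while in the integral of |u|^2 one factor 1 / \<phi>' remains.\<close>

lemma dispersion_substitution:
  fixes G :: "real \<Rightarrow> complex"
  assumes \<phi>: "dispersion \<phi> \<phi>'" and ab: "0 < a" "a \<le> b"
    and [measurable]: "G \<in> borel_measurable borel" and Gi: "integrable lborel G" and Gf: "norm_sq G < \<infinity>"
    and G0: "\<And>r. r < a \<or> b < r \<Longrightarrow> G r = 0"
  obtains u where "u \<in> borel_measurable borel" "integrable lborel u" "norm_sq u < \<infinity>"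
    "norm_sq u = (\<integral>\<^sup>+r. ennreal ((norm (G r))\<^sup>2 / \<phi>' r) \<partial>lborel)"
    "\<forall>s. s < \<phi> a \<or> \<phi> b < s \<longrightarrow> u s = 0"
    "\<forall>t. ft u t = (LINT r|lborel. cis (- (\<phi> r * t)) * G r)"
proof -
  have c': "continuous_on {a..b} \<phi>'" and d: "\<And>r. 0 < r \<Longrightarrow> (\<phi> has_real_derivative \<phi>' r) (at r)"
    and pos: "\<And>r. 0 < r \<Longrightarrow> \<phi>' r > 0"
    using \<phi> ab unfolding dispersion_def by (auto intro: continuous_on_subset)
  have mono: "\<phi> r \<le> \<phi> s" if "0 < r" "r \<le> s" for r s
    using dispersion_strict_mono[OF \<phi> that(1), of s] that(2) by (cases "r = s") auto
  have inj: "inj_on \<phi> {a..b}"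
  proof (rule linorder_inj_onI)
    show "\<phi> x \<noteq> \<phi> y" if "x < y" "x \<in> {a..b}" "y \<in> {a..b}" for x y
      using dispersion_strict_mono[OF \<phi>, of x y] that ab by auto
  qed auto
  have cphi: "continuous_on {a..b} \<phi>"
    using d ab by (intro continuous_at_imp_continuous_on ballI) (auto intro: DERIV_isCont[OF d])
  have im: "\<phi> ` {a..b} = {\<phi> a..\<phi> b}"
  proof
    show "\<phi> ` {a..b} \<subseteq> {\<phi> a..\<phi> b}" using mono ab by auto
    show "{\<phi> a..\<phi> b} \<subseteq> \<phi> ` {a..b}"
      using IVT'[of \<phi> a _ b] cphi ab by (fastforce simp: image_iff)
  qed
  define \<theta> where "\<theta> = inv_into {a..b} \<phi>"
  have \<theta>: "\<theta> (\<phi> r) = r" if "r \<in> {a..b}" for r unfolding \<theta>_def using inj that by (rule inv_into_f_f)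
  have c\<theta>: "continuous_on {\<phi> a..\<phi> b} \<theta>"
    unfolding im[symmetric] using cphi \<theta> by (intro continuous_on_inv) auto
  \<comment> \<open>\<open>T\<close>, \<open>p\<close> and \<open>q\<close> extend the inverse of
    \<open>\<phi>\<close>, \<open>\<phi>\<close> and \<open>\<phi>'\<close> from their intervals to
    Borel functions on the whole line. The default \<open>a\<close> of \<open>T\<close> is masked by
    the indicator in \<open>u\<close>.\<close>
  define T where "T s = (if s \<in> {\<phi> a..\<phi> b} then \<theta> s else a)" for s
  have [measurable]: "T \<in> borel_measurable borel"
    unfolding T_def[abs_def] using c\<theta> by (intro borel_measurable_continuous_on_if) auto
  define p where "p r = (if r \<in> {a..b} then \<phi> r else 0)" for r
  have [measurable]: "p \<in> borel_measurable borel"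
    unfolding p_def[abs_def] using cphi by (intro borel_measurable_continuous_on_if) auto
  define q where "q r = (if r \<in> {a..b} then \<phi>' r else 0)" for r
  have [measurable]: "q \<in> borel_measurable borel"
    unfolding q_def[abs_def] using c' by (intro borel_measurable_continuous_on_if) auto
  have q0: "0 \<le> q r" for r using pos[of r] ab by (auto simp: q_def)
  let ?I = "{\<phi> a..\<phi> b}"
  \<comment> \<open>The change of variables as an identity of measures, so that it serves complex
    integrals in \<open>L\<close> and nonnegative ones in \<open>N\<close> alike. On each Borel set
    it is the substitution rule for an indicator function.\<close>
  have dd: "distr (density lborel (\<lambda>r. ennreal (q r))) borel p = density lborel (indicator ?I)"
  proof (rule measure_eqI)
    fix B assume "B \<in> sets (distr (density lborel (\<lambda>r. ennreal (q r))) borel p)"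
    then have B[measurable]: "B \<in> sets borel" by simp
    have "emeasure (density lborel (indicator ?I)) B = (\<integral>\<^sup>+s. ennreal (indicator B s) * indicator ?I s \<partial>lborel)"
      by (subst emeasure_density) (auto intro!: nn_integral_cong split: split_indicator)
    also have "\<dots> = (\<integral>\<^sup>+r. ennreal (indicator B (\<phi> r) * \<phi>' r * indicator {a..b} r) \<partial>lborel)"
    proof -
      have "(\<integral>\<^sup>+s. ennreal (indicator B s * indicator ?I s) \<partial>lborel) = (\<integral>\<^sup>+r. ennreal (indicator B (\<phi> r) * \<phi>' r * indicator {a..b} r) \<partial>lborel)"
        by (rule nn_integral_substitution[OF _ _ c' _ ab(2)])
          (use d pos ab in \<open>auto simp: set_borel_measurable_def intro: less_imp_le\<close>)
      then show ?thesis by (simp add: ennreal_mult ennreal_indicator)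
    qed
    also have "\<dots> = (\<integral>\<^sup>+r. ennreal (q r) * indicator (p -` B) r \<partial>lborel)"
      by (intro nn_integral_cong) (auto simp: p_def q_def split: split_indicator)
    also have "\<dots> = emeasure (distr (density lborel (\<lambda>r. ennreal (q r))) borel p) B"
      by (subst emeasure_distr, simp, simp, subst emeasure_density)
        (auto intro!: measurable_sets_borel[OF _ B])
    finally show "emeasure (distr (density lborel (\<lambda>r. ennreal (q r))) borel p) B = emeasure (density lborel (indicator ?I)) B" ..
  qed simp
  define v where "v s = G (T s) / of_real (q (T s))" for s
  have [measurable]: "v \<in> borel_measurable borel" unfolding v_def[abs_def] by measurable
  have vp: "q r *\<^sub>R v (p r) = G r" for r
  proof (cases "r \<in> {a..b}")
    case True
    then have "p r \<in> ?I" "T (p r) = r" using im \<theta> by (auto simp: p_def T_def)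
    then show ?thesis using True pos[of r] ab by (simp add: v_def q_def scaleR_conv_of_real)
  next
    case False
    then show ?thesis using G0[of r] by (auto simp: q_def)
  qed
  define u where "u s = indicator ?I s *\<^sub>R v s" for s
  have [measurable]: "u \<in> borel_measurable borel" unfolding u_def[abs_def] by measurable
  have ind: "density lborel (indicator ?I) = density lborel (\<lambda>s. ennreal (indicator ?I s))"
    by (simp add: ennreal_indicator)
  have L: "(LINT s|lborel. K s * u s) = (LINT r|lborel. K (p r) * G r)"
    if [measurable]: "K \<in> borel_measurable borel" for K :: "real \<Rightarrow> complex"
  proof -
    have "(LINT s|lborel. K s * u s) = (LINT s|density lborel (\<lambda>s. ennreal (indicator ?I s)). K s * v s)"
      by (subst integral_density) (auto simp: u_def)
    also have "\<dots> = (LINT r|density lborel (\<lambda>r. ennreal (q r)). K (p r) * v (p r))"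
      unfolding ind[symmetric] dd[symmetric] by (subst integral_distr) auto
    also have "\<dots> = (LINT r|lborel. K (p r) * (q r *\<^sub>R v (p r)))"
      by (subst integral_density) (auto simp: q0)
    finally show ?thesis unfolding vp .
  qed
  have N: "(\<integral>\<^sup>+s. K s * indicator ?I s \<partial>lborel) = (\<integral>\<^sup>+r. ennreal (q r) * K (p r) \<partial>lborel)"
    if [measurable]: "K \<in> borel_measurable borel" for K :: "real \<Rightarrow> ennreal"
  proof -
    have "(\<integral>\<^sup>+s. K s * indicator ?I s \<partial>lborel) = (\<integral>\<^sup>+s. K s \<partial>density lborel (indicator ?I))"
      by (subst nn_integral_density) (auto simp: mult.commute)
    also have "\<dots> = (\<integral>\<^sup>+r. K (p r) \<partial>density lborel (\<lambda>r. ennreal (q r)))"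
      unfolding dd[symmetric] by (subst nn_integral_distr) auto
    also have "\<dots> = (\<integral>\<^sup>+r. ennreal (q r) * K (p r) \<partial>lborel)"
      by (subst nn_integral_density) auto
    finally show ?thesis .
  qed
  have ui: "integrable lborel u"
  proof (rule integrableI_bounded)
    have "(\<integral>\<^sup>+s. ennreal (norm (u s)) \<partial>lborel) = (\<integral>\<^sup>+s. ennreal (norm (v s)) * indicator ?I s \<partial>lborel)"
      by (intro nn_integral_cong) (auto simp: u_def split: split_indicator)
    also have "\<dots> = (\<integral>\<^sup>+r. ennreal (norm (G r)) \<partial>lborel)"
      by (subst N, measurable) (auto simp: vp[symmetric] q0 ennreal_mult)
    also have "\<dots> < \<infinity>" using Gi by (simp add: integrable_iff_bounded)
    finally show "(\<integral>\<^sup>+s. ennreal (norm (u s)) \<partial>lborel) < \<infinity>" .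
  qed measurable
  have nu: "norm_sq u = (\<integral>\<^sup>+r. ennreal ((norm (G r))\<^sup>2 / \<phi>' r) \<partial>lborel)"
  proof -
    have "norm_sq u = (\<integral>\<^sup>+s. ennreal ((norm (v s))\<^sup>2) * indicator ?I s \<partial>lborel)"
      unfolding norm_sq_def by (intro nn_integral_cong) (auto simp: u_def split: split_indicator)
    also have "\<dots> = (\<integral>\<^sup>+r. ennreal (q r) * ennreal ((norm (v (p r)))\<^sup>2) \<partial>lborel)" by (subst N) auto
    also have "\<dots> = (\<integral>\<^sup>+r. ennreal ((norm (G r))\<^sup>2 / \<phi>' r) \<partial>lborel)"
    proof (rule nn_integral_cong)
      fix r
      show "ennreal (q r) * ennreal ((norm (v (p r)))\<^sup>2) = ennreal ((norm (G r))\<^sup>2 / \<phi>' r)"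
      proof (cases "r \<in> {a..b}")
        case True
        then have "\<phi>' r > 0" "q r = \<phi>' r" using pos ab by (auto simp: q_def)
        then show ?thesis unfolding vp[of r, symmetric]
          by (simp add: ennreal_mult[symmetric] power_mult_distrib power2_eq_square)
      next
        case False
        then show ?thesis using G0[of r] by (auto simp: q_def)
      qed
    qed
    finally show ?thesis .
  qed
  \<comment> \<open>The continuous positive function \<open>\<phi>'\<close> attains a positive
    minimum on the compact interval, so the weight 1 / \<phi>' is bounded there and \<open>u\<close>
    is square integrable along with \<open>G\<close>.\<close>
  have "compact (\<phi>' ` {a..b})" using c' by (intro compact_continuous_image) auto
  moreover have "\<phi>' ` {a..b} \<noteq> {}" using ab by auto
  ultimately obtain r0 where r0: "r0 \<in> {a..b}" "\<And>r. r \<in> {a..b} \<Longrightarrow> \<phi>' r0 \<le> \<phi>' r"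
    using compact_attains_inf[of "\<phi>' ` {a..b}"] by auto
  have m: "\<phi>' r0 > 0" using r0 pos ab by auto
  have "norm_sq u \<le> (\<integral>\<^sup>+r. ennreal (1 / \<phi>' r0) * ennreal ((norm (G r))\<^sup>2) \<partial>lborel)"
    unfolding nu
  proof (rule nn_integral_mono)
    fix r
    show "ennreal ((norm (G r))\<^sup>2 / \<phi>' r) \<le> ennreal (1 / \<phi>' r0) * ennreal ((norm (G r))\<^sup>2)"
    proof (cases "r \<in> {a..b}")
      case True
      then have "(norm (G r))\<^sup>2 / \<phi>' r \<le> (norm (G r))\<^sup>2 / \<phi>' r0" using m r0(2)[of r] by (intro divide_left_mono) auto
      then show ?thesis using m by (simp add: ennreal_mult[symmetric] ennreal_leI)
    next
      case False
      then show ?thesis using G0[of r] by auto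
    qed
  qed
  also have "\<dots> = ennreal (1 / \<phi>' r0) * norm_sq G"
    unfolding norm_sq_def by (rule nn_integral_cmult) measurable
  also have "\<dots> < \<infinity>" using Gf by (simp add: ennreal_mult_less_top)
  finally have fu: "norm_sq u < \<infinity>" .
  have "ft u t = (LINT r|lborel. cis (- (\<phi> r * t)) * G r)" for t
  proof -
    have "ft u t = (LINT s|lborel. cis (- (s * t)) * u s)" unfolding ft_def by (simp add: mult.commute)
    also have "\<dots> = (LINT r|lborel. cis (- (p r * t)) * G r)" by (rule L) measurable
    also have "\<dots> = (LINT r|lborel. cis (- (\<phi> r * t)) * G r)"
    proof (rule Bochner_Integration.integral_cong[OF refl])
      show "cis (- (p r * t)) * G r = cis (- (\<phi> r * t)) * G r" for r
        using G0[of r] by (auto simp: p_def)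
    qed
    finally show ?thesis .
  qed
  then show ?thesis using ui nu fu by (intro that[of u]) (auto simp: u_def)
qed

section \<open>Time integrals of scalar evolutions\<close>

text \<open>Continuity of \<open>\<psi>\<close> is given at positive arguments, and the norm leaves
  these only at the origin, a single point.\<close>

lemma continuous_norm_measurable:
  fixes \<psi> :: "real \<Rightarrow> real"
  assumes "continuous_on {0<..} \<psi>"
  shows "(\<lambda>x::'a::euclidean_space. \<psi> (norm x)) \<in> borel_measurable borel"
proof -
  have "(\<lambda>x::'a. if x \<in> {0} then \<psi> 0 else \<psi> (norm x)) \<in> borel_measurable borel"
  proof (rule borel_measurable_continuous_on_if)
    show "continuous_on (- {0}) (\<lambda>x::'a. \<psi> (norm x))"
      by (rule continuous_on_compose2[OF assms]) (auto intro!: continuous_intros)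
  qed auto
  also have "(\<lambda>x::'a. if x \<in> {0} then \<psi> 0 else \<psi> (norm x)) = (\<lambda>x. \<psi> (norm x))" by auto
  finally show ?thesis .
qed

lemma dispersion_continuous: "dispersion \<phi> \<phi>' \<Longrightarrow> continuous_on {0<..} \<phi>"
  unfolding dispersion_def by (auto intro!: continuous_at_imp_continuous_on DERIV_isCont)

lemma bounded_symbol:
  fixes \<psi> :: "real \<Rightarrow> real"
  assumes "continuous_on {0<..} \<psi>" "0 < a"
  shows "\<exists>B. \<forall>r. \<bar>if r \<in> {a..b} then \<psi> r else (0::real)\<bar> \<le> B"
proof -
  have "compact (\<psi> ` {a..b})"
    by (rule compact_continuous_image[OF continuous_on_subset[OF assms(1)]]) (use assms(2) in auto)
  then obtain B where "\<And>r. r \<in> {a..b} \<Longrightarrow> \<bar>\<psi> r\<bar> \<le> B"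
    using compact_imp_bounded by (fastforce simp: bounded_iff)
  then have "\<bar>if r \<in> {a..b} then \<psi> r else 0\<bar> \<le> max B 0" for r
    by (cases "r \<in> {a..b}") (auto simp: le_max_iff_disj)
  then show ?thesis by blast
qed

text \<open>The evolution without the factor (2 pi)^-d of the inverse transform; its square is put
  back in \<open>spacetime_integral_eq_energy\<close>.\<close>

definition evol :: "(real \<Rightarrow> real) \<Rightarrow> (real \<Rightarrow> real) \<Rightarrow> ('a::euclidean_space \<Rightarrow> complex) \<Rightarrow> real \<Rightarrow> 'a \<Rightarrow> complex" where
  "evol \<psi> \<phi> h t x =
     (LINT \<xi>|lborel. of_real (\<psi> (norm \<xi>)) * cis (- (t * \<phi> (norm \<xi>))) * h \<xi> * cis (x \<bullet> \<xi>))"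

abbreviation time_sq :: "(real \<Rightarrow> 'a \<Rightarrow> complex) \<Rightarrow> 'a \<Rightarrow> ennreal" where
  "time_sq u x \<equiv> \<integral>\<^sup>+t. ennreal ((norm (u t x))\<^sup>2) \<partial>lborel"

lemma evol_measurable:
  fixes h :: "'a::euclidean_space \<Rightarrow> complex"
  assumes "continuous_on {0<..} \<psi>" "continuous_on {0<..} \<phi>" and [measurable]: "h \<in> borel_measurable borel"
  shows "(\<lambda>(t, x). evol \<psi> \<phi> h t x) \<in> borel_measurable (lborel \<Otimes>\<^sub>M lborel)"
proof -
  note [measurable] = continuous_norm_measurable[OF assms(1), where 'a = 'a]
    continuous_norm_measurable[OF assms(2), where 'a = 'a]
  show ?thesis unfolding evol_def by measurable
qed

lemma annular_symbol_integrable: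
  fixes h :: "'a::euclidean_space \<Rightarrow> complex"
  assumes h: "annular h a b" and \<psi>: "continuous_on {0<..} \<psi>" and "continuous_on {0<..} \<phi>"
  shows "integrable lborel (\<lambda>\<xi>. of_real (\<psi> (norm \<xi>)) * cis (- (t * \<phi> (norm \<xi>))) * h \<xi> * cis (x \<bullet> \<xi>))"
proof -
  note [measurable] = continuous_norm_measurable[OF assms(2), where 'a = 'a]
    continuous_norm_measurable[OF assms(3), where 'a = 'a]
  from h have [measurable]: "h \<in> borel_measurable borel" by (simp add: annular_def)
  obtain B where B: "\<And>r. \<bar>if r \<in> {a..b} then \<psi> r else 0\<bar> \<le> B"
    using bounded_symbol[OF \<psi>, of a b] h unfolding annular_def by auto
  have hi: "integrable lborel h"
    using h unfolding annular_def by (intro L2_bounded_support_integrable[of h b]) auto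
  show ?thesis
  proof (rule Bochner_Integration.integrable_bound)
    show "integrable lborel (\<lambda>\<xi>. B * norm (h \<xi>))" using hi by simp
    show "AE \<xi> in lborel. norm (of_real (\<psi> (norm \<xi>)) * cis (- (t * \<phi> (norm \<xi>))) * h \<xi> * cis (x \<bullet> \<xi>)) \<le> norm (B * norm (h \<xi>))"
    proof (rule AE_I2)
      fix \<xi>
      show "norm (of_real (\<psi> (norm \<xi>)) * cis (- (t * \<phi> (norm \<xi>))) * h \<xi> * cis (x \<bullet> \<xi>)) \<le> norm (B * norm (h \<xi>))"
      proof (cases "norm \<xi> \<in> {a..b}")
        case True
        then have "\<bar>\<psi> (norm \<xi>)\<bar> \<le> \<bar>B\<bar>" using B[of "norm \<xi>"] by auto
        then show ?thesis by (simp add: norm_mult abs_mult mult_right_mono)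
      next
        case False
        then have "h \<xi> = 0" using h unfolding annular_def by auto
        then show ?thesis by simp
      qed
    qed
  qed measurable
qed

lemma evol_add:
  assumes "annular h1 a b" "annular h2 a b" "continuous_on {0<..} \<psi>" "continuous_on {0<..} \<phi>"
  shows "evol \<psi> \<phi> (\<lambda>\<xi>. h1 \<xi> + h2 \<xi>) t x = evol \<psi> \<phi> h1 t x + evol \<psi> \<phi> h2 t x"
  unfolding evol_def
  by (subst Bochner_Integration.integral_add[symmetric])
     (use annular_symbol_integrable[OF assms(1,3,4)] annular_symbol_integrable[OF assms(2,3,4)] in \<open>auto simp: algebra_simps\<close>)

lemma evol_cmult: "evol \<psi> \<phi> (\<lambda>\<xi>. c * h \<xi>) t x = c * evol \<psi> \<phi> h t x"
  unfolding evol_def by (subst integral_mult_right_zero[symmetric]) (simp add: mult_ac)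

text \<open>With the phase e^{i x.\<xi>} absorbed into the datum, everything else in the integrand
  depends on |\<xi>| only. Hence at fixed \<open>x\<close> the evolution is, as a function of time,
  the one-dimensional transform of some \<open>u\<close>, supported in frequencies at least
  \<open>\<phi> a\<close>.\<close>

lemma evol_frequency:
  assumes G: "radial_density (\<lambda>\<xi>. h \<xi> * cis (x \<bullet> \<xi>)) G a b" and h: "annular h a b"
    and \<psi>: "continuous_on {0<..} \<psi>" and \<phi>: "dispersion \<phi> \<phi>'"
  obtains u where "u \<in> borel_measurable borel" "integrable lborel u" "norm_sq u < \<infinity>"
    "norm_sq u = (\<integral>\<^sup>+r. ennreal ((\<psi> r)\<^sup>2 * (norm (G r))\<^sup>2 / \<phi>' r) \<partial>lborel)"
    "\<forall>s. s < \<phi> a \<longrightarrow> u s = 0" "\<forall>t. evol \<psi> \<phi> h t x = ft u t"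
proof -
  have ab: "0 < a" "a \<le> b" and h0: "\<And>\<xi>. norm \<xi> < a \<or> norm \<xi> > b \<Longrightarrow> h \<xi> = 0"
    using h by (auto simp: annular_def)
  have G': "G \<in> borel_measurable borel" "integrable lborel G" "norm_sq G < \<infinity>"
    "\<And>r. r < a \<or> b < r \<Longrightarrow> G r = 0" and
    Gk: "\<And>k B. k \<in> borel_measurable borel \<Longrightarrow> \<forall>r. norm (k r) \<le> B \<Longrightarrow>
        (LINT \<xi>|lborel. k (norm \<xi>) * (h \<xi> * cis (x \<bullet> \<xi>))) = (LINT r|lborel. k r * G r)"
    using G unfolding radial_density_def by auto
  note [measurable] = G'(1)
  \<comment> \<open>\<open>radial_density\<close> can be tested only with bounded Borel functions on
    the whole line, so both symbols are cut off to the interval of radii.\<close>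
  define p where "p r = (if r \<in> {a..b} then \<psi> r else 0)" for r
  define q where "q r = (if r \<in> {a..b} then \<phi> r else 0)" for r
  have [measurable]: "p \<in> borel_measurable borel" "q \<in> borel_measurable borel"
    unfolding p_def[abs_def] q_def[abs_def]
    by (intro borel_measurable_continuous_on_if continuous_on_subset[OF \<psi>] continuous_on_subset[OF dispersion_continuous[OF \<phi>]];
        use ab in auto)+
  obtain B where B: "\<And>r. \<bar>p r\<bar> \<le> B"
    using bounded_symbol[OF \<psi> ab(1), of b] unfolding p_def by blast
  have B0: "0 \<le> B" using B[of 0] by linarith
  define H where "H r = of_real (p r) * G r" for r
  have Hm[measurable]: "H \<in> borel_measurable borel" unfolding H_def[abs_def] by measurable
  have Hi: "integrable lborel H" unfolding H_def[abs_def]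
    using B G' by (intro integrable_bounded_mult[where B = B]) auto
  have "norm_sq H \<le> (\<integral>\<^sup>+r. ennreal (B\<^sup>2) * ennreal ((norm (G r))\<^sup>2) \<partial>lborel)"
    unfolding norm_sq_def H_def
    by (intro nn_integral_mono)
       (auto simp: ennreal_mult[symmetric] norm_mult power_mult_distrib intro!: ennreal_leI mult_right_mono
          power2_le_iff_abs_le[THEN iffD2] order_trans[OF B] abs_ge_self B0)
  also have "\<dots> = ennreal (B\<^sup>2) * norm_sq G" unfolding norm_sq_def by (rule nn_integral_cmult) measurable
  also have "\<dots> < \<infinity>" using G' by (simp add: ennreal_mult_less_top)
  finally have Hf: "norm_sq H < \<infinity>" .
  have H0: "H r = 0" if "r < a \<or> b < r" for r using G'(4)[OF that] by (simp add: H_def)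
  obtain u where u: "u \<in> borel_measurable borel" "integrable lborel u" "norm_sq u < \<infinity>"
    "norm_sq u = (\<integral>\<^sup>+r. ennreal ((norm (H r))\<^sup>2 / \<phi>' r) \<partial>lborel)"
    "\<forall>s. s < \<phi> a \<or> \<phi> b < s \<longrightarrow> u s = 0" "\<forall>t. ft u t = (LINT r|lborel. cis (- (\<phi> r * t)) * H r)"
    using dispersion_substitution[OF \<phi> ab Hm Hi Hf H0] .
  have "evol \<psi> \<phi> h t x = ft u t" for t
  proof -
    let ?k = "\<lambda>r. of_real (p r) * cis (- (t * q r))"
    have "evol \<psi> \<phi> h t x = (LINT \<xi>|lborel. ?k (norm \<xi>) * (h \<xi> * cis (x \<bullet> \<xi>)))"
      unfolding evol_def
    proof (rule Bochner_Integration.integral_cong[OF refl])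
      fix \<xi>
      show "of_real (\<psi> (norm \<xi>)) * cis (- (t * \<phi> (norm \<xi>))) * h \<xi> * cis (x \<bullet> \<xi>) = ?k (norm \<xi>) * (h \<xi> * cis (x \<bullet> \<xi>))"
        using h0[of \<xi>] by (cases "norm \<xi> \<in> {a..b}") (auto simp: p_def q_def)
    qed
    also have "\<dots> = (LINT r|lborel. ?k r * G r)"
      by (rule Gk[where B = B]) (use B in \<open>auto simp: norm_mult\<close>)
    also have "\<dots> = ft u t" unfolding u(6)[rule_format]
    proof (rule Bochner_Integration.integral_cong[OF refl])
      fix r
      show "?k r * G r = cis (- (\<phi> r * t)) * H r"
        using G'(4)[of r] by (cases "r \<in> {a..b}") (auto simp: H_def q_def mult_ac)
    qed
    finally show ?thesis .
  qed
  moreover have "norm_sq u = (\<integral>\<^sup>+r. ennreal ((\<psi> r)\<^sup>2 * (norm (G r))\<^sup>2 / \<phi>' r) \<partial>lborel)"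
    unfolding u(4)
  proof (rule nn_integral_cong)
    fix r
    show "ennreal ((norm (H r))\<^sup>2 / \<phi>' r) = ennreal ((\<psi> r)\<^sup>2 * (norm (G r))\<^sup>2 / \<phi>' r)"
      using G'(4)[of r] by (cases "r \<in> {a..b}") (auto simp: H_def p_def norm_mult power_mult_distrib)
  qed
  ultimately show ?thesis using u by (intro that[of u]) auto
qed

lemma annular_modulated: "annular h a b \<Longrightarrow> annular (\<lambda>\<xi>. h \<xi> * cis (x \<bullet> \<xi>)) a b"
  unfolding annular_def by (auto simp: norm_sq_def norm_mult)

lemma annular_radial_density:
  assumes "annular h a b"
  shows "\<exists>G. radial_density (\<lambda>\<xi>. h \<xi> * cis (x \<bullet> \<xi>)) G a b"
  using annular_modulated[OF assms, of x] by (intro radial_density_exists) (auto simp: annular_def)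

text \<open>One density \<open>G\<close>, depending on \<open>h\<close> and \<open>x\<close> but on
  no symbol, serves both evolutions. Plancherel in time contributes the same factor 2 pi on both
  sides.\<close>

lemma evol_time_compare:
  assumes h: "annular h a b"
    and "continuous_on {0<..} \<psi>1" "dispersion \<phi>1 \<phi>1'" "continuous_on {0<..} \<psi>2" "dispersion \<phi>2 \<phi>2'"
    and c: "0 \<le> c" and eq: "\<And>r. 0 < r \<Longrightarrow> (\<psi>1 r)\<^sup>2 / \<phi>1' r = c * ((\<psi>2 r)\<^sup>2 / \<phi>2' r)"
  shows "time_sq (evol \<psi>1 \<phi>1 h) x =
    ennreal c * time_sq (evol \<psi>2 \<phi>2 h) x"
proof -
  obtain G where G: "radial_density (\<lambda>\<xi>. h \<xi> * cis (x \<bullet> \<xi>)) G a b"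
    using annular_radial_density[OF h] by blast
  obtain u1 where u1: "u1 \<in> borel_measurable borel" "integrable lborel u1" "norm_sq u1 < \<infinity>"
    "norm_sq u1 = (\<integral>\<^sup>+r. ennreal ((\<psi>1 r)\<^sup>2 * (norm (G r))\<^sup>2 / \<phi>1' r) \<partial>lborel)"
    "\<forall>s. s < \<phi>1 a \<longrightarrow> u1 s = 0" "\<forall>t. evol \<psi>1 \<phi>1 h t x = ft u1 t"
    using evol_frequency[OF G h assms(2,3)] .
  obtain u2 where u2: "u2 \<in> borel_measurable borel" "integrable lborel u2" "norm_sq u2 < \<infinity>"
    "norm_sq u2 = (\<integral>\<^sup>+r. ennreal ((\<psi>2 r)\<^sup>2 * (norm (G r))\<^sup>2 / \<phi>2' r) \<partial>lborel)"
    "\<forall>s. s < \<phi>2 a \<longrightarrow> u2 s = 0" "\<forall>t. evol \<psi>2 \<phi>2 h t x = ft u2 t"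
    using evol_frequency[OF G h assms(4,5)] .
  have G0: "G r = 0" if "r \<le> 0" for r
    using G h that unfolding radial_density_def annular_def by auto
  have "norm_sq u1 = (\<integral>\<^sup>+r. ennreal c * ennreal ((\<psi>2 r)\<^sup>2 * (norm (G r))\<^sup>2 / \<phi>2' r) \<partial>lborel)"
    unfolding u1(4)
  proof (rule nn_integral_cong)
    fix r
    show "ennreal ((\<psi>1 r)\<^sup>2 * (norm (G r))\<^sup>2 / \<phi>1' r) = ennreal c * ennreal ((\<psi>2 r)\<^sup>2 * (norm (G r))\<^sup>2 / \<phi>2' r)"
    proof (cases "0 < r")
      case True
      have "(\<psi>1 r)\<^sup>2 * (norm (G r))\<^sup>2 / \<phi>1' r = (\<psi>1 r)\<^sup>2 / \<phi>1' r * (norm (G r))\<^sup>2" by simp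
      also have "\<dots> = c * ((\<psi>2 r)\<^sup>2 * (norm (G r))\<^sup>2 / \<phi>2' r)" unfolding eq[OF True] by simp
      finally show ?thesis by (simp only: ennreal_mult'[OF c])
    qed (use G0 in auto)
  qed
  also have "\<dots> = ennreal c * norm_sq u2"
  proof -
    have [measurable]: "G \<in> borel_measurable borel" using G by (simp add: radial_density_def)
    have "continuous_on {0<..} \<phi>2'" using assms(5) by (simp add: dispersion_def)
    then have [measurable]: "(\<lambda>r. if r \<in> {0<..} then \<phi>2' r else 1) \<in> borel_measurable borel"
      by (intro borel_measurable_continuous_on_if) auto
    have [measurable]: "(\<lambda>r. if r \<in> {0<..} then \<psi>2 r else 0) \<in> borel_measurable borel"
      using assms(4) by (intro borel_measurable_continuous_on_if) auto
    have e: "ennreal ((\<psi>2 r)\<^sup>2 * (norm (G r))\<^sup>2 / \<phi>2' r) =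
      ennreal ((if r \<in> {0<..} then \<psi>2 r else 0)\<^sup>2 * (norm (G r))\<^sup>2 / (if r \<in> {0<..} then \<phi>2' r else 1))" for r
      using G0[of r] by auto
    show ?thesis unfolding u2(4) e by (rule nn_integral_cmult) measurable
  qed
  finally have n: "norm_sq u1 = ennreal c * norm_sq u2" .
  have "time_sq (evol \<psi>1 \<phi>1 h) x = norm_sq (ft u1)"
    unfolding norm_sq_def u1(6)[rule_format] ..
  also have "\<dots> = ennreal c * norm_sq (ft u2)"
    unfolding plancherel[OF u1(1-3)] plancherel[OF u2(1-3)] n by (simp add: mult_ac)
  also have "norm_sq (ft u2) = time_sq (evol \<psi>2 \<phi>2 h) x"
    unfolding norm_sq_def u2(6)[rule_format] ..
  finally show ?thesis .
qed

text \<open>The reversed time in the second summand is the factor e^{it\<phi>} of the negative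
  spectral part; it reflects the frequency density of that summand.\<close>

lemma evol_time_orthogonal:
  assumes h1: "annular h1 a b" and h2: "annular h2 a b"
    and \<psi>: "continuous_on {0<..} \<psi>" and \<phi>: "dispersion \<phi> \<phi>'" and \<phi>pos: "\<And>r. 0 < r \<Longrightarrow> 0 < \<phi> r"
  shows "(\<integral>\<^sup>+t. ennreal ((norm (evol \<psi> \<phi> h1 t x + evol \<psi> \<phi> h2 (- t) x))\<^sup>2) \<partial>lborel) =
    time_sq (evol \<psi> \<phi> h1) x + time_sq (evol \<psi> \<phi> h2) x"
proof -
  obtain G1 where G1: "radial_density (\<lambda>\<xi>. h1 \<xi> * cis (x \<bullet> \<xi>)) G1 a b"
    using annular_radial_density[OF h1] by blast
  obtain G2 where G2: "radial_density (\<lambda>\<xi>. h2 \<xi> * cis (x \<bullet> \<xi>)) G2 a b"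
    using annular_radial_density[OF h2] by blast
  obtain u1 where u1: "u1 \<in> borel_measurable borel" "integrable lborel u1" "norm_sq u1 < \<infinity>"
    "norm_sq u1 = (\<integral>\<^sup>+r. ennreal ((\<psi> r)\<^sup>2 * (norm (G1 r))\<^sup>2 / \<phi>' r) \<partial>lborel)"
    "\<forall>s. s < \<phi> a \<longrightarrow> u1 s = 0" "\<forall>t. evol \<psi> \<phi> h1 t x = ft u1 t"
    using evol_frequency[OF G1 h1 \<psi> \<phi>] .
  obtain u2 where u2: "u2 \<in> borel_measurable borel" "integrable lborel u2" "norm_sq u2 < \<infinity>"
    "norm_sq u2 = (\<integral>\<^sup>+r. ennreal ((\<psi> r)\<^sup>2 * (norm (G2 r))\<^sup>2 / \<phi>' r) \<partial>lborel)"
    "\<forall>s. s < \<phi> a \<longrightarrow> u2 s = 0" "\<forall>t. evol \<psi> \<phi> h2 t x = ft u2 t"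
    using evol_frequency[OF G2 h2 \<psi> \<phi>] .
  \<comment> \<open>Positivity of \<open>\<phi>\<close> separates the supports: \<open>u1 s\<close>
    can be nonzero only for s \<ge> \<phi> a > 0, and \<open>u2 (- s)\<close> only for s \<le> -
    \<phi> a < 0. The squares of the moduli then add pointwise.\<close>
  have "0 < \<phi> a" using \<phi>pos h1 by (simp add: annular_def)
  then have z: "u1 s = 0 \<or> u2 (- s) = 0" for s using u1(5) u2(5) by (cases "s < \<phi> a") auto
  note [measurable] = u1(1) u2(1)
  have i2: "integrable lborel (\<lambda>s. u2 (- s))"
  proof -
    have "integrable (distr lborel borel uminus) u2" unfolding lborel_distr_neg by (rule u2(2))
    then show ?thesis by (subst (asm) integrable_distr_eq) auto
  qed
  let ?u = "\<lambda>s. u1 s + u2 (- s)"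
  have nu: "norm_sq ?u = norm_sq u1 + norm_sq u2"
  proof -
    have "norm_sq ?u = (\<integral>\<^sup>+s. ennreal ((norm (u1 s))\<^sup>2) + ennreal ((norm (u2 (- s)))\<^sup>2) \<partial>lborel)"
      unfolding norm_sq_def
    proof (rule nn_integral_cong)
      fix s
      show "ennreal ((norm (?u s))\<^sup>2) = ennreal ((norm (u1 s))\<^sup>2) + ennreal ((norm (u2 (- s)))\<^sup>2)"
        using z[of s] by auto
    qed
    also have "\<dots> = norm_sq u1 + norm_sq (\<lambda>s. u2 (- s))"
      unfolding norm_sq_def by (rule nn_integral_add) measurable
    also have "norm_sq (\<lambda>s. u2 (- s)) = norm_sq u2" by (rule norm_sq_reflect) measurable
    finally show ?thesis .
  qed
  have f2: "ft (\<lambda>s. u2 (- s)) t = ft u2 (- t)" for t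
    unfolding ft_def using lborel_integral_reflect[of "\<lambda>s. u2 s * cis (- (s \<bullet> - t))"] by simp
  have fu: "ft ?u t = evol \<psi> \<phi> h1 t x + evol \<psi> \<phi> h2 (- t) x" for t
    unfolding u1(6)[rule_format] u2(6)[rule_format] f2[symmetric] unfolding ft_def
    by (subst Bochner_Integration.integral_add[symmetric])
       (use u1(2) i2 in \<open>auto intro!: integrable_mult_cis simp: algebra_simps\<close>)
  have "(\<integral>\<^sup>+t. ennreal ((norm (evol \<psi> \<phi> h1 t x + evol \<psi> \<phi> h2 (- t) x))\<^sup>2) \<partial>lborel) = norm_sq (ft ?u)"
    unfolding norm_sq_def fu ..
  also have "\<dots> = norm_sq (ft u1) + norm_sq (ft u2)"
    using plancherel[of ?u] nu u1 u2 i2 unfolding plancherel[OF u1(1-3)] plancherel[OF u2(1-3)]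
    by (simp add: distrib_left)
  finally show ?thesis unfolding norm_sq_def u1(6)[rule_format] u2(6)[rule_format] .
qed

section \<open>Measurability of the weight\<close>

text \<open>Polynomials in the coordinates. Their products with the Gaussian form a class closed
  under partial derivatives, which is how the Gaussian is shown to be a Schwartz function.\<close>

inductive coord_poly :: "(real^'n \<Rightarrow> real) \<Rightarrow> bool" where
  const: "coord_poly (\<lambda>_. c)"
| coord: "coord_poly (\<lambda>x. x $ j)"
| add: "coord_poly p \<Longrightarrow> coord_poly q \<Longrightarrow> coord_poly (\<lambda>x. p x + q x)"
| mult: "coord_poly p \<Longrightarrow> coord_poly q \<Longrightarrow> coord_poly (\<lambda>x. p x * q x)"

lemma coord_poly_derivative:
  "coord_poly p \<Longrightarrow> \<exists>D. (\<forall>x. (p has_derivative D x) (at x)) \<and> (\<forall>j. coord_poly (\<lambda>x. D x (axis j 1)))"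
proof (induction rule: coord_poly.induct)
  case (const c)
  show ?case by (intro exI[of _ "\<lambda>x v. 0"]) (auto intro: coord_poly.const)
next
  case (coord i)
  show ?case
    by (intro exI[of _ "\<lambda>x v. v $ i"])
       (auto intro: coord_poly.const bounded_linear_imp_has_derivative bounded_linear_vec_nth)
next
  case (add p q)
  then obtain D E where "\<forall>x. (p has_derivative D x) (at x)" "\<forall>j. coord_poly (\<lambda>x. D x (axis j 1))"
    "\<forall>x. (q has_derivative E x) (at x)" "\<forall>j. coord_poly (\<lambda>x. E x (axis j 1))" by metis
  then show ?case
    by (intro exI[of _ "\<lambda>x v. D x v + E x v"]) (auto intro!: coord_poly.add has_derivative_add)
next
  case (mult p q)
  then obtain D E where "\<forall>x. (p has_derivative D x) (at x)" "\<forall>j. coord_poly (\<lambda>x. D x (axis j 1))"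
    "\<forall>x. (q has_derivative E x) (at x)" "\<forall>j. coord_poly (\<lambda>x. E x (axis j 1))" by metis
  with mult show ?case
    by (intro exI[of _ "\<lambda>x v. p x * E x v + D x v * q x"])
      (auto intro!: coord_poly.add coord_poly.mult has_derivative_mult)
qed

text \<open>An exponential bound replaces one by the degree since it passes through the induction
  easily: for sums and products the rates are simply added.\<close>

lemma coord_poly_bound:
  fixes p :: "real^'n \<Rightarrow> real"
  shows "coord_poly p \<Longrightarrow> \<exists>C N. 0 \<le> N \<and> (\<forall>x. \<bar>p x\<bar> \<le> C * exp (N * norm x))"
proof (induction rule: coord_poly.induct)
  case (const c)
  show ?case by (intro exI[of _ "\<bar>c\<bar>"] exI[of _ 0]) auto
next
  case (coord i)
  have "\<bar>x $ i\<bar> \<le> 1 * exp (1 * norm x)" for x :: "real^'n"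
    using component_le_norm_cart[of x i] exp_ge_add_one_self[of "norm x"] by (simp, linarith)
  then show ?case by (intro exI[of _ 1]) simp
next
  case (add p q)
  then obtain C N D M where 1: "0 \<le> N" "0 \<le> M" "\<And>x. \<bar>p x\<bar> \<le> C * exp (N * norm x)" "\<And>x. \<bar>q x\<bar> \<le> D * exp (M * norm x)" by metis
  have "\<bar>p x + q x\<bar> \<le> (\<bar>C\<bar> + \<bar>D\<bar>) * exp ((N + M) * norm x)" for x
  proof -
    have "\<bar>p x\<bar> \<le> \<bar>C\<bar> * exp ((N + M) * norm x)" "\<bar>q x\<bar> \<le> \<bar>D\<bar> * exp ((N + M) * norm x)"
      using 1(1,2) by (auto intro!: order_trans[OF 1(3)] order_trans[OF 1(4)] mult_mono mult_right_mono)
    then show ?thesis by (simp add: distrib_right)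
  qed
  then show ?case using 1(1,2) by (intro exI[of _ "\<bar>C\<bar> + \<bar>D\<bar>"] exI[of _ "N + M"]) auto
next
  case (mult p q)
  then obtain C N D M where 1: "0 \<le> N" "0 \<le> M" "\<And>x. \<bar>p x\<bar> \<le> C * exp (N * norm x)" "\<And>x. \<bar>q x\<bar> \<le> D * exp (M * norm x)" by metis
  have "\<bar>p x * q x\<bar> \<le> (C * D) * exp ((N + M) * norm x)" for x
  proof -
    have eq: "(C * D) * exp ((N + M) * norm x) = (C * exp (N * norm x)) * (D * exp (M * norm x))"
      unfolding distrib_right exp_add by (simp only: mult_ac)
    show ?thesis
      unfolding eq abs_mult by (rule mult_mono[OF 1(3,4) order_trans[OF abs_ge_zero 1(3)]]) simp
  qed
  then show ?case using 1(1,2) by (intro exI[of _ "C * D"] exI[of _ "N + M"]) auto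
qed

lemma coord_poly_gauss_bounded:
  fixes p :: "real^'n \<Rightarrow> real"
  assumes "coord_poly p"
  shows "bounded (range (\<lambda>x. norm x ^ k *\<^sub>R complex_of_real (p x * gauss x)))"
proof -
  obtain C N where C: "\<And>x. \<bar>p x\<bar> \<le> C * exp (N * norm x)" using coord_poly_bound[OF assms] by blast
  \<comment> \<open>With |x|^k \<le> exp (k |x|) the exponent becomes (k + N) r - r^2 / 2 at r =
    |x|, whose maximum over \<open>r\<close> is (k + N)^2 / 2.\<close>
  have "norm (norm x ^ k *\<^sub>R complex_of_real (p x * gauss x)) \<le> \<bar>C\<bar> * exp ((real k + N)\<^sup>2 / 2)" for x
  proof -
    have "norm x ^ k \<le> exp (norm x) ^ k"
      using exp_ge_add_one_self[of "norm x"] by (intro power_mono) (linarith, simp)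
    moreover have "\<bar>p x\<bar> \<le> \<bar>C\<bar> * exp (N * norm x)"
      by (rule order_trans[OF C]) (simp add: mult_right_mono)
    ultimately have "norm x ^ k * \<bar>p x\<bar> * gauss x \<le> exp (norm x) ^ k * (\<bar>C\<bar> * exp (N * norm x)) * gauss x"
      by (intro mult_right_mono mult_mono) auto
    also have "\<dots> = \<bar>C\<bar> * exp ((real k + N) * norm x - (norm x)\<^sup>2 / 2)"
      by (simp add: gauss_def exp_of_nat_mult[symmetric] exp_add[symmetric] algebra_simps)
    also have "(real k + N) * norm x - (norm x)\<^sup>2 / 2 \<le> (real k + N)\<^sup>2 / 2"
      using zero_le_power2[of "norm x - (real k + N)"] by (simp add: power2_eq_square algebra_simps)
    finally show ?thesis by (simp add: norm_mult mult_left_mono mult.assoc)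
  qed
  then show ?thesis unfolding bounded_iff by blast
qed

lemma gauss_has_derivative:
  "((gauss :: real^'n \<Rightarrow> real) has_derivative (\<lambda>v. - (x \<bullet> v) * gauss x)) (at x)"
proof -
  have e: "gauss = (\<lambda>z::real^'n. exp (- (z \<bullet> z) / 2))" unfolding gauss_def[abs_def] power2_norm_eq_inner ..
  show ?thesis unfolding e
    by (rule derivative_eq_intros refl)+ (auto simp: fun_eq_iff inner_commute)
qed

lemma coord_poly_gauss_derivative:
  fixes p :: "real^'n \<Rightarrow> real"
  assumes "coord_poly p"
  shows "(\<lambda>x. complex_of_real (p x * gauss x)) differentiable (at x)"
    and "\<exists>q. coord_poly q \<and> (\<forall>x. frechet_derivative (\<lambda>x. complex_of_real (p x * gauss x)) (at x) (axis j 1)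
       = complex_of_real (q x * gauss x))"
proof -
  obtain D where D: "\<And>x. (p has_derivative D x) (at x)" "\<And>j. coord_poly (\<lambda>x. D x (axis j 1))"
    using coord_poly_derivative[OF assms] by blast
  have d: "((\<lambda>x. complex_of_real (p x * gauss x)) has_derivative
      (\<lambda>v. complex_of_real (p x * (- (x \<bullet> v) * gauss x) + D x v * gauss x))) (at x)" for x
    by (intro has_derivative_of_real has_derivative_mult D gauss_has_derivative)
  show "(\<lambda>x. complex_of_real (p x * gauss x)) differentiable (at x)"
    using d unfolding differentiable_def by blast
  have "coord_poly (\<lambda>x. D x (axis j 1) + p x * ((- 1) * x $ j))"
    by (intro coord_poly.intros assms D)
  moreover have "frechet_derivative (\<lambda>x. complex_of_real (p x * gauss x)) (at x) (axis j 1)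
       = complex_of_real ((D x (axis j 1) + p x * ((- 1) * x $ j)) * gauss x)" for x
    unfolding frechet_derivative_at[OF d, symmetric] by (simp add: inner_axis algebra_simps)
  ultimately show "\<exists>q. coord_poly q \<and> (\<forall>x. frechet_derivative (\<lambda>x. complex_of_real (p x * gauss x)) (at x) (axis j 1)
       = complex_of_real (q x * gauss x))" by blast
qed

lemma partials_gauss:
  "\<exists>q. coord_poly q \<and> partials js (\<lambda>x::real^'n. complex_of_real (gauss x)) = (\<lambda>x. complex_of_real (q x * gauss x))"
proof (induction js)
  case Nil
  show ?case by (intro exI[of _ "\<lambda>_. 1"]) (auto intro: coord_poly.const)
next
  case (Cons j js)
  then obtain q where q: "coord_poly q"
    "partials js (\<lambda>x::real^'n. complex_of_real (gauss x)) = (\<lambda>x. complex_of_real (q x * gauss x))" by blast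
  show ?case using coord_poly_gauss_derivative(2)[OF q(1), of j] unfolding partials.simps q(2) by fast
qed

lemma schwartz_gauss: "schwartz (\<lambda>x::real^'n. complex_of_real (gauss x))"
  unfolding schwartz_def
proof (intro conjI allI)
  fix js x k
  obtain q where q: "coord_poly q"
    "partials js (\<lambda>x::real^'n. complex_of_real (gauss x)) = (\<lambda>x. complex_of_real (q x * gauss x))"
    using partials_gauss by blast
  show "partials js (\<lambda>x::real^'n. complex_of_real (gauss x)) differentiable (at x)"
    unfolding q(2) by (rule coord_poly_gauss_derivative(1)[OF q(1)])
  show "bounded (range (\<lambda>x::real^'n. norm x ^ k *\<^sub>R partials js (\<lambda>x. complex_of_real (gauss x)) x))"
    unfolding q(2) by (rule coord_poly_gauss_bounded[OF q(1)])
qed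

text \<open>The product of the weight with the Gaussian is integrable by assumption, and the
  Gaussian, being positive, can be divided out.\<close>

lemma weight_measurable:
  assumes "weight_assumption TYPE('n::finite) w"
  shows "(\<lambda>x::real^'n. w (norm x)) \<in> borel_measurable lebesgue"
proof -
  have "integrable lebesgue (\<lambda>x::real^'n. complex_of_real (w (norm x)) * complex_of_real (gauss x))"
    using assms schwartz_gauss unfolding weight_assumption_def by blast
  then have [measurable]: "(\<lambda>x::real^'n. complex_of_real (w (norm x)) * complex_of_real (gauss x)) \<in> borel_measurable lebesgue"
    by (rule borel_measurable_integrable)
  have [measurable]: "(gauss :: real^'n \<Rightarrow> real) \<in> borel_measurable lebesgue" by (intro measurable_completion) measurable
  have "(\<lambda>x::real^'n. Re (complex_of_real (w (norm x)) * complex_of_real (gauss x)) / gauss x) \<in> borel_measurable lebesgue"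
    by measurable
  moreover have "Re (complex_of_real (w (norm x)) * complex_of_real (gauss x)) / gauss x = w (norm x)" for x :: "real^'n"
    using gauss_pos[of x] by simp
  ultimately show ?thesis by simp
qed

text \<open>\<open>W\<close> stands for a Borel version of x \<mapsto> w |x|. What is recorded is
  the Tonelli formula it provides, with the time integral innermost, for every nonnegative
  integrand, so that scalar and Dirac evolutions are covered at once.\<close>

definition represents_weight :: "(real \<Rightarrow> real) \<Rightarrow> (real^'n \<Rightarrow> ennreal) \<Rightarrow> bool" where
  "represents_weight w W \<longleftrightarrow> W \<in> borel_measurable borel \<and>
    (\<forall>F :: real \<Rightarrow> real^'n \<Rightarrow> real. (\<lambda>(t, x). F t x) \<in> borel_measurable (lborel \<Otimes>\<^sub>M lborel) \<longrightarrow> (\<forall>t x. 0 \<le> F t x) \<longrightarrow>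
      (\<integral>\<^sup>+t. \<integral>\<^sup>+x. ennreal (F t x * w (norm x)) \<partial>lebesgue \<partial>lebesgue) =
      (\<integral>\<^sup>+x. W x * (\<integral>\<^sup>+t. ennreal (F t x) \<partial>lborel) \<partial>lborel))"

lemma weighted_spacetime_integral:
  fixes w :: "real \<Rightarrow> real"
  assumes "(\<lambda>x::real^'n. w (norm x)) \<in> borel_measurable lebesgue"
  obtains W :: "real^'n \<Rightarrow> ennreal" where "represents_weight w W"
proof -
  obtain v where [measurable]: "v \<in> borel_measurable lborel" and v: "AE x::real^'n in lborel. w (norm x) = v x"
    using completion_ex_borel_measurable_real[OF assms] by auto
  have "\<forall>F :: real \<Rightarrow> real^'n \<Rightarrow> real. (\<lambda>(t, x). F t x) \<in> borel_measurable (lborel \<Otimes>\<^sub>M lborel) \<longrightarrow> (\<forall>t x. 0 \<le> F t x) \<longrightarrow>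
      (\<integral>\<^sup>+t. \<integral>\<^sup>+x. ennreal (F t x * w (norm x)) \<partial>lebesgue \<partial>lebesgue) =
      (\<integral>\<^sup>+x. ennreal (v x) * (\<integral>\<^sup>+t. ennreal (F t x) \<partial>lborel) \<partial>lborel)"
  proof (intro allI impI)
    fix F :: "real \<Rightarrow> real^'n \<Rightarrow> real"
    assume [measurable]: "(\<lambda>(t, x). F t x) \<in> borel_measurable (lborel \<Otimes>\<^sub>M lborel)" and F0: "\<forall>t x. 0 \<le> F t x"
    have "(\<integral>\<^sup>+t. \<integral>\<^sup>+x. ennreal (F t x * w (norm x)) \<partial>lebesgue \<partial>lebesgue) =
       (\<integral>\<^sup>+t. \<integral>\<^sup>+x. ennreal (v x) * ennreal (F t x) \<partial>lborel \<partial>lborel)"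
      unfolding nn_integral_completion
    proof (rule nn_integral_cong, rule nn_integral_cong_AE)
      fix t :: real
      show "AE x in lborel. ennreal (F t x * w (norm x)) = ennreal (v x) * ennreal (F t x)"
        using v by eventually_elim (use F0 in \<open>subst ennreal_mult', auto simp: mult.commute\<close>)
    qed
    also have "\<dots> = (\<integral>\<^sup>+x. \<integral>\<^sup>+t. ennreal (v x) * ennreal (F t x) \<partial>lborel \<partial>lborel)"
      by (rule lborel_pair.Fubini'[symmetric]) measurable
    also have "\<dots> = (\<integral>\<^sup>+x. ennreal (v x) * (\<integral>\<^sup>+t. ennreal (F t x) \<partial>lborel) \<partial>lborel)"
      by (intro nn_integral_cong nn_integral_cmult) measurable
    finally show "(\<integral>\<^sup>+t. \<integral>\<^sup>+x. ennreal (F t x * w (norm x)) \<partial>lebesgue \<partial>lebesgue) =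
      (\<integral>\<^sup>+x. ennreal (v x) * (\<integral>\<^sup>+t. ennreal (F t x) \<partial>lborel) \<partial>lborel)" .
  qed
  then show ?thesis by (intro that[of "\<lambda>x. ennreal (v x)"]) (simp add: represents_weight_def)
qed

section \<open>The Dirac symbol\<close>

lemma scaleR_complex_eq: "c *\<^sub>R z = complex_of_real c * z"
  by (rule scaleR_conv_of_real)

lemma matrix_add_rdistrib: "(A + B) ** C = A ** C + B ** (C :: complex^'N^'M)"
  by (simp add: matrix_matrix_mult_def vec_eq_iff sum.distrib distrib_right)

lemma scaleR_matrix_mult_left: "(c *\<^sub>R A) ** B = c *\<^sub>R (A ** (B :: complex^'N^'M))"
  and scaleR_matrix_mult_right: "A ** (c *\<^sub>R B) = c *\<^sub>R (A ** B)"
  by (simp_all add: matrix_matrix_mult_def vec_eq_iff scaleR_sum_right)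

lemma sum_matrix_mult_left: "(\<Sum>j\<in>J. F j) ** B = (\<Sum>j\<in>J. F j ** (B :: complex^'N^'M))"
  and sum_matrix_mult_right: "A ** (\<Sum>j\<in>J. G j) = (\<Sum>j\<in>J. A ** (G j :: complex^'N^'M))"
  by (induction J rule: infinite_finite_induct)
    (auto simp: matrix_add_rdistrib matrix_add_ldistrib matrix_matrix_mult_def vec_eq_iff sum.distrib distrib_left distrib_right)

lemma mat_eq_scaleR: "mat (of_real c) = c *\<^sub>R (mat 1 :: complex^'N^'N)"
  by (simp add: vec_eq_iff mat_def scaleR_complex_eq)

text \<open>Symmetrizing the double sum for the square of the massless part \<open>X\<close> in
  \<open>j\<close> and \<open>k\<close> produces anticommutators, of which only the diagonal ones
  survive; \<open>X\<close> and \<beta> anticommute, which removes the mixed terms.\<close>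

lemma dirac_symbol_square:
  fixes \<alpha> :: "'n::finite \<Rightarrow> complex^'N^'N"
  assumes "dirac_matrices \<alpha> \<beta>"
  shows "dirac_symbol \<alpha> \<beta> m \<xi> ** dirac_symbol \<alpha> \<beta> m \<xi> = ((norm \<xi>)\<^sup>2 + m\<^sup>2) *\<^sub>R mat 1"
proof -
  define X where "X = (\<Sum>j\<in>UNIV. (\<xi> $ j) *\<^sub>R \<alpha> j)"
  have a: "\<alpha> j ** \<alpha> k + \<alpha> k ** \<alpha> j = (if j = k then mat 2 else 0)"
    and b: "\<alpha> j ** \<beta> + \<beta> ** \<alpha> j = 0" and c: "\<beta> ** \<beta> + \<beta> ** \<beta> = mat 2" for j k
    using assms unfolding dirac_matrices_def by auto
  have m2: "mat 2 = 2 *\<^sub>R (mat 1 :: complex^'N^'N)" using mat_eq_scaleR[of 2] by simp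
  have XX: "X ** X = (\<Sum>j\<in>UNIV. \<Sum>k\<in>UNIV. (\<xi> $ j * \<xi> $ k) *\<^sub>R (\<alpha> j ** \<alpha> k))"
    unfolding X_def sum_matrix_mult_left
    by (simp only: sum_matrix_mult_right scaleR_matrix_mult_left scaleR_matrix_mult_right scaleR_scaleR scaleR_sum_right mult.commute)
  have XX': "X ** X = (\<Sum>j\<in>UNIV. \<Sum>k\<in>UNIV. (\<xi> $ j * \<xi> $ k) *\<^sub>R (\<alpha> k ** \<alpha> j))"
    unfolding XX by (subst sum.swap) (simp only: mult.commute)
  have "X ** X + X ** X = (\<Sum>j\<in>UNIV. \<Sum>k\<in>UNIV. (\<xi> $ j * \<xi> $ k) *\<^sub>R (\<alpha> j ** \<alpha> k + \<alpha> k ** \<alpha> j))"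
    unfolding scaleR_add_right sum.distrib XX[symmetric] XX'[symmetric] ..
  also have "\<dots> = (\<Sum>j\<in>UNIV. (\<xi> $ j * \<xi> $ j) *\<^sub>R mat 2)"
  proof (rule sum.cong[OF refl])
    fix j
    have "(\<xi> $ j * \<xi> $ k) *\<^sub>R (\<alpha> j ** \<alpha> k + \<alpha> k ** \<alpha> j) = (if k = j then (\<xi> $ j * \<xi> $ j) *\<^sub>R mat 2 else 0)" for k
      unfolding a by auto
    then show "(\<Sum>k\<in>UNIV. (\<xi> $ j * \<xi> $ k) *\<^sub>R (\<alpha> j ** \<alpha> k + \<alpha> k ** \<alpha> j)) = (\<xi> $ j * \<xi> $ j) *\<^sub>R mat 2"
      by simp
  qed
  also have "\<dots> = (norm \<xi>)\<^sup>2 *\<^sub>R mat 2"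
    unfolding power2_norm_eq_inner inner_vec_def scaleR_sum_left[symmetric] by simp
  finally have "2 *\<^sub>R (X ** X) = 2 *\<^sub>R ((norm \<xi>)\<^sup>2 *\<^sub>R mat 1)"
    unfolding m2 scaleR_2[symmetric] scaleR_scaleR by (simp only: mult.commute)
  then have X2: "X ** X = (norm \<xi>)\<^sup>2 *\<^sub>R mat 1" by (metis scaleR_cancel_left zero_neq_numeral)
  have "2 *\<^sub>R (\<beta> ** \<beta>) = 2 *\<^sub>R mat 1" using c unfolding m2 scaleR_2[symmetric] .
  then have B2: "\<beta> ** \<beta> = mat 1" by (metis scaleR_cancel_left zero_neq_numeral)
  have "X ** \<beta> + \<beta> ** X = (\<Sum>j\<in>UNIV. (\<xi> $ j) *\<^sub>R (\<alpha> j ** \<beta> + \<beta> ** \<alpha> j))"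
    unfolding X_def sum_matrix_mult_left sum_matrix_mult_right scaleR_matrix_mult_left scaleR_matrix_mult_right
    by (simp add: scaleR_add_right sum.distrib)
  then have XB: "X ** \<beta> + \<beta> ** X = 0" unfolding b by simp
  have "dirac_symbol \<alpha> \<beta> m \<xi> ** dirac_symbol \<alpha> \<beta> m \<xi> = X ** X + m *\<^sub>R (X ** \<beta> + \<beta> ** X) + (m * m) *\<^sub>R (\<beta> ** \<beta>)"
    unfolding dirac_symbol_def X_def[symmetric] matrix_add_rdistrib matrix_add_ldistrib
      scaleR_matrix_mult_left scaleR_matrix_mult_right scaleR_scaleR by (simp add: scaleR_add_right ac_simps)
  then show ?thesis unfolding X2 B2 XB by (simp add: power2_eq_square scaleR_left_distrib)
qed

text \<open>The involution S of the overview. For m = 0 the quotient degenerates at the origin, a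
  null set that the lemmas on it exclude.\<close>

definition dirac_sign ::
  "('n::finite \<Rightarrow> complex^'N^'N) \<Rightarrow> complex^'N^'N \<Rightarrow> real \<Rightarrow> real^'n \<Rightarrow> complex^'N^'N" where
  "dirac_sign \<alpha> \<beta> m \<xi> = (1 / rel_dispersion m (norm \<xi>)) *\<^sub>R dirac_symbol \<alpha> \<beta> m \<xi>"

lemma rel_dispersion_pos: "0 < r \<Longrightarrow> 0 < rel_dispersion m r"
  unfolding rel_dispersion_def by (simp add: add_pos_nonneg)

lemma rel_dispersion_square: "(rel_dispersion m r)\<^sup>2 = r\<^sup>2 + m\<^sup>2"
  unfolding rel_dispersion_def by simp

lemma dirac_sign_square:
  assumes "dirac_matrices \<alpha> \<beta>" "\<xi> \<noteq> 0"
  shows "dirac_sign \<alpha> \<beta> m \<xi> ** dirac_sign \<alpha> \<beta> m \<xi> = mat 1"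
proof -
  have "rel_dispersion m (norm \<xi>) > 0" using assms by (intro rel_dispersion_pos) auto
  then show ?thesis
    unfolding dirac_sign_def scaleR_matrix_mult_left scaleR_matrix_mult_right dirac_symbol_square[OF assms(1)]
      rel_dispersion_square[symmetric] by (simp add: power2_eq_square)
qed

lemma dirac_sign_hermitian:
  assumes "dirac_matrices \<alpha> \<beta>"
  shows "dirac_sign \<alpha> \<beta> m \<xi> $ i $ j = cnj (dirac_sign \<alpha> \<beta> m \<xi> $ j $ i)"
proof -
  have "\<alpha> k $ i $ j = cnj (\<alpha> k $ j $ i)" "\<beta> $ i $ j = cnj (\<beta> $ j $ i)" for k
    using assms unfolding dirac_matrices_def hermitian_def by blast+
  then show ?thesis
    by (simp add: dirac_sign_def dirac_symbol_def cnj_sum)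
qed

text \<open>The powers of \<open>B\<close> repeat with period four like those of the imaginary unit,
  so the exponential series splits into the cosine series at the identity and the sine series at
  \<open>B\<close>. \<open>cos_coeff\<close> and \<open>sin_coeff\<close> encode this pattern
  together with the factorials.\<close>

lemma matrix_exp_rotation:
  fixes B :: "complex^'N^'N"
  assumes B: "B ** B = - mat 1"
  shows "matrix_exp (\<theta> *\<^sub>R B) = cos \<theta> *\<^sub>R mat 1 + sin \<theta> *\<^sub>R B"
proof -
  have pow: "(((**) (\<theta> *\<^sub>R B)) ^^ n) (mat 1) =
    (fact n * cos_coeff n * \<theta> ^ n) *\<^sub>R mat 1 + (fact n * sin_coeff n * \<theta> ^ n) *\<^sub>R B" for n
  proof (induction n)
    case 0
    show ?case by simp
  next
    case (Suc n)
    have "(((**) (\<theta> *\<^sub>R B)) ^^ Suc n) (mat 1) =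
      \<theta> *\<^sub>R ((fact n * cos_coeff n * \<theta> ^ n) *\<^sub>R B + (fact n * sin_coeff n * \<theta> ^ n) *\<^sub>R (- mat 1))"
      unfolding funpow.simps comp_def Suc matrix_add_ldistrib scaleR_matrix_mult_left scaleR_matrix_mult_right B
      by (simp add: scaleR_add_right mult.commute)
    also have "\<dots> = (fact (Suc n) * cos_coeff (Suc n) * \<theta> ^ Suc n) *\<^sub>R mat 1 +
        (fact (Suc n) * sin_coeff (Suc n) * \<theta> ^ Suc n) *\<^sub>R B"
      by (simp add: cos_coeff_Suc sin_coeff_Suc scaleR_add_right scaleR_diff_right mult_ac del: of_nat_Suc)
    finally show ?case .
  qed
  have "(\<lambda>n. (cos_coeff n *\<^sub>R \<theta> ^ n) *\<^sub>R (mat 1 :: complex^'N^'N) + (sin_coeff n *\<^sub>R \<theta> ^ n) *\<^sub>R B) sums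
     (cos \<theta> *\<^sub>R mat 1 + sin \<theta> *\<^sub>R B)"
    by (intro sums_add bounded_linear.sums[OF bounded_linear_scaleR_left] cos_converges sin_converges)
  moreover have "(1 / fact n) *\<^sub>R (((**) (\<theta> *\<^sub>R B)) ^^ n) (mat 1) =
     (cos_coeff n *\<^sub>R \<theta> ^ n) *\<^sub>R (mat 1 :: complex^'N^'N) + (sin_coeff n *\<^sub>R \<theta> ^ n) *\<^sub>R B" for n
    unfolding pow by (simp add: scaleR_add_right)
  ultimately show ?thesis unfolding matrix_exp_def by (simp add: sums_unique[symmetric])
qed

lemma dirac_exp:
  fixes \<alpha> :: "'n::finite \<Rightarrow> complex^'N^'N"
  assumes d: "dirac_matrices \<alpha> \<beta>" and \<xi>: "\<xi> \<noteq> 0"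
  shows "(matrix_exp (mat (- \<i> * of_real t) ** dirac_symbol \<alpha> \<beta> m \<xi>) *v v) $ i =
    cis (- (t * rel_dispersion m (norm \<xi>))) * ((v $ i + (dirac_sign \<alpha> \<beta> m \<xi> *v v) $ i) / 2) +
    cis (t * rel_dispersion m (norm \<xi>)) * ((v $ i - (dirac_sign \<alpha> \<beta> m \<xi> *v v) $ i) / 2)"
proof -
  let ?S = "dirac_sign \<alpha> \<beta> m \<xi>" and ?p = "rel_dispersion m (norm \<xi>)"
  have p: "?p > 0" using \<xi> by (intro rel_dispersion_pos) auto
  \<comment> \<open>With B = -i S the exponent is t times the dispersion times \<open>B\<close>, and
    the square of \<open>B\<close> is minus the identity because S is an involution. The resulting
    cos - i sin S then regroups into the two exponentials.\<close>
  define B where "B = (\<chi> i j. - \<i> * ?S $ i $ j)"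
  have "(B ** B) $ i $ j = (- mat 1) $ i $ j" for i j
  proof -
    have "(B ** B) $ i $ j = (\<Sum>k\<in>UNIV. - (?S $ i $ k * ?S $ k $ j))"
      unfolding matrix_matrix_mult_def B_def by (simp, rule sum.cong) (auto simp: algebra_simps)
    also have "\<dots> = - ((?S ** ?S) $ i $ j)" by (simp add: matrix_matrix_mult_def sum_negf)
    finally show ?thesis unfolding dirac_sign_square[OF d \<xi>] by simp
  qed
  then have BB: "B ** B = - mat 1" by (simp add: vec_eq_iff)
  have "(mat (- \<i> * of_real t) ** dirac_symbol \<alpha> \<beta> m \<xi>) $ i $ j = ((t * ?p) *\<^sub>R B) $ i $ j" for i j
  proof -
    have "(mat (- \<i> * of_real t) ** dirac_symbol \<alpha> \<beta> m \<xi>) $ i $ j =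
      (\<Sum>k\<in>UNIV. (if i = k then (- \<i> * of_real t) * dirac_symbol \<alpha> \<beta> m \<xi> $ k $ j else 0))"
      unfolding matrix_matrix_mult_def mat_def by (simp add: if_distrib if_distribR cong: if_cong)
    also have "\<dots> = (- \<i> * of_real t) * dirac_symbol \<alpha> \<beta> m \<xi> $ i $ j" by simp
    finally show ?thesis using p by (simp add: B_def dirac_sign_def scaleR_complex_eq)
  qed
  then have "mat (- \<i> * of_real t) ** dirac_symbol \<alpha> \<beta> m \<xi> = (t * ?p) *\<^sub>R B" by (simp add: vec_eq_iff)
  then have "matrix_exp (mat (- \<i> * of_real t) ** dirac_symbol \<alpha> \<beta> m \<xi>) = cos (t * ?p) *\<^sub>R mat 1 + sin (t * ?p) *\<^sub>R B"
    by (simp only: matrix_exp_rotation[OF BB])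
  then have "(matrix_exp (mat (- \<i> * of_real t) ** dirac_symbol \<alpha> \<beta> m \<xi>) *v v) $ i
    = (\<Sum>j\<in>UNIV. (if i = j then of_real (cos (t * ?p)) * v $ j else 0) + of_real (sin (t * ?p)) * (- \<i>) * (?S $ i $ j * v $ j))"
    by (auto simp: matrix_vector_mult_def B_def mat_def scaleR_complex_eq algebra_simps intro!: sum.cong)
  also have "\<dots> = of_real (cos (t * ?p)) * v $ i + of_real (sin (t * ?p)) * (- \<i>) * (?S *v v) $ i"
    unfolding sum.distrib sum_distrib_left[symmetric] by (simp add: matrix_vector_mult_def)
  also have "\<dots> = cis (- (t * ?p)) * ((v $ i + (?S *v v) $ i) / 2) + cis (t * ?p) * ((v $ i - (?S *v v) $ i) / 2)"
    by (simp add: complex_eq_iff field_simps)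
  finally show ?thesis .
qed

lemma norm_sq_vec: "(norm (v :: complex^'N))\<^sup>2 = (\<Sum>i\<in>UNIV. (norm (v $ i))\<^sup>2)"
  unfolding norm_vec_def L2_set_def by (simp add: sum_nonneg)

text \<open>S is self-adjoint, hence |S v|^2 = <S S v, v> = |v|^2; in coordinates this is an
  exchange of sums.\<close>

lemma hermitian_involution_norm:
  fixes S :: "complex^'N^'N"
  assumes S: "S ** S = mat 1" and H: "\<And>i j. S $ i $ j = cnj (S $ j $ i)"
  shows "(\<Sum>i\<in>UNIV. (norm ((S *v v) $ i))\<^sup>2) = (\<Sum>i\<in>UNIV. (norm (v $ i))\<^sup>2)"
proof -
  have "complex_of_real (\<Sum>i\<in>UNIV. (norm ((S *v v) $ i))\<^sup>2) = (\<Sum>i\<in>UNIV. (S *v v) $ i * cnj ((S *v v) $ i))"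
    by (simp only: of_real_sum complex_norm_square)
  also have "\<dots> = (\<Sum>i\<in>UNIV. \<Sum>j\<in>UNIV. \<Sum>k\<in>UNIV. (S $ k $ i * S $ i $ j) * (v $ j * cnj (v $ k)))"
  proof (rule sum.cong[OF refl])
    fix i
    have c: "cnj (S $ i $ k) = S $ k $ i" for k using H[of k i] by simp
    have "cnj ((S *v v) $ i) = (\<Sum>k\<in>UNIV. S $ k $ i * cnj (v $ k))"
      by (simp add: matrix_vector_mult_def cnj_sum c)
    then show "(S *v v) $ i * cnj ((S *v v) $ i) = (\<Sum>j\<in>UNIV. \<Sum>k\<in>UNIV. (S $ k $ i * S $ i $ j) * (v $ j * cnj (v $ k)))"
      by (simp add: matrix_vector_mult_def sum_product mult_ac)
  qed
  also have "\<dots> = (\<Sum>j\<in>UNIV. \<Sum>i\<in>UNIV. \<Sum>k\<in>UNIV. (S $ k $ i * S $ i $ j) * (v $ j * cnj (v $ k)))"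
    by (rule sum.swap)
  also have "\<dots> = (\<Sum>j\<in>UNIV. \<Sum>k\<in>UNIV. \<Sum>i\<in>UNIV. (S $ k $ i * S $ i $ j) * (v $ j * cnj (v $ k)))"
    by (rule sum.cong[OF refl], rule sum.swap)
  also have "\<dots> = (\<Sum>j\<in>UNIV. \<Sum>k\<in>UNIV. (S ** S) $ k $ j * (v $ j * cnj (v $ k)))"
    by (simp add: matrix_matrix_mult_def sum_distrib_right)
  also have "\<dots> = (\<Sum>j\<in>UNIV. v $ j * cnj (v $ j))"
  proof (rule sum.cong[OF refl])
    fix j
    have "(S ** S) $ k $ j * (v $ j * cnj (v $ k)) = (if k = j then v $ j * cnj (v $ j) else 0)" for k
      unfolding S by (auto simp: mat_def)
    then show "(\<Sum>k\<in>UNIV. (S ** S) $ k $ j * (v $ j * cnj (v $ k))) = v $ j * cnj (v $ j)" by simp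
  qed
  also have "\<dots> = complex_of_real (\<Sum>i\<in>UNIV. (norm (v $ i))\<^sup>2)"
    by (simp only: of_real_sum complex_norm_square)
  finally show ?thesis by (simp only: of_real_eq_iff)
qed

text \<open>The component \<open>i\<close> of P_+ h for s = 1 and of P_- h for s = -1. Single
  components are used because the scalar theory is applied to each of them.\<close>

definition dirac_part ::
  "('n::finite \<Rightarrow> complex^'N^'N) \<Rightarrow> complex^'N^'N \<Rightarrow> real \<Rightarrow> complex \<Rightarrow> (real^'n \<Rightarrow> complex^'N) \<Rightarrow> 'N \<Rightarrow> real^'n \<Rightarrow> complex" where
  "dirac_part \<alpha> \<beta> m s h i \<xi> = (h \<xi> $ i + s * (dirac_sign \<alpha> \<beta> m \<xi> *v h \<xi>) $ i) / 2"

text \<open>The parallelogram law in every component, combined with |S h| = |h|.\<close>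

lemma dirac_part_norm:
  assumes "dirac_matrices \<alpha> \<beta>" "\<xi> \<noteq> 0"
  shows "(\<Sum>i\<in>UNIV. (norm (dirac_part \<alpha> \<beta> m 1 h i \<xi>))\<^sup>2 + (norm (dirac_part \<alpha> \<beta> m (- 1) h i \<xi>))\<^sup>2) = (norm (h \<xi>))\<^sup>2"
proof -
  let ?S = "dirac_sign \<alpha> \<beta> m \<xi>"
  have e: "(norm ((a + b) / 2))\<^sup>2 + (norm ((a - b) / 2))\<^sup>2 = ((norm a)\<^sup>2 + (norm b)\<^sup>2) / 2" for a b :: complex
    by (simp only: cmod_power2) (simp add: power2_eq_square field_simps)
  have "(\<Sum>i\<in>UNIV. (norm (dirac_part \<alpha> \<beta> m 1 h i \<xi>))\<^sup>2 + (norm (dirac_part \<alpha> \<beta> m (- 1) h i \<xi>))\<^sup>2) =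
    (\<Sum>i\<in>UNIV. ((norm (h \<xi> $ i))\<^sup>2 + (norm ((?S *v h \<xi>) $ i))\<^sup>2) / 2)"
    unfolding dirac_part_def using e by (intro sum.cong) auto
  also have "\<dots> = ((\<Sum>i\<in>UNIV. (norm (h \<xi> $ i))\<^sup>2) + (\<Sum>i\<in>UNIV. (norm ((?S *v h \<xi>) $ i))\<^sup>2)) / 2"
    by (simp add: sum.distrib sum_divide_distrib[symmetric])
  also have "\<dots> = (norm (h \<xi>))\<^sup>2"
    unfolding hermitian_involution_norm[OF dirac_sign_square[OF assms] dirac_sign_hermitian[OF assms(1)]] norm_sq_vec by simp
  finally show ?thesis .
qed

lemma rel_dispersion_dispersion: "dispersion (rel_dispersion m) (\<lambda>r. r / rel_dispersion m r)"
  unfolding dispersion_def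
proof (intro conjI allI impI)
  show "continuous_on {0<..} (\<lambda>r. r / rel_dispersion m r)"
    using rel_dispersion_pos[of _ m] by (fastforce simp: rel_dispersion_def intro!: continuous_intros)
  fix r :: real assume r: "0 < r"
  then have "0 < r\<^sup>2 + m\<^sup>2" by (simp add: add_pos_nonneg)
  then show "(rel_dispersion m has_real_derivative r / rel_dispersion m r) (at r)"
    unfolding rel_dispersion_def[abs_def] by (auto intro!: derivative_eq_intros simp: field_simps)
  show "0 < r / rel_dispersion m r" using r rel_dispersion_pos[OF r, of m] by simp
qed

lemma dirac_part_measurable:
  fixes h :: "real^'n \<Rightarrow> complex^'N"
  assumes [measurable]: "\<And>i. (\<lambda>\<xi>. h \<xi> $ i) \<in> borel_measurable borel"
  shows "dirac_part \<alpha> \<beta> m s h i \<in> borel_measurable borel"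
proof -
  have [measurable]: "(\<lambda>\<xi>::real^'n. rel_dispersion m (norm \<xi>)) \<in> borel_measurable borel"
    unfolding rel_dispersion_def by measurable
  have [measurable]: "(\<lambda>\<xi>::real^'n. \<xi> $ k) \<in> borel_measurable borel" for k
    by (intro borel_measurable_continuous_onI continuous_intros)
  show ?thesis
    unfolding dirac_part_def[abs_def] dirac_sign_def dirac_symbol_def matrix_vector_mult_def
    by (simp add: scaleR_complex_eq)
qed

section \<open>Comparison of the optimal constants\<close>

abbreviation weighted_sq :: "(real \<Rightarrow> real) \<Rightarrow> (real \<Rightarrow> real^'n \<Rightarrow> 'b::real_normed_vector) \<Rightarrow> ennreal" where
  "weighted_sq w u \<equiv> \<integral>\<^sup>+t. \<integral>\<^sup>+x. ennreal ((norm (u t x))\<^sup>2 * w (norm x)) \<partial>lebesgue \<partial>lebesgue"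

text \<open>The functional Q of the overview up to the factor (2 pi)^(-2d), with the time integral
  taken at each point of space.\<close>

definition energy ::
  "(real^'n \<Rightarrow> ennreal) \<Rightarrow> (real \<Rightarrow> real) \<Rightarrow> (real \<Rightarrow> real) \<Rightarrow> (real^'n \<Rightarrow> complex) \<Rightarrow> ennreal" where
  "energy W \<psi> \<phi> h = (\<integral>\<^sup>+x. W x * time_sq (evol \<psi> \<phi> h) x \<partial>lborel)"

lemma inv_fourier_eq:
  fixes F :: "real^'n \<Rightarrow> complex"
  assumes [measurable]: "F \<in> borel_measurable lebesgue" "F' \<in> borel_measurable borel"
    and ae: "AE \<xi> in lborel. F \<xi> = F' \<xi>"
  shows "inv_fourier F x = (LINT \<xi>|lborel. F' \<xi> * cis (x \<bullet> \<xi>)) / of_real ((2 * pi) ^ CARD('n))"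
proof -
  have [measurable]: "(\<lambda>\<xi>. cis (x \<bullet> \<xi>)) \<in> borel_measurable lebesgue"
    by (intro measurable_completion) measurable
  have [measurable]: "F' \<in> borel_measurable lebesgue" by (intro measurable_completion) simp
  have "(LINT \<xi>|lebesgue. F \<xi> * cis (x \<bullet> \<xi>)) = (LINT \<xi>|lebesgue. F' \<xi> * cis (x \<bullet> \<xi>))"
  proof (rule integral_cong_AE)
    show "AE \<xi> in lebesgue. F \<xi> * cis (x \<bullet> \<xi>) = F' \<xi> * cis (x \<bullet> \<xi>)"
      using AE_completion[OF ae] by eventually_elim simp
  qed measurable
  also have "\<dots> = (LINT \<xi>|lborel. F' \<xi> * cis (x \<bullet> \<xi>))"
    by (rule integral_completion) measurable
  finally show ?thesis unfolding inv_fourier_def exp_eq_cis by simp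
qed

lemma schrodinger_evolution_eq_evol:
  fixes g :: "real^'n \<Rightarrow> complex"
  assumes \<psi>: "continuous_on {0<..} \<psi>" and \<phi>: "continuous_on {0<..} \<phi>"
    and [measurable]: "g \<in> borel_measurable lebesgue" "h \<in> borel_measurable borel"
    and ae: "AE \<xi> in lborel. g \<xi> = h \<xi>"
  shows "schrodinger_evolution \<psi> \<phi> g t x = evol \<psi> \<phi> h t x / of_real ((2 * pi) ^ CARD('n))"
proof -
  note [measurable] = continuous_norm_measurable[OF \<psi>, where 'a = "real^'n"]
    continuous_norm_measurable[OF \<phi>, where 'a = "real^'n"]
  have b: "(\<lambda>\<xi>::real^'n. of_real (\<psi> (norm \<xi>)) * cis (- (t * \<phi> (norm \<xi>)))) \<in> borel_measurable borel" by measurable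
  have [measurable]: "(\<lambda>\<xi>::real^'n. of_real (\<psi> (norm \<xi>)) * cis (- (t * \<phi> (norm \<xi>)))) \<in> borel_measurable lebesgue"
    by (intro measurable_completion) (use b in simp)
  show ?thesis
    unfolding schrodinger_evolution_def exp_eq_cis evol_def
  proof (rule inv_fourier_eq)
    show "AE \<xi> in lborel. of_real (\<psi> (norm \<xi>)) * cis (- (t * \<phi> (norm \<xi>))) * g \<xi> =
        of_real (\<psi> (norm \<xi>)) * cis (- (t * \<phi> (norm \<xi>))) * h \<xi>"
      using ae by eventually_elim simp
  qed measurable
qed

lemma evol_norm_measurable:
  fixes h :: "'a::euclidean_space \<Rightarrow> complex"
  assumes "continuous_on {0<..} \<psi>" "continuous_on {0<..} \<phi>" and "h \<in> borel_measurable borel"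
  shows "(\<lambda>(t, x). (norm (evol \<psi> \<phi> h t x))\<^sup>2) \<in> borel_measurable (lborel \<Otimes>\<^sub>M lborel)"
proof -
  note [measurable] = evol_measurable[OF assms]
  show ?thesis by measurable
qed

lemma evol_time_norm_measurable:
  fixes h :: "'a::euclidean_space \<Rightarrow> complex"
  assumes "continuous_on {0<..} \<psi>" "continuous_on {0<..} \<phi>" and "h \<in> borel_measurable borel"
  shows "(\<lambda>x. time_sq (evol \<psi> \<phi> h) x) \<in> borel_measurable borel"
proof -
  note [measurable] = evol_norm_measurable[OF assms]
  have "(\<lambda>x. time_sq (evol \<psi> \<phi> h) x) \<in> borel_measurable lborel" by measurable
  then show ?thesis by simp
qed

lemma spacetime_integral_eq_energy:
  fixes g :: "real^'n \<Rightarrow> complex"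
  assumes W: "represents_weight w W"
    and \<psi>: "continuous_on {0<..} \<psi>" and \<phi>: "continuous_on {0<..} \<phi>"
    and g: "g \<in> borel_measurable lebesgue" and h: "h \<in> borel_measurable borel"
    and ae: "AE \<xi> in lborel. g \<xi> = h \<xi>"
  shows "weighted_sq w (schrodinger_evolution \<psi> \<phi> g) =
    ennreal ((1 / (2 * pi) ^ CARD('n))\<^sup>2) * energy W \<psi> \<phi> h"
proof -
  let ?c = "(1 / (2 * pi) ^ CARD('n))\<^sup>2 :: real"
  let ?F = "\<lambda>t x. ?c * (norm (evol \<psi> \<phi> h t x))\<^sup>2"
  note [measurable] = evol_norm_measurable[OF \<psi> \<phi> h] evol_time_norm_measurable[OF \<psi> \<phi> h]
  have [measurable]: "W \<in> borel_measurable borel" using W by (simp add: represents_weight_def)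
  have e: "(norm (schrodinger_evolution \<psi> \<phi> g t x))\<^sup>2 = ?F t x" for t x
    unfolding schrodinger_evolution_eq_evol[OF assms(2-)]
    by (simp add: norm_divide norm_power power_divide norm_mult)
  have "(\<integral>\<^sup>+t. \<integral>\<^sup>+x. ennreal (?F t x * w (norm x)) \<partial>lebesgue \<partial>lebesgue) =
      (\<integral>\<^sup>+x. W x * (\<integral>\<^sup>+t. ennreal (?F t x) \<partial>lborel) \<partial>lborel)"
  proof -
    have "(\<lambda>(t, x). ?F t x) \<in> borel_measurable (lborel \<Otimes>\<^sub>M lborel)" by measurable
    then show ?thesis using W unfolding represents_weight_def by simp
  qed
  also have "\<dots> = (\<integral>\<^sup>+x. ennreal ?c * (W x * time_sq (evol \<psi> \<phi> h) x) \<partial>lborel)"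
  proof (rule nn_integral_cong)
    fix x
    have [measurable]: "(\<lambda>t. (norm (evol \<psi> \<phi> h t x))\<^sup>2) \<in> borel_measurable lborel" by measurable
    have "(\<integral>\<^sup>+t. ennreal (?F t x) \<partial>lborel) = (\<integral>\<^sup>+t. ennreal ?c * ennreal ((norm (evol \<psi> \<phi> h t x))\<^sup>2) \<partial>lborel)"
      by (intro nn_integral_cong ennreal_mult) auto
    also have "\<dots> = ennreal ?c * time_sq (evol \<psi> \<phi> h) x"
      by (rule nn_integral_cmult) measurable
    finally show "W x * (\<integral>\<^sup>+t. ennreal (?F t x) \<partial>lborel) =
      ennreal ?c * (W x * time_sq (evol \<psi> \<phi> h) x)" by (simp only: mult.left_commute)
  qed
  also have "\<dots> = ennreal ?c * energy W \<psi> \<phi> h"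
    unfolding energy_def by (rule nn_integral_cmult) measurable
  finally show ?thesis unfolding e .
qed

lemma energy_compare:
  fixes h :: "real^'n \<Rightarrow> complex"
  assumes W: "represents_weight w W" and h: "annular h a b"
    and 1: "continuous_on {0<..} \<psi>1" "dispersion \<phi>1 \<phi>1'" and 2: "continuous_on {0<..} \<psi>2" "dispersion \<phi>2 \<phi>2'"
    and c: "0 \<le> c" and eq: "\<And>r. 0 < r \<Longrightarrow> (\<psi>1 r)\<^sup>2 / \<phi>1' r = c * ((\<psi>2 r)\<^sup>2 / \<phi>2' r)"
  shows "energy W \<psi>1 \<phi>1 h = ennreal c * energy W \<psi>2 \<phi>2 h"
proof -
  have [measurable]: "W \<in> borel_measurable borel" using W by (simp add: represents_weight_def)
  have "h \<in> borel_measurable borel" using h by (simp add: annular_def)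
  note [measurable] = evol_time_norm_measurable[OF 2(1) dispersion_continuous[OF 2(2)] this]
  show ?thesis
    unfolding energy_def evol_time_compare[OF h 1 2 c eq, simplified] mult.left_commute[of _ "ennreal c"]
    by (rule nn_integral_cmult) measurable
qed

text \<open>Disposes of the one kind of datum that \<open>energy_le_smoothing_const\<close> cannot
  normalise.\<close>

lemma energy_zero:
  assumes "h \<in> borel_measurable borel" "norm_sq h = 0" "continuous_on {0<..} \<psi>" "continuous_on {0<..} \<phi>"
  shows "energy W \<psi> \<phi> h = 0"
proof -
  note [measurable] = assms(1)
  have "AE \<xi> in lborel. h \<xi> = 0"
    using assms(2) unfolding norm_sq_def by (subst (asm) nn_integral_0_iff_AE) auto
  then have "evol \<psi> \<phi> h t x = 0" for t x
    unfolding evol_def by (intro integral_eq_zero_AE) (auto elim!: eventually_mono)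
  then show ?thesis by (simp add: energy_def)
qed

lemma energy_cmult:
  assumes W: "represents_weight w W" and h: "h \<in> borel_measurable borel"
    and "continuous_on {0<..} \<psi>" "continuous_on {0<..} \<phi>"
  shows "energy W \<psi> \<phi> (\<lambda>\<xi>. c * h \<xi>) = ennreal ((norm c)\<^sup>2) * energy W \<psi> \<phi> h"
proof -
  have [measurable]: "W \<in> borel_measurable borel" using W by (simp add: represents_weight_def)
  note [measurable] = evol_time_norm_measurable[OF assms(3,4) h] evol_norm_measurable[OF assms(3,4) h]
  have "time_sq (evol \<psi> \<phi> (\<lambda>\<xi>. c * h \<xi>)) x =
    ennreal ((norm c)\<^sup>2) * time_sq (evol \<psi> \<phi> h) x" for x
  proof -
    have [measurable]: "(\<lambda>t. (norm (evol \<psi> \<phi> h t x))\<^sup>2) \<in> borel_measurable lborel" by measurable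
    have "time_sq (evol \<psi> \<phi> (\<lambda>\<xi>. c * h \<xi>)) x =
       (\<integral>\<^sup>+t. ennreal ((norm c)\<^sup>2) * ennreal ((norm (evol \<psi> \<phi> h t x))\<^sup>2) \<partial>lborel)"
      unfolding evol_cmult norm_mult power_mult_distrib by (intro nn_integral_cong ennreal_mult) auto
    then show ?thesis by (simp add: nn_integral_cmult)
  qed
  then show ?thesis
    unfolding energy_def by (simp only: mult.left_commute[of _ "ennreal ((norm c)\<^sup>2)"]) (rule nn_integral_cmult, measurable)
qed

lemma energy_add_le:
  assumes W: "represents_weight w W" and h: "annular h1 a b" "annular h2 a b"
    and c: "continuous_on {0<..} \<psi>" "continuous_on {0<..} \<phi>"
  shows "energy W \<psi> \<phi> (\<lambda>\<xi>. h1 \<xi> + h2 \<xi>) \<le> 2 * (energy W \<psi> \<phi> h1 + energy W \<psi> \<phi> h2)"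
proof -
  have [measurable]: "W \<in> borel_measurable borel" using W by (simp add: represents_weight_def)
  have m: "h1 \<in> borel_measurable borel" "h2 \<in> borel_measurable borel" using h by (auto simp: annular_def)
  note [measurable] = evol_time_norm_measurable[OF c m(1)] evol_time_norm_measurable[OF c m(2)]
  let ?I = "\<lambda>h x. time_sq (evol \<psi> \<phi> h) x"
  have "?I (\<lambda>\<xi>. h1 \<xi> + h2 \<xi>) x \<le> 2 * ?I h1 x + 2 * ?I h2 x" for x
  proof -
    have "(\<lambda>t. evol \<psi> \<phi> h t x) \<in> borel_measurable borel" if "h \<in> borel_measurable borel" for h
      using measurable_compose[OF _ evol_measurable[OF c that], of "\<lambda>t. (t, x)" borel] by simp
    from norm_sq_add_le_2[OF this[OF m(1)] this[OF m(2)]] show ?thesis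
      unfolding evol_add[OF h c] norm_sq_def by (simp add: distrib_left)
  qed
  then have "energy W \<psi> \<phi> (\<lambda>\<xi>. h1 \<xi> + h2 \<xi>) \<le> (\<integral>\<^sup>+x. W x * (2 * ?I h1 x + 2 * ?I h2 x) \<partial>lborel)"
    unfolding energy_def by (intro nn_integral_mono mult_left_mono) auto
  also have "\<dots> = (\<integral>\<^sup>+x. 2 * (W x * ?I h1 x) + 2 * (W x * ?I h2 x) \<partial>lborel)"
    by (simp add: distrib_left mult.left_commute)
  also have "\<dots> = 2 * (energy W \<psi> \<phi> h1 + energy W \<psi> \<phi> h2)"
    unfolding energy_def by (subst nn_integral_add, measurable) (simp add: nn_integral_cmult distrib_left)
  finally show ?thesis .
qed

lemma annular_in_L2:
  fixes h :: "real^'n \<Rightarrow> complex"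
  assumes "annular h a b"
  shows "h \<in> borel_measurable lebesgue" "in_L2 h" "compact_support_off_0 h" "L2_norm_sq h = norm_sq h"
proof -
  show m: "h \<in> borel_measurable lebesgue"
    by (intro measurable_completion) (use assms in \<open>simp add: annular_def\<close>)
  show l: "L2_norm_sq h = norm_sq h" by (rule L2_norm_sq_eq_norm_sq) simp
  show "in_L2 h" using assms m l by (simp add: in_L2_def annular_def)
  have "compact (cball 0 b - ball (0::real^'n) a)" by (intro compact_diff) auto
  moreover have "\<xi> \<notin> cball 0 b - ball 0 a \<longrightarrow> h \<xi> = 0" for \<xi>
    using assms unfolding annular_def by auto
  ultimately show "compact_support_off_0 h"
    unfolding compact_support_off_0_def using assms
    by (intro exI[of _ "cball 0 b - ball 0 a"]) (auto simp: annular_def)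
qed

text \<open>The supremum in homogeneous form, ready for data that are not normalised. The squared
  power of 2 pi on the left belongs to the evolution; the single power on the right converts the
  norm of the transform \<open>h\<close> into that of its datum.\<close>

lemma energy_le_smoothing_const:
  fixes h :: "real^'n \<Rightarrow> complex"
  assumes W: "represents_weight w W" and h: "annular h a b"
    and c: "continuous_on {0<..} \<psi>" "continuous_on {0<..} \<phi>"
  shows "ennreal ((1 / (2 * pi) ^ CARD('n))\<^sup>2) * energy W \<psi> \<phi> h \<le>
    smoothing_const TYPE('n) w \<psi> \<phi> * (ennreal (1 / (2 * pi) ^ CARD('n)) * norm_sq h)"
proof -
  let ?c = "1 / (2 * pi) ^ CARD('n) :: real"
  have m: "h \<in> borel_measurable borel" and fin: "norm_sq h < \<infinity>" using h by (auto simp: annular_def)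
  obtain s where s: "norm_sq h = ennreal s" "0 \<le> s" using fin by (cases "norm_sq h") auto
  show ?thesis
  proof (cases "s = 0")
    case True
    then show ?thesis using energy_zero[OF m _ c] s by simp
  next
    case False
    \<comment> \<open>Both sides are homogeneous of degree two in \<open>h\<close>; this scaling
      gives the datum belonging to k h the norm 1, since ?c k^2 s = 1.\<close>
    define k where "k = sqrt (1 / (?c * s))"
    have sp: "s > 0" using False s by simp
    then have "?c * s > 0" by simp
    have k: "k\<^sup>2 = 1 / (?c * s)" using sp by (simp add: k_def)
    define g where "g \<xi> = of_real k * h \<xi>" for \<xi>
    have ng: "norm_sq g = ennreal (k\<^sup>2) * norm_sq h" unfolding g_def[abs_def] using m by (simp add: norm_sq_cmult)
    have ga: "annular g a b" using h ng unfolding annular_def by (auto simp: g_def[abs_def] ennreal_mult_less_top)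
    obtain f where f: "has_L2_fourier f g" "L2_norm_sq f = ennreal ?c * L2_norm_sq g"
      using has_L2_fourier_exists[OF annular_in_L2(2,3)[OF ga]] .
    have "L2_norm_sq f = ennreal (?c * (k\<^sup>2 * s))"
      unfolding f(2) annular_in_L2(4)[OF ga] ng s(1) using s(2) by (simp add: ennreal_mult[symmetric] del: times_divide_eq_left)
    also have "?c * (k\<^sup>2 * s) = 1" unfolding k using \<open>?c * s > 0\<close> by (simp add: field_simps)
    finally have f1: "L2_norm_sq f = 1" by simp
    have "(f, g) \<in> {(f, g). has_L2_fourier f g \<and> L2_norm_sq f = 1 \<and> compact_support_off_0 g}"
      using f f1 annular_in_L2(3)[OF ga] by simp
    then have "weighted_sq w (schrodinger_evolution \<psi> \<phi> g)
        \<le> smoothing_const TYPE('n) w \<psi> \<phi>"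
      unfolding smoothing_const_def by (rule SUP_upper2) simp
    then have "ennreal (?c\<^sup>2) * energy W \<psi> \<phi> g \<le> smoothing_const TYPE('n) w \<psi> \<phi>"
      using spacetime_integral_eq_energy[OF W c annular_in_L2(1)[OF ga], of g] ga by (simp add: annular_def)
    then have le: "ennreal (?c\<^sup>2) * (ennreal (k\<^sup>2) * energy W \<psi> \<phi> h) \<le> smoothing_const TYPE('n) w \<psi> \<phi>"
      unfolding g_def[abs_def] energy_cmult[OF W m c] by simp
    have "ennreal (?c\<^sup>2) * energy W \<psi> \<phi> h = ennreal (?c\<^sup>2) * (ennreal (k\<^sup>2 * (?c * s)) * energy W \<psi> \<phi> h)"
      unfolding k using sp by simp
    also have "\<dots> = ennreal (?c\<^sup>2) * (ennreal (k\<^sup>2) * energy W \<psi> \<phi> h) * ennreal (?c * s)"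
      using \<open>?c * s > 0\<close> by (subst ennreal_mult) (auto simp: mult_ac)
    also have "\<dots> \<le> smoothing_const TYPE('n) w \<psi> \<phi> * ennreal (?c * s)"
      by (intro mult_right_mono le) simp
    also have "ennreal (?c * s) = ennreal ?c * norm_sq h"
      unfolding s(1) using s(2) by (intro ennreal_mult) auto
    finally show ?thesis .
  qed
qed

section \<open>Spectral parts of vector-valued data\<close>

lemma annular_weaken: "annular h a b \<Longrightarrow> 0 < a' \<Longrightarrow> a' \<le> a \<Longrightarrow> b \<le> b' \<Longrightarrow> annular h a' b'"
  unfolding annular_def by auto

lemma dirac_part_norm_sq:
  fixes h :: "real^'n \<Rightarrow> complex^'N"
  assumes d: "dirac_matrices \<alpha> \<beta>" and h: "\<And>i. annular (\<lambda>\<xi>. h \<xi> $ i) a b"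
  shows "(\<Sum>i\<in>UNIV. norm_sq (dirac_part \<alpha> \<beta> m 1 h i) + norm_sq (dirac_part \<alpha> \<beta> m (- 1) h i))
    = (\<Sum>i\<in>UNIV. norm_sq (\<lambda>\<xi>. h \<xi> $ i))"
proof -
  have m: "(\<lambda>\<xi>. h \<xi> $ i) \<in> borel_measurable borel" for i using h by (auto simp: annular_def)
  note [measurable] = m dirac_part_measurable[of h, OF m]
  have "(\<Sum>i\<in>UNIV. norm_sq (dirac_part \<alpha> \<beta> m 1 h i) + norm_sq (dirac_part \<alpha> \<beta> m (- 1) h i)) =
    (\<integral>\<^sup>+\<xi>. (\<Sum>i\<in>UNIV. ennreal ((norm (dirac_part \<alpha> \<beta> m 1 h i \<xi>))\<^sup>2) + ennreal ((norm (dirac_part \<alpha> \<beta> m (- 1) h i \<xi>))\<^sup>2)) \<partial>lborel)"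
    unfolding norm_sq_def
    by (subst nn_integral_sum, measurable, intro sum.cong refl nn_integral_add[symmetric]) measurable
  also have "\<dots> = (\<integral>\<^sup>+\<xi>. (\<Sum>i\<in>UNIV. ennreal ((norm (h \<xi> $ i))\<^sup>2)) \<partial>lborel)"
  \<comment> \<open>Only almost everywhere: \<open>dirac_part_norm\<close> leaves out the
    origin.\<close>
  proof (rule nn_integral_cong_AE)
    show "AE \<xi> in lborel. (\<Sum>i\<in>UNIV. ennreal ((norm (dirac_part \<alpha> \<beta> m 1 h i \<xi>))\<^sup>2) + ennreal ((norm (dirac_part \<alpha> \<beta> m (- 1) h i \<xi>))\<^sup>2))
      = (\<Sum>i\<in>UNIV. ennreal ((norm (h \<xi> $ i))\<^sup>2))"
      using AE_lborel_singleton[of 0]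
    proof eventually_elim
      case (elim \<xi>)
      have "(\<Sum>i\<in>UNIV. ennreal ((norm (dirac_part \<alpha> \<beta> m 1 h i \<xi>))\<^sup>2) + ennreal ((norm (dirac_part \<alpha> \<beta> m (- 1) h i \<xi>))\<^sup>2))
        = ennreal (\<Sum>i\<in>UNIV. (norm (dirac_part \<alpha> \<beta> m 1 h i \<xi>))\<^sup>2 + (norm (dirac_part \<alpha> \<beta> m (- 1) h i \<xi>))\<^sup>2)"
        by (simp add: ennreal_plus[symmetric] sum_ennreal del: ennreal_plus)
      also have "\<dots> = (\<Sum>i\<in>UNIV. ennreal ((norm (h \<xi> $ i))\<^sup>2))"
        unfolding dirac_part_norm[OF d elim] norm_sq_vec by (simp add: sum_ennreal)
      finally show ?case .
    qed
  qed
  also have "\<dots> = (\<Sum>i\<in>UNIV. norm_sq (\<lambda>\<xi>. h \<xi> $ i))"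
    unfolding norm_sq_def by (rule nn_integral_sum) measurable
  finally show ?thesis .
qed

lemma dirac_part_annular:
  fixes h :: "real^'n \<Rightarrow> complex^'N"
  assumes d: "dirac_matrices \<alpha> \<beta>" and h: "\<And>i. annular (\<lambda>\<xi>. h \<xi> $ i) a b" and s: "s = 1 \<or> s = - 1"
  shows "annular (dirac_part \<alpha> \<beta> m s h i) a b"
proof -
  have m: "(\<lambda>\<xi>. h \<xi> $ i) \<in> borel_measurable borel" for i using h by (auto simp: annular_def)
  have z: "dirac_part \<alpha> \<beta> m s h i \<xi> = 0" if "norm \<xi> < a \<or> norm \<xi> > b" for \<xi>
  proof -
    have "h \<xi> $ j = 0" for j using h[of j] that by (auto simp: annular_def)
    then have "h \<xi> = 0" by (simp add: vec_eq_iff)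
    then show ?thesis by (simp add: dirac_part_def)
  qed
  have "norm_sq (dirac_part \<alpha> \<beta> m s h i) \<le> norm_sq (dirac_part \<alpha> \<beta> m 1 h i) + norm_sq (dirac_part \<alpha> \<beta> m (- 1) h i)"
    using s by auto
  also have "\<dots> \<le> (\<Sum>i\<in>UNIV. norm_sq (dirac_part \<alpha> \<beta> m 1 h i) + norm_sq (dirac_part \<alpha> \<beta> m (- 1) h i))"
    by (rule member_le_sum) auto
  also have "\<dots> < \<infinity>" unfolding dirac_part_norm_sq[OF d h] using h by (simp add: annular_def)
  finally show ?thesis
    using z h[of i] dirac_part_measurable[of h, OF m] unfolding annular_def by auto
qed

lemma dirac_evolution_eq_evol:
  fixes g h :: "real^'n \<Rightarrow> complex^'N"
  assumes d: "dirac_matrices \<alpha> \<beta>" and h: "\<And>i. annular (\<lambda>\<xi>. h \<xi> $ i) a b"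
    and ae: "\<And>i. AE \<xi> in lborel. g \<xi> $ i = h \<xi> $ i"
    and \<psi>: "continuous_on {0<..} \<psi>"
  shows "dirac_evolution \<alpha> \<beta> m \<psi> g t x $ i =
    (evol \<psi> (rel_dispersion m) (dirac_part \<alpha> \<beta> m 1 h i) t x +
     evol \<psi> (rel_dispersion m) (dirac_part \<alpha> \<beta> m (- 1) h i) (- t) x) / of_real ((2 * pi) ^ CARD('n))"
proof -
  let ?p = "rel_dispersion m"
  let ?P = "dirac_part \<alpha> \<beta> m 1 h i" and ?Q = "dirac_part \<alpha> \<beta> m (- 1) h i"
  have c: "continuous_on {0<..} ?p" by (rule dispersion_continuous[OF rel_dispersion_dispersion])
  have m: "(\<lambda>\<xi>. h \<xi> $ i) \<in> borel_measurable borel" for i using h by (auto simp: annular_def)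
  have P: "annular ?P a b" and Q: "annular ?Q a b" using dirac_part_annular[OF d h] by auto
  note [measurable] = continuous_norm_measurable[OF \<psi>, where 'a = "real^'n"]
    continuous_norm_measurable[OF c, where 'a = "real^'n"] dirac_part_measurable[of h, OF m]
  define F' where "F' \<xi> = of_real (\<psi> (norm \<xi>)) * cis (- (t * ?p (norm \<xi>))) * ?P \<xi> +
    of_real (\<psi> (norm \<xi>)) * cis (- (- t * ?p (norm \<xi>))) * ?Q \<xi>" for \<xi>
  have m': "F' \<in> borel_measurable borel" unfolding F'_def[abs_def] by measurable
  define F where "F \<xi> = of_real (\<psi> (norm \<xi>)) *
    (matrix_exp (mat (- \<i> * of_real t) ** dirac_symbol \<alpha> \<beta> m \<xi>) *v g \<xi>) $ i" for \<xi>
  have AE: "AE \<xi> in lborel. F \<xi> = F' \<xi>"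
  proof -
    have "AE \<xi> in lborel. \<forall>i. g \<xi> $ i = h \<xi> $ i" using ae by (simp add: AE_all_countable)
    then show ?thesis using AE_lborel_singleton[of 0]
    proof eventually_elim
      case (elim \<xi>)
      then have "g \<xi> = h \<xi>" by (simp add: vec_eq_iff)
      then show ?case
        unfolding F_def F'_def dirac_exp[OF d elim(2)] dirac_part_def by (simp add: algebra_simps)
    qed
  qed
  \<comment> \<open>\<open>F\<close> contains the matrix exponential. Its measurability is inherited
    from the Borel function \<open>F'\<close>, with which it agrees almost everywhere, because
    Lebesgue measure is complete.\<close>
  have mF: "F \<in> borel_measurable lebesgue"
  proof (rule borel_measurable_AE)
    show "F' \<in> borel_measurable lebesgue" by (intro measurable_completion) (use m' in simp)
    show "AE \<xi> in lebesgue. F' \<xi> = F \<xi>" using AE_completion[OF AE] by eventually_elim simp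
  qed
  have "dirac_evolution \<alpha> \<beta> m \<psi> g t x $ i = inv_fourier F x"
    unfolding dirac_evolution_def F_def by simp
  also have "\<dots> = (LINT \<xi>|lborel. F' \<xi> * cis (x \<bullet> \<xi>)) / of_real ((2 * pi) ^ CARD('n))"
    by (rule inv_fourier_eq[OF mF m' AE])
  also have "(LINT \<xi>|lborel. F' \<xi> * cis (x \<bullet> \<xi>)) = evol \<psi> ?p ?P t x + evol \<psi> ?p ?Q (- t) x"
    unfolding evol_def F'_def distrib_right
    by (rule Bochner_Integration.integral_add[OF annular_symbol_integrable[OF P \<psi> c] annular_symbol_integrable[OF Q \<psi> c]])
  finally show ?thesis .
qed

text \<open>\<open>represents_weight\<close> moves the time integral inside, where
  \<open>evol_time_orthogonal\<close> removes the cross terms for each component and at each point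
  of space.\<close>

lemma dirac_spacetime_integral:
  fixes g h :: "real^'n \<Rightarrow> complex^'N"
  assumes W: "represents_weight w W" and d: "dirac_matrices \<alpha> \<beta>" and h: "\<And>i. annular (\<lambda>\<xi>. h \<xi> $ i) a b"
    and ae: "\<And>i. AE \<xi> in lborel. g \<xi> $ i = h \<xi> $ i"
    and \<psi>: "continuous_on {0<..} \<psi>"
  shows "weighted_sq w (dirac_evolution \<alpha> \<beta> m \<psi> g) =
    ennreal ((1 / (2 * pi) ^ CARD('n))\<^sup>2) *
    (\<Sum>i\<in>UNIV. energy W \<psi> (rel_dispersion m) (dirac_part \<alpha> \<beta> m 1 h i) +
       energy W \<psi> (rel_dispersion m) (dirac_part \<alpha> \<beta> m (- 1) h i))"
proof -
  let ?p = "rel_dispersion m" and ?c = "(1 / (2 * pi) ^ CARD('n))\<^sup>2 :: real"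
  let ?P = "dirac_part \<alpha> \<beta> m 1 h" and ?Q = "dirac_part \<alpha> \<beta> m (- 1) h"
  let ?E = "\<lambda>i t x. (norm (evol \<psi> ?p (?P i) t x + evol \<psi> ?p (?Q i) (- t) x))\<^sup>2"
  let ?I = "\<lambda>h x. time_sq (evol \<psi> ?p h) x"
  have c: "continuous_on {0<..} ?p" by (rule dispersion_continuous[OF rel_dispersion_dispersion])
  have P: "annular (?P i) a b" and Q: "annular (?Q i) a b" for i using dirac_part_annular[OF d h] by auto
  have mP: "?P i \<in> borel_measurable borel" and mQ: "?Q i \<in> borel_measurable borel" for i
    using P Q by (auto simp: annular_def)
  note [measurable] = evol_measurable[OF \<psi> c mP] evol_measurable[OF \<psi> c mQ]
    evol_time_norm_measurable[OF \<psi> c mP] evol_time_norm_measurable[OF \<psi> c mQ]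
  have [measurable]: "(\<lambda>p. evol \<psi> ?p (?Q i) (- fst p) (snd p)) \<in> borel_measurable (lborel \<Otimes>\<^sub>M lborel)" for i
    using measurable_compose[OF _ evol_measurable[OF \<psi> c mQ[of i]], of "\<lambda>p. (- fst p, snd p)" "lborel \<Otimes>\<^sub>M lborel"]
    by simp
  have Em[measurable]: "(\<lambda>(t, x). ?E i t x) \<in> borel_measurable (lborel \<Otimes>\<^sub>M lborel)" for i
    unfolding split_def by measurable
  have [measurable]: "W \<in> borel_measurable borel" using W by (simp add: represents_weight_def)
  let ?F = "\<lambda>t x. ?c * (\<Sum>i\<in>UNIV. ?E i t x)"
  have e: "(norm (dirac_evolution \<alpha> \<beta> m \<psi> g t x))\<^sup>2 = ?F t x" for t x
    unfolding norm_sq_vec dirac_evolution_eq_evol[OF d h ae \<psi>] sum_distrib_left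
    by (simp add: norm_divide norm_power power_divide norm_mult)
  have "(\<lambda>(t, x). ?F t x) \<in> borel_measurable (lborel \<Otimes>\<^sub>M lborel)" unfolding split_def by measurable
  moreover have "\<forall>t x. 0 \<le> ?F t x" by (auto intro!: mult_nonneg_nonneg sum_nonneg)
  ultimately have "(\<integral>\<^sup>+t. \<integral>\<^sup>+x. ennreal (?F t x * w (norm x)) \<partial>lebesgue \<partial>lebesgue) =
      (\<integral>\<^sup>+x. W x * (\<integral>\<^sup>+t. ennreal (?F t x) \<partial>lborel) \<partial>lborel)"
    using W unfolding represents_weight_def by blast
  also have "\<dots> = (\<integral>\<^sup>+x. ennreal ?c * (\<Sum>i\<in>UNIV. W x * ?I (?P i) x + W x * ?I (?Q i) x) \<partial>lborel)"
  proof (rule nn_integral_cong)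
    fix x
    have [measurable]: "(\<lambda>t. ?E i t x) \<in> borel_measurable lborel" for i
      using measurable_compose[OF _ Em[of i], of "\<lambda>t. (t, x)" lborel] by simp
    have "(\<integral>\<^sup>+t. ennreal (?F t x) \<partial>lborel) = (\<integral>\<^sup>+t. ennreal ?c * (\<Sum>i\<in>UNIV. ennreal (?E i t x)) \<partial>lborel)"
      by (intro nn_integral_cong) (simp only: sum_ennreal zero_le_power2 ennreal_mult sum_nonneg)
    also have "\<dots> = ennreal ?c * (\<Sum>i\<in>UNIV. \<integral>\<^sup>+t. ennreal (?E i t x) \<partial>lborel)"
      by (subst nn_integral_cmult, measurable) (subst nn_integral_sum, measurable)
    also have "(\<Sum>i\<in>UNIV. \<integral>\<^sup>+t. ennreal (?E i t x) \<partial>lborel) = (\<Sum>i\<in>UNIV. ?I (?P i) x + ?I (?Q i) x)"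
      by (intro sum.cong refl evol_time_orthogonal[OF P Q \<psi> rel_dispersion_dispersion rel_dispersion_pos])
    finally show "W x * (\<integral>\<^sup>+t. ennreal (?F t x) \<partial>lborel) = ennreal ?c * (\<Sum>i\<in>UNIV. W x * ?I (?P i) x + W x * ?I (?Q i) x)"
      by (simp only: mult.left_commute distrib_left sum_distrib_left)
  qed
  also have "\<dots> = ennreal ?c * (\<Sum>i\<in>UNIV. energy W \<psi> ?p (?P i) + energy W \<psi> ?p (?Q i))"
    unfolding energy_def
    by (subst nn_integral_cmult, measurable, subst nn_integral_sum, measurable)
       (simp add: nn_integral_add)
  finally show ?thesis unfolding e .
qed

lemma vector_annular_rep:
  fixes f g :: "real^'n \<Rightarrow> complex^'N"
  assumes fg: "\<And>i. has_L2_fourier (\<lambda>x. f x $ i) (\<lambda>\<xi>. g \<xi> $ i)" and c: "compact_support_off_0 g"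
  obtains h :: "real^'n \<Rightarrow> complex^'N" and a b where "\<forall>i. annular (\<lambda>\<xi>. h \<xi> $ i) a b"
    "\<forall>i. AE \<xi> in lborel. g \<xi> $ i = h \<xi> $ i" "\<forall>i. L2_norm_sq (\<lambda>\<xi>. g \<xi> $ i) = norm_sq (\<lambda>\<xi>. h \<xi> $ i)"
proof -
  have "\<exists>k a b. annular k a b \<and> (AE \<xi> in lborel. g \<xi> $ i = k \<xi>)" for i
  proof -
    have L: "in_L2 (\<lambda>\<xi>. g \<xi> $ i)" using fg[of i] by (simp add: has_L2_fourier_def)
    have "compact_support_off_0 (\<lambda>\<xi>. g \<xi> $ i)"
    proof -
      obtain K where "compact K" "0 \<notin> K" "AE \<xi> in lebesgue. \<xi> \<notin> K \<longrightarrow> g \<xi> = 0"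
        using c unfolding compact_support_off_0_def by blast
      then show ?thesis unfolding compact_support_off_0_def
        by (intro exI[of _ K]) (auto elim!: eventually_mono)
    qed
    from compact_support_off_0_rep[OF L this] show ?thesis by blast
  qed
  then obtain k A B where k: "\<And>i. annular (k i) (A i) (B i)" "\<And>i. AE \<xi> in lborel. g \<xi> $ i = k i \<xi>" by metis
  define h where "h \<xi> = (\<chi> i. k i \<xi>)" for \<xi>
  \<comment> \<open>One shell for all components: the smallest inner and the largest outer radius
    over the finite index type.\<close>
  have 1: "annular (\<lambda>\<xi>. h \<xi> $ i) (Min (range A)) (Max (range B))" for i
    unfolding h_def vec_lambda_beta
  proof (rule annular_weaken[OF k(1)])
    show "0 < Min (range A)" using k(1) by (auto simp: annular_def)
  qed auto
  have 2: "AE \<xi> in lborel. g \<xi> $ i = h \<xi> $ i" for i using k(2) by (simp add: h_def)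
  show ?thesis
    by (rule that[of h "Min (range A)" "Max (range B)"]) (use 1 2 L2_norm_sq_eq_norm_sq[OF 2] in auto)
qed

lemma L2_norm_sq_vec:
  fixes f :: "real^'n \<Rightarrow> complex^'N"
  assumes [measurable]: "\<And>i. (\<lambda>x. f x $ i) \<in> borel_measurable lebesgue"
  shows "L2_norm_sq f = (\<Sum>i\<in>UNIV. L2_norm_sq (\<lambda>x. f x $ i))"
proof -
  have "L2_norm_sq f = (\<integral>\<^sup>+x. (\<Sum>i\<in>UNIV. ennreal ((norm (f x $ i))\<^sup>2)) \<partial>lebesgue)"
    unfolding L2_norm_sq_def norm_sq_vec by (simp add: sum_ennreal)
  also have "\<dots> = (\<Sum>i\<in>UNIV. L2_norm_sq (\<lambda>x. f x $ i))"
    unfolding L2_norm_sq_def by (rule nn_integral_sum) measurable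
  finally show ?thesis .
qed

lemma norm_sq_vec_axis: "(norm (axis i z :: complex^'N))\<^sup>2 = (norm z)\<^sup>2"
proof -
  have "(norm (axis i z :: complex^'N))\<^sup>2 = (\<Sum>j\<in>UNIV. if j = i then (norm z)\<^sup>2 else 0)"
    unfolding norm_sq_vec by (intro sum.cong) (auto simp: axis_def)
  then show ?thesis by simp
qed

lemma has_L2_fourier_zero: "has_L2_fourier (\<lambda>x::real^'n. 0) (\<lambda>\<xi>. 0)"
  unfolding has_L2_fourier_def in_L2_def
  by (intro conjI exI[of _ "\<lambda>n x. 0"]) (auto simp: L2_norm_sq_def fourier_def)

text \<open>Being homogeneous, the scalar bound applies to each component of both spectral parts
  without normalising them; \<open>dirac_part_norm_sq\<close> then adds up their masses.\<close>

lemma dirac_smoothing_const_le: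
  fixes w \<psi> :: "real \<Rightarrow> real" and \<alpha> :: "'n::finite \<Rightarrow> complex^'N^'N"
  assumes W: "represents_weight w (W :: real^'n \<Rightarrow> ennreal)" and d: "dirac_matrices \<alpha> \<beta>"
    and \<psi>: "continuous_on {0<..} \<psi>"
  shows "dirac_smoothing_const \<alpha> \<beta> w \<psi> m \<le> smoothing_const TYPE('n) w \<psi> (rel_dispersion m)"
  unfolding dirac_smoothing_const_def
proof (rule SUP_least, clarify)
  fix f g :: "real^'n \<Rightarrow> complex^'N"
  assume fg: "\<forall>i. has_L2_fourier (\<lambda>x. f x $ i) (\<lambda>\<xi>. g \<xi> $ i)" and f1: "L2_norm_sq f = 1"
    and c: "compact_support_off_0 g"
  let ?p = "rel_dispersion m" and ?K = "(2 * pi) ^ CARD('n) :: real"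
  let ?C = "smoothing_const TYPE('n) w \<psi> ?p"
  have cp: "continuous_on {0<..} ?p" by (rule dispersion_continuous[OF rel_dispersion_dispersion])
  obtain h a b where h: "\<forall>i. annular (\<lambda>\<xi>. h \<xi> $ i) a b"
    "\<forall>i. AE \<xi> in lborel. g \<xi> $ i = h \<xi> $ i" "\<forall>i. L2_norm_sq (\<lambda>\<xi>. g \<xi> $ i) = norm_sq (\<lambda>\<xi>. h \<xi> $ i)"
    using vector_annular_rep[OF spec[OF fg] c] .
  let ?P = "dirac_part \<alpha> \<beta> m 1 h" and ?Q = "dirac_part \<alpha> \<beta> m (- 1) h"
  have P: "annular (?P i) a b" and Q: "annular (?Q i) a b" for i using dirac_part_annular[OF d spec[OF h(1)]] by auto
  have "weighted_sq w (dirac_evolution \<alpha> \<beta> m \<psi> g) =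
    ennreal ((1 / ?K)\<^sup>2) * (\<Sum>i\<in>UNIV. energy W \<psi> ?p (?P i) + energy W \<psi> ?p (?Q i))"
    by (rule dirac_spacetime_integral[OF W d spec[OF h(1)] spec[OF h(2)] \<psi>])
  also have "\<dots> = (\<Sum>i\<in>UNIV. ennreal ((1 / ?K)\<^sup>2) * energy W \<psi> ?p (?P i) + ennreal ((1 / ?K)\<^sup>2) * energy W \<psi> ?p (?Q i))"
    by (simp only: sum_distrib_left distrib_left)
  also have "\<dots> \<le> (\<Sum>i\<in>UNIV. ?C * (ennreal (1 / ?K) * norm_sq (?P i)) + ?C * (ennreal (1 / ?K) * norm_sq (?Q i)))"
    by (intro sum_mono add_mono energy_le_smoothing_const[OF W P \<psi> cp] energy_le_smoothing_const[OF W Q \<psi> cp])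
  also have "\<dots> = ?C * (ennreal (1 / ?K) * (\<Sum>i\<in>UNIV. norm_sq (?P i) + norm_sq (?Q i)))"
    by (simp only: sum_distrib_left distrib_left)
  also have "(\<Sum>i\<in>UNIV. norm_sq (?P i) + norm_sq (?Q i)) = (\<Sum>i\<in>UNIV. norm_sq (\<lambda>\<xi>. h \<xi> $ i))"
    by (rule dirac_part_norm_sq[OF d spec[OF h(1)]])
  also have "\<dots> \<le> (\<Sum>i\<in>UNIV. ennreal ?K * L2_norm_sq (\<lambda>x. f x $ i))"
    using has_L2_fourier_norm_le[OF spec[OF fg]] h(3) by (intro sum_mono) simp
  also have "\<dots> = ennreal ?K * L2_norm_sq f"
    using fg by (subst L2_norm_sq_vec) (auto simp: sum_distrib_left has_L2_fourier_def in_L2_def)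
  \<comment> \<open>The power of 2 pi from converting transforms into data cancels the one from
    bounding the transform of \<open>f\<close>.\<close>
  also have "?C * (ennreal (1 / ?K) * (ennreal ?K * L2_norm_sq f)) = ?C"
    unfolding f1 mult_1_right by (subst ennreal_mult[symmetric]) auto
  finally show "weighted_sq w (dirac_evolution \<alpha> \<beta> m \<psi> g) \<le> ?C"
    by (simp add: mult_left_mono)
qed

text \<open>A scalar datum placed in one component is the sum of its two spectral parts there, so
  \<open>energy_add_le\<close> gives the factor 2. The energies of the other components, which S may
  populate, only enlarge the Dirac side.\<close>

lemma smoothing_const_le_dirac:
  fixes w \<psi> :: "real \<Rightarrow> real" and \<alpha> :: "'n::finite \<Rightarrow> complex^'N^'N"
  assumes W: "represents_weight w (W :: real^'n \<Rightarrow> ennreal)" and d: "dirac_matrices \<alpha> \<beta>"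
    and \<psi>: "continuous_on {0<..} \<psi>"
  shows "smoothing_const TYPE('n) w \<psi> (rel_dispersion m) \<le> 2 * dirac_smoothing_const \<alpha> \<beta> w \<psi> m"
  unfolding smoothing_const_def
proof (rule SUP_least, clarify)
  fix f g :: "real^'n \<Rightarrow> complex"
  assume fg: "has_L2_fourier f g" and f1: "L2_norm_sq f = 1" and c: "compact_support_off_0 g"
  let ?p = "rel_dispersion m" and ?c = "(1 / (2 * pi) ^ CARD('n))\<^sup>2 :: real"
  have cp: "continuous_on {0<..} ?p" by (rule dispersion_continuous[OF rel_dispersion_dispersion])
  \<comment> \<open>Types are nonempty, so some index exists; which component receives the scalar
    datum is immaterial.\<close>
  obtain i0 :: 'N where True by blast
  define fv where "fv x = axis i0 (f x)" for x
  define gv where "gv x = axis i0 (g x)" for x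
  have comp: "(\<lambda>x. axis i0 (u x) $ i) = (if i = i0 then u else (\<lambda>x. 0))" for u :: "real^'n \<Rightarrow> complex" and i
    by (auto simp: axis_def)
  have fgv: "\<forall>i. has_L2_fourier (\<lambda>x. fv x $ i) (\<lambda>\<xi>. gv \<xi> $ i)"
    unfolding fv_def gv_def comp using fg by (simp add: has_L2_fourier_zero)
  have fv1: "L2_norm_sq fv = 1"
    using f1 unfolding L2_norm_sq_def fv_def by (simp add: norm_sq_vec_axis)
  have cv: "compact_support_off_0 gv"
    using c unfolding compact_support_off_0_def gv_def by (auto elim!: eventually_mono)
  obtain h a b where h: "\<forall>i. annular (\<lambda>\<xi>. h \<xi> $ i) a b"
    "\<forall>i. AE \<xi> in lborel. gv \<xi> $ i = h \<xi> $ i" "\<forall>i. L2_norm_sq (\<lambda>\<xi>. gv \<xi> $ i) = norm_sq (\<lambda>\<xi>. h \<xi> $ i)"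
    using vector_annular_rep[OF spec[OF fgv] cv] .
  let ?P = "dirac_part \<alpha> \<beta> m 1 h" and ?Q = "dirac_part \<alpha> \<beta> m (- 1) h"
  have P: "annular (?P i) a b" and Q: "annular (?Q i) a b" for i using dirac_part_annular[OF d spec[OF h(1)]] by auto
  have gm: "g \<in> borel_measurable lebesgue" using fg by (simp add: has_L2_fourier_def in_L2_def)
  have gh: "AE \<xi> in lborel. g \<xi> = h \<xi> $ i0" using spec[OF h(2), of i0] by (simp add: gv_def)
  have PQ: "(\<lambda>\<xi>. h \<xi> $ i0) = (\<lambda>\<xi>. ?P i0 \<xi> + ?Q i0 \<xi>)"
    by (simp add: dirac_part_def fun_eq_iff field_simps)
  have "weighted_sq w (schrodinger_evolution \<psi> ?p g) =
     ennreal ?c * energy W \<psi> ?p (\<lambda>\<xi>. h \<xi> $ i0)"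
    using spec[OF h(1), of i0] by (intro spacetime_integral_eq_energy[OF W \<psi> cp gm _ gh]) (simp add: annular_def)
  also have "\<dots> \<le> ennreal ?c * (2 * (energy W \<psi> ?p (?P i0) + energy W \<psi> ?p (?Q i0)))"
    unfolding PQ by (intro mult_left_mono energy_add_le[OF W P Q \<psi> cp]) simp
  also have "\<dots> \<le> ennreal ?c * (2 * (\<Sum>i\<in>UNIV. energy W \<psi> ?p (?P i) + energy W \<psi> ?p (?Q i)))"
    by (intro mult_left_mono member_le_sum) auto
  also have "\<dots> = 2 * weighted_sq w (dirac_evolution \<alpha> \<beta> m \<psi> gv)"
    unfolding dirac_spacetime_integral[OF W d spec[OF h(1)] spec[OF h(2)] \<psi>] by (rule mult.left_commute)
  also have "\<dots> \<le> 2 * dirac_smoothing_const \<alpha> \<beta> w \<psi> m"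
  proof (rule mult_left_mono)
    have "(fv, gv) \<in> {(f :: real^'n \<Rightarrow> complex^'N, g).
          (\<forall>i. has_L2_fourier (\<lambda>x. f x $ i) (\<lambda>\<xi>. g \<xi> $ i)) \<and> L2_norm_sq f = 1 \<and> compact_support_off_0 g}"
      using fgv fv1 cv by simp
    then show "weighted_sq w (dirac_evolution \<alpha> \<beta> m \<psi> gv)
        \<le> dirac_smoothing_const \<alpha> \<beta> w \<psi> m"
      unfolding dirac_smoothing_const_def by (rule SUP_upper2) simp
  qed simp
  finally show "weighted_sq w (schrodinger_evolution \<psi> ?p g)
    \<le> 2 * dirac_smoothing_const \<alpha> \<beta> w \<psi> m" .
qed

lemma smoothing_const_rel_dispersion:
  fixes w \<psi> :: "real \<Rightarrow> real"
  assumes W: "represents_weight w (W :: real^'n \<Rightarrow> ennreal)" and \<psi>: "continuous_on {0<..} \<psi>"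
  shows "smoothing_const TYPE('n::finite) w \<psi> (rel_dispersion m) =
    2 * smoothing_const TYPE('n) w (\<lambda>r. sqrt (rel_dispersion m r) * \<psi> r) (\<lambda>r. r\<^sup>2)"
proof -
  let ?p = "rel_dispersion m" and ?c = "(1 / (2 * pi) ^ CARD('n))\<^sup>2 :: real"
  let ?q = "\<lambda>r. sqrt (?p r) * \<psi> r"
  have cp: "continuous_on {0<..} ?p" by (rule dispersion_continuous[OF rel_dispersion_dispersion])
  have cq: "continuous_on {0<..} ?q" by (intro continuous_intros cp \<psi>)
  have ds: "dispersion (\<lambda>r. r\<^sup>2) (\<lambda>r. 2 * r)"
    unfolding dispersion_def by (auto intro!: continuous_intros derivative_eq_intros)
  \<comment> \<open>Both sides equal \<psi>^2 times the relativistic dispersion, divided by r: its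
    derivative is r over itself, while that of r^2 is 2 r. This is the source of the factor
    2.\<close>
  have eq: "(\<psi> r)\<^sup>2 / (r / ?p r) = 2 * ((?q r)\<^sup>2 / (2 * r))" if "0 < r" for r
    using rel_dispersion_pos[OF that, of m] that by (simp add: power_mult_distrib)
  have "weighted_sq w (schrodinger_evolution \<psi> ?p g) =
    2 * weighted_sq w (schrodinger_evolution ?q (\<lambda>r. r\<^sup>2) g)"
    if fg: "has_L2_fourier f g" and c: "compact_support_off_0 g" for f g :: "real^'n \<Rightarrow> complex"
  proof -
    have L: "in_L2 g" and gm: "g \<in> borel_measurable lebesgue" using fg by (auto simp: has_L2_fourier_def in_L2_def)
    obtain h a b where h: "annular h a b" and ae: "AE \<xi> in lborel. g \<xi> = h \<xi>" and "L2_norm_sq g = norm_sq h"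
      using compact_support_off_0_rep[OF L c] .
    have hm: "h \<in> borel_measurable borel" using h by (simp add: annular_def)
    show ?thesis
      unfolding spacetime_integral_eq_energy[OF W \<psi> cp gm hm ae]
        spacetime_integral_eq_energy[OF W cq dispersion_continuous[OF ds] gm hm ae]
        energy_compare[OF W h \<psi> rel_dispersion_dispersion cq ds _ eq, simplified]
      by (simp add: mult.left_commute)
  qed
  \<comment> \<open>The admissible pairs do not depend on the symbols, so the identity for each
    datum passes to the suprema.\<close>
  then show ?thesis
    unfolding smoothing_const_def SUP_mult_left_ennreal by (intro SUP_cong refl) auto
qed

theorem corollary1p6:
  fixes w \<psi> :: "real \<Rightarrow> real" and m :: real
    and \<alpha> :: "'n::finite \<Rightarrow> complex^'N^'N" and \<beta> :: "complex^'N^'N"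
  assumes "CARD('n) \<ge> 2" and "m \<ge> 0"
    and "CARD('N) = 2 ^ ((CARD('n) + 1) div 2)" and "dirac_matrices \<alpha> \<beta>"
    and "standing_assumption TYPE('n) w \<psi> (rel_dispersion m)"
  shows "dirac_smoothing_const \<alpha> \<beta> w \<psi> m \<le> smoothing_const TYPE('n) w \<psi> (rel_dispersion m)
    \<and> smoothing_const TYPE('n) w \<psi> (rel_dispersion m) =
        2 * smoothing_const TYPE('n) w (\<lambda>r. sqrt (rel_dispersion m r) * \<psi> r) (\<lambda>r. r\<^sup>2)
    \<and> (CARD('n) = 2 \<or> CARD('n) = 3 \<longrightarrow>
        smoothing_const TYPE('n) w (\<lambda>r. sqrt (rel_dispersion m r) * \<psi> r) (\<lambda>r. r\<^sup>2) =
          1 / 2 * smoothing_const TYPE('n) w \<psi> (rel_dispersion m)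
      \<and> 1 / 2 * smoothing_const TYPE('n) w \<psi> (rel_dispersion m) \<le>
          dirac_smoothing_const \<alpha> \<beta> w \<psi> m)"
proof -
  have \<psi>: "continuous_on {0<..} \<psi>" and w: "weight_assumption TYPE('n) w"
    using assms(5) unfolding standing_assumption_def by auto
  obtain W :: "real^'n \<Rightarrow> ennreal" where W: "represents_weight w W"
    using weighted_spacetime_integral[OF weight_measurable[OF w]] .
  \<comment> \<open>The scalars are multiplied as finite numbers before meeting \<open>x\<close>, so
    the cancellation also covers an infinite constant.\<close>
  have half: "1 / 2 * (2 * x) = x" for x :: ennreal
  proof -
    have "1 / 2 * (2 * x) = ennreal (1 / 2 * 2) * x"
      by (subst ennreal_mult) (auto simp: divide_ennreal_def mult.assoc)
    then show ?thesis by simp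
  qed
  have eq: "smoothing_const TYPE('n) w \<psi> (rel_dispersion m) =
      2 * smoothing_const TYPE('n) w (\<lambda>r. sqrt (rel_dispersion m r) * \<psi> r) (\<lambda>r. r\<^sup>2)"
    by (rule smoothing_const_rel_dispersion[OF W \<psi>])
  have "1 / 2 * smoothing_const TYPE('n) w \<psi> (rel_dispersion m) \<le> 1 / 2 * (2 * dirac_smoothing_const \<alpha> \<beta> w \<psi> m)"
    by (intro mult_left_mono smoothing_const_le_dirac[OF W assms(4) \<psi>]) simp
  then have le: "1 / 2 * smoothing_const TYPE('n) w \<psi> (rel_dispersion m) \<le> dirac_smoothing_const \<alpha> \<beta> w \<psi> m"
    unfolding half .
  have eq': "smoothing_const TYPE('n) w (\<lambda>r. sqrt (rel_dispersion m r) * \<psi> r) (\<lambda>r. r\<^sup>2) =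
      1 / 2 * smoothing_const TYPE('n) w \<psi> (rel_dispersion m)"
    unfolding eq half ..
  show ?thesis
    using dirac_smoothing_const_le[OF W assms(4) \<psi>] eq eq' le by blast
qed

end
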